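(* There is a deterministic algorithm that, given any graph $G=(V,E,w)$ with $n$ vertices, $m$ edges and edge-weights in $\{1,\ldots,M\}$, computes a $2$-approximation for Girth (i.e., outputs a cycle of $G$ whose weight is at most twice the girth of $G$) in time $\tilde{\mathcal O}(n^{5/3}\,\mathrm{polylog}\,M+m)$.
   Context: Graphs are finite, simple, connected and undirected, given by adjacency lists; $w:E\to\mathbb{R}^+$ is an edge-weight function. The weight of a subgraph is the sum of the weights of its edges. The girth of $G$ is the minimum weight of a cycle of $G$; the Girth problem asks for it. An $\alpha$-approximation for Girth is a cycle of weight at most $\alpha$ times the girth. $\tilde{\mathcal O}(\cdot)$ hides polylogarithmic factors in $n$. *)

theory Defs
  imports Complex_Main "HOL-Library.Extended_Nat"
begin

section \<open>Graphs, cycles and girth\<close>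

text \<open>Vertices are \<open>0, \<dots>, n - 1\<close>; an edge is a two-element set of vertices.\<close>

definition simple_graph :: "nat \<Rightarrow> nat set set \<Rightarrow> bool" where
  "simple_graph n E \<longleftrightarrow> 0 < n \<and> (\<forall>e\<in>E. e \<subseteq> {..<n} \<and> card e = 2)"

definition connected_graph :: "nat \<Rightarrow> nat set set \<Rightarrow> bool" where
  "connected_graph n E \<longleftrightarrow> (\<forall>u<n. \<forall>v<n. (u, v) \<in> {(x, y). {x, y} \<in> E}\<^sup>*)"

text \<open>A cycle is given by its vertices in cyclic order, without repeating the first one.\<close>

definition cycle_edges :: "nat list \<Rightarrow> nat set set" where
  "cycle_edges c = {{c ! i, c ! (Suc i mod length c)} |i. i < length c}"

definition is_cycle :: "nat set set \<Rightarrow> nat list \<Rightarrow> bool" where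
  "is_cycle E c \<longleftrightarrow> 3 \<le> length c \<and> distinct c \<and> cycle_edges c \<subseteq> E"

definition cycle_weight :: "(nat set \<Rightarrow> nat) \<Rightarrow> nat list \<Rightarrow> nat" where
  "cycle_weight w c = (\<Sum>e\<in>cycle_edges c. w e)"

text \<open>The girth of an acyclic graph is \<open>\<infinity>\<close>.\<close>

definition girth :: "nat set set \<Rightarrow> (nat set \<Rightarrow> nat) \<Rightarrow> enat" where
  "girth E w = (INF c\<in>{c. is_cycle E c}. enat (cycle_weight w c))"

definition girth_approximation ::
    "nat \<Rightarrow> nat set set \<Rightarrow> (nat set \<Rightarrow> nat) \<Rightarrow> nat list \<Rightarrow> bool" where
  "girth_approximation \<alpha> E w c \<longleftrightarrow>
     is_cycle E c \<and> enat (cycle_weight w c) \<le> enat \<alpha> * girth E w"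

text \<open>
  Adjacency lists: the \<open>u\<close>-th list contains, in arbitrary order, one pair \<open>(v, w {u, v})\<close> for every
  neighbour \<open>v\<close> of \<open>u\<close>.
\<close>

definition adjacency_lists ::
    "nat \<Rightarrow> nat set set \<Rightarrow> (nat set \<Rightarrow> nat) \<Rightarrow> (nat \<times> nat) list list \<Rightarrow> bool" where
  "adjacency_lists n E w A \<longleftrightarrow> length A = n \<and>
     (\<forall>u<n. distinct (A ! u) \<and> set (A ! u) = {(v, w {u, v}) |v. {u, v} \<in> E})"


section \<open>A unit-cost word RAM\<close>

text \<open>
  Programs are structured RAM programs over registers and an indirectly addressed memory. A program
  is a fixed finite object, hence uses finitely many registers. All elementary operations and tests
  cost one time unit. To make the unit-cost measure legitimate, words hold the natural numbers below
  a bound \<open>B\<close>: an operation whose result is not below \<open>B\<close> has no transition, so that a computation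
  that overflows does not terminate successfully. As registers start at 0, every register content,
  stored value and address is below \<open>B\<close> throughout a run.
\<close>

type_synonym reg = nat

datatype arith_op = Plus | Minus | Times | Div

datatype cond = Eq reg reg | Neq reg reg | Less reg reg | Leq reg reg

datatype com =
    Skip
  | Const reg nat
  | Arith arith_op reg reg reg
  | Load reg reg
  | Store reg reg
  | Seq com com
  | Ite cond com com
  | While cond com

record state =
  regs :: "reg \<Rightarrow> nat"
  mem :: "nat \<Rightarrow> nat"

text \<open>Subtraction is truncated at 0, and division by 0 yields 0, as on type \<open>nat\<close>.\<close>

fun arith_val :: "arith_op \<Rightarrow> nat \<Rightarrow> nat \<Rightarrow> nat" where
  "arith_val Plus x y = x + y"
| "arith_val Minus x y = x - y"
| "arith_val Times x y = x * y"
| "arith_val Div x y = x div y"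

fun cond_val :: "cond \<Rightarrow> state \<Rightarrow> bool" where
  "cond_val (Eq x y) s \<longleftrightarrow> regs s x = regs s y"
| "cond_val (Neq x y) s \<longleftrightarrow> regs s x \<noteq> regs s y"
| "cond_val (Less x y) s \<longleftrightarrow> regs s x < regs s y"
| "cond_val (Leq x y) s \<longleftrightarrow> regs s x \<le> regs s y"

definition set_reg :: "reg \<Rightarrow> nat \<Rightarrow> state \<Rightarrow> state" where
  "set_reg x v s = s\<lparr>regs := (regs s)(x := v)\<rparr>"

text \<open>
  \<open>exec B p s t s'\<close>: with words below \<open>B\<close>, program \<open>p\<close> started in \<open>s\<close> halts in \<open>s'\<close> after exactly
  \<open>t\<close> time units.
\<close>

inductive exec :: "nat \<Rightarrow> com \<Rightarrow> state \<Rightarrow> nat \<Rightarrow> state \<Rightarrow> bool" for B :: nat where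
  Skip: "exec B Skip s 1 s"
| Const: "v < B \<Longrightarrow> exec B (Const x v) s 1 (set_reg x v s)"
| Arith: "v = arith_val f (regs s y) (regs s z) \<Longrightarrow> v < B \<Longrightarrow>
    exec B (Arith f x y z) s 1 (set_reg x v s)"
| Load: "v = mem s (regs s y) \<Longrightarrow> v < B \<Longrightarrow> exec B (Load x y) s 1 (set_reg x v s)"
| Store: "exec B (Store x y) s 1 (s\<lparr>mem := (mem s)(regs s x := regs s y)\<rparr>)"
| Seq: "exec B p s t s' \<Longrightarrow> exec B q s' t' s'' \<Longrightarrow> exec B (Seq p q) s (t + t') s''"
| IteTrue: "cond_val b s \<Longrightarrow> exec B p s t s' \<Longrightarrow> exec B (Ite b p q) s (1 + t) s'"
| IteFalse: "\<not> cond_val b s \<Longrightarrow> exec B q s t s' \<Longrightarrow> exec B (Ite b p q) s (1 + t) s'"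
| WhileFalse: "\<not> cond_val b s \<Longrightarrow> exec B (While b p) s 1 s"
| WhileTrue: "cond_val b s \<Longrightarrow> exec B p s t s' \<Longrightarrow> exec B (While b p) s' t' s'' \<Longrightarrow>
    exec B (While b p) s (1 + t + t') s''"

inductive_cases exec_SkipE: "exec B Skip s t s'"
inductive_cases exec_ConstE: "exec B (Const x v) s t s'"
inductive_cases exec_ArithE: "exec B (Arith f x y z) s t s'"
inductive_cases exec_LoadE: "exec B (Load x y) s t s'"
inductive_cases exec_StoreE: "exec B (Store x y) s t s'"
inductive_cases exec_SeqE: "exec B (Seq p q) s t s'"
inductive_cases exec_IteE: "exec B (Ite b p q) s t s'"
inductive_cases exec_WhileE: "exec B (While b p) s t s'"

lemma exec_deterministic:
  "exec B p s t s' \<Longrightarrow> exec B p s u s'' \<Longrightarrow> u = t \<and> s'' = s'"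
proof (induction arbitrary: u s'' rule: exec.induct)
  case (Seq p s t s' q t' r)
  from Seq.prems obtain t1 s1 t2
    where *: "exec B p s t1 s1" "exec B q s1 t2 s''" "u = t1 + t2"
    by (cases rule: exec_SeqE) auto
  have eq: "t1 = t" "s1 = s'" using Seq.IH(1)[OF *(1)] by auto
  show ?case using Seq.IH(2)[OF *(2)[unfolded eq]] *(3) eq by auto
next
  case (IteTrue b s p t s' q)
  from IteTrue.prems IteTrue.hyps(1) obtain t1 where *: "exec B p s t1 s''" "u = Suc t1"
    by (cases rule: exec_IteE) auto
  show ?case using IteTrue.IH[OF *(1)] *(2) by simp
next
  case (IteFalse b s q t s' p)
  from IteFalse.prems IteFalse.hyps(1) obtain t1 where *: "exec B q s t1 s''" "u = Suc t1"
    by (cases rule: exec_IteE) auto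
  show ?case using IteFalse.IH[OF *(1)] *(2) by simp
next
  case (WhileFalse b s p)
  from WhileFalse.prems WhileFalse.hyps show ?case
    by (cases rule: exec_WhileE) auto
next
  case (WhileTrue b s p t s' t' r)
  from WhileTrue.prems WhileTrue.hyps(1) obtain t1 s1 t2
    where *: "exec B p s t1 s1" "exec B (While b p) s1 t2 s''" "u = Suc (t1 + t2)"
    by (cases rule: exec_WhileE) auto
  have eq: "t1 = t" "s1 = s'" using WhileTrue.IH(1)[OF *(1)] by auto
  show ?case using WhileTrue.IH(2)[OF *(2)[unfolded eq]] *(3) eq by auto
qed (auto elim: exec_SkipE exec_ConstE exec_ArithE exec_LoadE exec_StoreE)


section \<open>Input and output conventions\<close>

text \<open>
  The input occupies an initial segment of memory. Cell 0 contains \<open>n\<close>. For \<open>u < n\<close>, cell \<open>1 + u\<close>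
  contains the address at which the adjacency list of \<open>u\<close> starts, and cell \<open>1 + n\<close> contains the
  address just behind the last list. The lists follow, each entry \<open>(v, k)\<close> taking two cells.
\<close>

definition encode_graph :: "(nat \<times> nat) list list \<Rightarrow> nat list" where
  "encode_graph A =
     [length A] @
     map (\<lambda>u. 2 + length A + 2 * length (concat (take u A))) [0..<Suc (length A)] @
     concat (map (\<lambda>(v, k). [v, k]) (concat A))"

definition initial_state :: "nat list \<Rightarrow> state" where
  "initial_state xs = \<lparr>regs = \<lambda>_. 0, mem = \<lambda>a. if a < length xs then xs ! a else 0\<rparr>"

text \<open>Register 0 contains the start address of the output and register 1 its length.\<close>

definition output_of :: "state \<Rightarrow> nat list" where
  "output_of s = map (mem s) [regs s 0..<regs s 0 + regs s 1]"

end

(* Search from a vertex v with lazily scanned, weight-sorted adjacency lists and stop at the first edge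
   that closes a cycle: if it is scanned at radius k, its cycle has weight at most 2 k, and before
   that the scanned edges form a shortest-path tree. Let C be a shortest cycle, of weight g, and v a
   vertex of C. Stop the search from v after about n^(1/3) vertices. If it ends for another reason,
   it has found a cycle of weight at most 2 g, since C itself would be closed by radius g. Otherwise
   a greedy hitting set S of size O(n^(2/3) log n) contains some vertex u of the ball of v, at
   distance r, say. If every edge of C is scanned from u by radius g, then the unbounded search from
   u finds a cycle of weight at most 2 g. If not, r exceeds the distance of every vertex of C from v,
   so that C lies in the ball, and testing all pairs of vertices of the ball finds an edge that closes
   a cycle of weight at most g. No guess of g is needed, hence no dependence on M. The n balls and
   the |S| unbounded searches take n^(5/3) steps each, up to logarithmic factors. *)

theory Submission imports Defs begin

section \<open>A language with variables and arrays\<close>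

text \<open>The exponent is a balance: with balls of size \<open>L\<close>, testing pairs costs
  about n L^2 in total, and the hitting set calls for about (n / L) log n searches of cost n log n
  each; L = n^(1/3) equalises the two. The budget n^(5/3) + m rules out clearing a table of n^2
  cells, although an adjacency matrix and a membership matrix of the balls are used. Both rely on
  memory being 0 initially: only their nonzero entries are written, and after each search just the
  visited vertices are reset. A search costs O(log n) per visited vertex whatever the degrees,
  because a scanned edge either visits a new vertex or ends the search; the entry leading back to
  the parent is stepped over once. The value recorded for a closing edge is the weight of a closed
  walk through the root; a simple cycle, no heavier, is extracted only if that value improves the
  best one so far. Since an overflowing computation has no run at all, every correctness statement
  also carries bounds on words, which is why the search invariant tracks depths against
  \<open>M\<close>.\<close>

datatype exp = N nat | V nat | Rd nat exp | Bin arith_op exp exp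

datatype cmp = CEq | CNeq | CLess | CLeq

datatype prog =
    SKIP
  | Asg nat exp
  | St nat exp exp
  | Sq prog prog (infixr \<open>;;\<close> 60)
  | IF cmp exp exp prog prog
  | WH cmp exp exp prog

datatype hst = Hst (vr: "nat \<Rightarrow> nat") (ar: "nat \<Rightarrow> nat \<Rightarrow> nat")

definition setv :: "nat \<Rightarrow> nat \<Rightarrow> hst \<Rightarrow> hst" where
  "setv x v s = Hst ((vr s)(x := v)) (ar s)"

definition seta :: "nat \<Rightarrow> nat \<Rightarrow> nat \<Rightarrow> hst \<Rightarrow> hst" where
  "seta a i v s = Hst (vr s) ((ar s)(a := (ar s a)(i := v)))"

lemma set_simps [simp]:
  "vr (setv x v s) y = (if y = x then v else vr s y)"
  "ar (setv x v s) = ar s"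
  "vr (seta a i v s) = vr s"
  "ar (seta a i v s) b = (if b = a then (ar s a)(i := v) else ar s b)"
  by (simp_all add: setv_def seta_def)

fun ev :: "exp \<Rightarrow> hst \<Rightarrow> nat" where
  "ev (N c) s = c"
| "ev (V x) s = vr s x"
| "ev (Rd a e) s = ar s a (ev e s)"
| "ev (Bin f d e) s = arith_val f (ev d s) (ev e s)"

fun cmpv :: "cmp \<Rightarrow> nat \<Rightarrow> nat \<Rightarrow> bool" where
  "cmpv CEq x y \<longleftrightarrow> x = y"
| "cmpv CNeq x y \<longleftrightarrow> x \<noteq> y"
| "cmpv CLess x y \<longleftrightarrow> x < y"
| "cmpv CLeq x y \<longleftrightarrow> x \<le> y"

text \<open>
  Values are kept below \<open>H\<close>. Array 0 is the initial memory segment of length \<open>F\<close>, which holds the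
  input and, in the end, the output.
\<close>

fun ok :: "nat \<Rightarrow> nat \<Rightarrow> exp \<Rightarrow> hst \<Rightarrow> bool" where
  "ok H F (N c) s \<longleftrightarrow> c < H"
| "ok H F (V x) s \<longleftrightarrow> True"
| "ok H F (Rd a e) s \<longleftrightarrow> ok H F e s \<and> (a = 0 \<longrightarrow> ev e s < F)"
| "ok H F (Bin f d e) s \<longleftrightarrow> ok H F d s \<and> ok H F e s \<and>
    (f = Plus \<or> f = Times \<longrightarrow> arith_val f (ev d s) (ev e s) < H)"

text \<open>Evaluating an expression is free at this level. The compiler pays for it with a factor
  that depends on the program text only, so asymptotic costs can be counted in statements and
  tests.\<close>

inductive hex :: "nat \<Rightarrow> nat \<Rightarrow> prog \<Rightarrow> hst \<Rightarrow> nat \<Rightarrow> hst \<Rightarrow> bool" for H F where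
  Skip: "hex H F SKIP s 1 s"
| Asg: "ok H F e s \<Longrightarrow> hex H F (Asg x e) s 1 (setv x (ev e s) s)"
| St: "ok H F i s \<Longrightarrow> ok H F e s \<Longrightarrow> (a = 0 \<longrightarrow> ev i s < F) \<Longrightarrow>
    hex H F (St a i e) s 1 (seta a (ev i s) (ev e s) s)"
| Sq: "hex H F p s t s' \<Longrightarrow> hex H F q s' t' s'' \<Longrightarrow> hex H F (p ;; q) s (t + t') s''"
| IfT: "ok H F d s \<Longrightarrow> ok H F e s \<Longrightarrow> cmpv c (ev d s) (ev e s) \<Longrightarrow> hex H F p s t s' \<Longrightarrow>
    hex H F (IF c d e p q) s (t + 1) s'"
| IfF: "ok H F d s \<Longrightarrow> ok H F e s \<Longrightarrow> \<not> cmpv c (ev d s) (ev e s) \<Longrightarrow> hex H F q s t s' \<Longrightarrow>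
    hex H F (IF c d e p q) s (t + 1) s'"
| WhF: "ok H F d s \<Longrightarrow> ok H F e s \<Longrightarrow> \<not> cmpv c (ev d s) (ev e s) \<Longrightarrow>
    hex H F (WH c d e p) s 1 s"
| WhT: "ok H F d s \<Longrightarrow> ok H F e s \<Longrightarrow> cmpv c (ev d s) (ev e s) \<Longrightarrow> hex H F p s t s' \<Longrightarrow>
    hex H F (WH c d e p) s' t' s'' \<Longrightarrow> hex H F (WH c d e p) s (t + t' + 1) s''"

definition bounded :: "nat \<Rightarrow> hst \<Rightarrow> bool" where
  "bounded H s \<longleftrightarrow> (\<forall>x. vr s x < H) \<and> (\<forall>a i. ar s a i < H)"

text \<open>\<open>ok\<close> guards only \<open>Plus\<close> and \<open>Times\<close>: truncated
  subtraction and division never exceed their left operand and inherit its bound.\<close>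

lemma ev_bounded: "bounded H s \<Longrightarrow> ok H F e s \<Longrightarrow> ev e s < H"
proof (induction e)
  case (Bin f d e)
  then show ?case
    by (cases f) (auto intro: le_less_trans[OF diff_le_self] le_less_trans[OF div_le_dividend])
qed (auto simp: bounded_def)

lemma hex_bounded: "hex H F p s t s' \<Longrightarrow> bounded H s \<Longrightarrow> bounded H s'"
proof (induction rule: hex.induct)
  case (Asg e s x)
  then show ?case using ev_bounded by (auto simp: bounded_def)
next
  case (St i s e a)
  then have "ev e s < H" by (blast intro: ev_bounded)
  with St show ?case by (auto simp: bounded_def)
qed auto

subsection \<open>Compilation\<close>

text \<open>
  Variable \<open>x\<close> lives in register \<open>2 * x + 1\<close>, the temporaries in the even registers from 4 on.
  Register 0 remains 0, register 2 holds \<open>F\<close>. Element \<open>i\<close> of array \<open>a\<close> with \<open>1 \<le> a < 16\<close> is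
  interleaved with those of the other arrays.
\<close>

abbreviation tmp :: "nat \<Rightarrow> reg" where "tmp k \<equiv> 2 * k + 4"

definition adr :: "nat \<Rightarrow> nat \<Rightarrow> com" where
  "adr a k = (if a = 0 then Skip else
     Seq (Const (tmp (Suc k)) 16) (Seq (Arith Times (tmp k) (tmp k) (tmp (Suc k)))
     (Seq (Const (tmp (Suc k)) a) (Seq (Arith Plus (tmp k) (tmp k) (tmp (Suc k)))
     (Arith Plus (tmp k) (tmp k) 2)))))"

definition adr_val :: "nat \<Rightarrow> nat \<Rightarrow> nat \<Rightarrow> nat" where
  "adr_val F a i = (if a = 0 then i else F + 16 * i + a)"

fun ce :: "nat \<Rightarrow> exp \<Rightarrow> com" where
  "ce k (N c) = Const (tmp k) c"
| "ce k (V x) = Arith Plus (tmp k) (2 * x + 1) 0"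
| "ce k (Rd a e) = Seq (ce k e) (Seq (adr a k) (Load (tmp k) (tmp k)))"
| "ce k (Bin f d e) = Seq (ce k d) (Seq (ce (Suc k) e) (Arith f (tmp k) (tmp k) (tmp (Suc k))))"

fun ccond :: "cmp \<Rightarrow> reg \<Rightarrow> reg \<Rightarrow> cond" where
  "ccond CEq x y = Eq x y"
| "ccond CNeq x y = Neq x y"
| "ccond CLess x y = Less x y"
| "ccond CLeq x y = Leq x y"

definition cc :: "exp \<Rightarrow> exp \<Rightarrow> com" where
  "cc d e = Seq (ce 0 d) (ce 1 e)"

fun cp :: "prog \<Rightarrow> com" where
  "cp SKIP = Skip"
| "cp (Asg x e) = Seq (ce 0 e) (Arith Plus (2 * x + 1) (tmp 0) 0)"
| "cp (St a i e) = Seq (ce 0 i) (Seq (adr a 0) (Seq (ce 1 e) (Store (tmp 0) (tmp 1))))"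
| "cp (p ;; q) = Seq (cp p) (cp q)"
| "cp (IF c d e p q) = Seq (cc d e) (Ite (ccond c (tmp 0) (tmp 1)) (cp p) (cp q))"
| "cp (WH c d e p) = Seq (cc d e) (While (ccond c (tmp 0) (tmp 1)) (Seq (cp p) (cc d e)))"

text \<open>Counts machine instructions; the 6 charged for a read, and for a store in
  \<open>psz\<close>, is the five instructions of \<open>adr\<close> plus the memory access.\<close>

fun esz :: "exp \<Rightarrow> nat" where
  "esz (N c) = 1"
| "esz (V x) = 1"
| "esz (Rd a e) = esz e + 6"
| "esz (Bin f d e) = esz d + esz e + 1"

fun psz :: "prog \<Rightarrow> nat" where
  "psz SKIP = 1"
| "psz (Asg x e) = esz e + 1"
| "psz (St a i e) = esz i + esz e + 6"
| "psz (p ;; q) = psz p + psz q"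
| "psz (IF c d e p q) = esz d + esz e + 1 + psz p + psz q"
| "psz (WH c d e p) = esz d + esz e + 1 + psz p"

fun earr :: "exp \<Rightarrow> nat set" where
  "earr (N c) = {}"
| "earr (V x) = {}"
| "earr (Rd a e) = insert a (earr e)"
| "earr (Bin f d e) = earr d \<union> earr e"

fun parr :: "prog \<Rightarrow> nat set" where
  "parr SKIP = {}"
| "parr (Asg x e) = earr e"
| "parr (St a i e) = insert a (earr i \<union> earr e)"
| "parr (p ;; q) = parr p \<union> parr q"
| "parr (IF c d e p q) = earr d \<union> earr e \<union> parr p \<union> parr q"
| "parr (WH c d e p) = earr d \<union> earr e \<union> parr p"

text \<open>The even registers from 4 on are left unconstrained, so that temporaries can be
  overwritten without breaking the simulation.\<close>

definition rel :: "nat \<Rightarrow> hst \<Rightarrow> state \<Rightarrow> bool" where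
  "rel F s z \<longleftrightarrow> (\<forall>x. regs z (2 * x + 1) = vr s x) \<and> regs z 0 = 0 \<and> regs z 2 = F \<and>
     (\<forall>i<F. mem z i = ar s 0 i) \<and> (\<forall>a<16. 0 < a \<longrightarrow> (\<forall>i. mem z (adr_val F a i) = ar s a i))"

lemma set_reg_simps [simp]:
  "regs (set_reg x v z) y = (if y = x then v else regs z y)"
  "mem (set_reg x v z) = mem z"
  by (simp_all add: set_reg_def)

text \<open>Remainder and quotient modulo 16 recover the array and the index; array 0 is kept apart
  by lying below \<open>F\<close>.\<close>

lemma adr_val_inj:
  assumes "adr_val F a i = adr_val F b j" "a < 16" "b < 16"
    and "a = 0 \<Longrightarrow> i < F" "b = 0 \<Longrightarrow> j < F"
  shows "a = b" "i = j"
proof -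
  have *: "a = b \<and> i = j" if "16 * i + a = 16 * j + b"
    using arg_cong[OF that, of "\<lambda>x. x mod 16"] arg_cong[OF that, of "\<lambda>x. x div 16"] assms(2,3)
    by simp
  show "a = b" "i = j"
    using assms * by (cases "a = 0"; cases "b = 0"; simp add: adr_val_def)+
qed

lemmas exec_step = exec.Skip exec.Const exec.Arith exec.Load
lemmas exec_step' = exec_step[unfolded One_nat_def]

lemma adr_exec:
  assumes "regs z (tmp k) < H" "regs z 2 = F" "a < 16" "F + 16 * H + 16 \<le> B"
  shows "\<exists>t z'. exec B (adr a k) z t z' \<and> t \<le> 5 \<and> mem z' = mem z \<and>
    regs z' (tmp k) = adr_val F a (regs z (tmp k)) \<and>
    (\<forall>r. r < tmp k \<or> odd r \<longrightarrow> regs z' r = regs z r)"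
proof (cases "a = 0")
  case True
  then show ?thesis
    by (intro exI[of _ 1] exI[of _ z]) (auto simp: adr_def adr_val_def intro: exec_step')
next
  case False
  define i where "i = regs z (tmp k)"
  define z1 where "z1 = set_reg (tmp (Suc k)) 16 z"
  define z2 where "z2 = set_reg (tmp k) (i * 16) z1"
  define z3 where "z3 = set_reg (tmp (Suc k)) a z2"
  define z4 where "z4 = set_reg (tmp k) (i * 16 + a) z3"
  define z5 where "z5 = set_reg (tmp k) (i * 16 + a + F) z4"
  have b: "i < H" "F + 16 * H + 16 \<le> B" using assms by (auto simp: i_def)
  have "exec B (Const (tmp (Suc k)) 16) z 1 z1"
    unfolding z1_def using b by (intro exec.Const) auto
  moreover have "exec B (Arith Times (tmp k) (tmp k) (tmp (Suc k))) z1 1 z2"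
    unfolding z2_def using b by (intro exec.Arith) (auto simp: z1_def i_def)
  moreover have "exec B (Const (tmp (Suc k)) a) z2 1 z3"
    unfolding z3_def using b assms(3) by (intro exec.Const) auto
  moreover have "exec B (Arith Plus (tmp k) (tmp k) (tmp (Suc k))) z3 1 z4"
    unfolding z4_def using b assms(3) by (intro exec.Arith) (auto simp: z1_def z2_def z3_def)
  moreover have "exec B (Arith Plus (tmp k) (tmp k) 2) z4 1 z5"
    unfolding z5_def using b assms(2,3)
    by (intro exec.Arith) (auto simp: z1_def z2_def z3_def z4_def)
  ultimately have "exec B (adr a k) z (1 + (1 + (1 + (1 + 1)))) z5"
    using False by (simp only: adr_def if_False) (intro exec.Seq)
  moreover have "mem z5 = mem z \<and> regs z5 (tmp k) = adr_val F a (regs z (tmp k)) \<and>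
      (\<forall>r. r < tmp k \<or> odd r \<longrightarrow> regs z5 r = regs z r)"
    using False by (auto simp: z1_def z2_def z3_def z4_def z5_def adr_val_def i_def)
  ultimately show ?thesis
    by (intro exI[of _ "1 + (1 + (1 + (1 + 1)))"] exI[of _ z5]) simp
qed

lemma rel_cong:
  assumes "rel F s z" "mem z' = mem z" "\<And>r. r < 4 \<or> odd r \<Longrightarrow> regs z' r = regs z r"
  shows "rel F s z'"
  using assms by (auto simp: rel_def)

text \<open>Temporaries form a stack: code generated at level \<open>k\<close> leaves all lower
  temporaries alone, so a left operand survives the evaluation of the right one at level
  \<open>Suc k\<close>.\<close>

lemma ce_exec:
  assumes "bounded H s" "rel F s z" "earr e \<subseteq> {..<16}" "ok H F e s" "F + 16 * H + 16 \<le> B"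
  shows "\<exists>t z'. exec B (ce k e) z t z' \<and> t \<le> esz e \<and> mem z' = mem z \<and>
    regs z' (tmp k) = ev e s \<and> (\<forall>r. r < tmp k \<or> odd r \<longrightarrow> regs z' r = regs z r)"
  using assms(2-4)
proof (induction e arbitrary: k z)
  case (N c)
  then show ?case using assms(5)
    by (intro exI[of _ 1] exI[of _ "set_reg (tmp k) c z"]) (auto intro!: exec_step')
next
  case (V x)
  have "vr s x < B" using assms(1,5) by (auto simp: bounded_def intro: less_le_trans)
  with V show ?case
    by (intro exI[of _ 1] exI[of _ "set_reg (tmp k) (vr s x) z"])
      (auto intro!: exec_step' simp: rel_def)
next
  case (Rd a e)
  have e: "a < 16" "earr e \<subseteq> {..<16}" "ok H F e s" "a = 0 \<longrightarrow> ev e s < F" using Rd.prems by auto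
  obtain t1 z1 where 1: "exec B (ce k e) z t1 z1" "t1 \<le> esz e"
    "mem z1 = mem z" "regs z1 (tmp k) = ev e s" "\<forall>r. r < tmp k \<or> odd r \<longrightarrow> regs z1 r = regs z r"
    using Rd.IH[OF Rd.prems(1) e(2,3), of k] by blast
  have r1: "rel F s z1" by (rule rel_cong[OF Rd.prems(1)]) (use 1 in auto)
  have "regs z1 (tmp k) < H" "regs z1 2 = F"
    using ev_bounded[OF assms(1) e(3)] r1 1 by (auto simp: rel_def)
  from adr_exec[OF this e(1) assms(5)] obtain t2 z2 where 2: "exec B (adr a k) z1 t2 z2" "t2 \<le> 5"
    "mem z2 = mem z1" "regs z2 (tmp k) = adr_val F a (ev e s)"
    "\<forall>r. r < tmp k \<or> odd r \<longrightarrow> regs z2 r = regs z1 r"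
    unfolding 1(4) by blast
  have r2: "rel F s z2" using 2 by (intro rel_cong[OF r1]) auto
  have m: "mem z2 (adr_val F a (ev e s)) = ar s a (ev e s)"
    using r2 e by (cases "a = 0") (auto simp: rel_def adr_val_def)
  have "ar s a (ev e s) < H" "H \<le> B" using assms(1,5) by (auto simp: bounded_def)
  then have "ar s a (ev e s) < B" by simp
  then have 3: "exec B (Load (tmp k) (tmp k)) z2 1 (set_reg (tmp k) (ar s a (ev e s)) z2)"
    using 2 m by (intro exec.Load) auto
  have "exec B (ce k (Rd a e)) z (t1 + (t2 + 1)) (set_reg (tmp k) (ar s a (ev e s)) z2)"
    using exec.Seq[OF 1(1) exec.Seq[OF 2(1) 3]] by simp
  then show ?case using 1 2
    by (rule_tac exI[of _ "t1 + (t2 + 1)"], rule_tac exI[of _ "set_reg (tmp k) (ar s a (ev e s)) z2"])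
      auto
next
  case (Bin f d e)
  have e: "earr d \<subseteq> {..<16}" "earr e \<subseteq> {..<16}" "ok H F d s" "ok H F e s"
    using Bin.prems by auto
  obtain t1 z1 where 1: "exec B (ce k d) z t1 z1" "t1 \<le> esz d"
    "mem z1 = mem z" "regs z1 (tmp k) = ev d s" "\<forall>r. r < tmp k \<or> odd r \<longrightarrow> regs z1 r = regs z r"
    using Bin.IH(1)[OF Bin.prems(1) e(1,3), of k] by blast
  have r1: "rel F s z1" by (rule rel_cong[OF Bin.prems(1)]) (use 1 in auto)
  obtain t2 z2 where 2: "exec B (ce (Suc k) e) z1 t2 z2"
    "t2 \<le> esz e" "mem z2 = mem z1" "regs z2 (tmp (Suc k)) = ev e s"
    "\<forall>r. r < tmp (Suc k) \<or> odd r \<longrightarrow> regs z2 r = regs z1 r"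
    using Bin.IH(2)[OF r1 e(2,4), of "Suc k"] by blast
  define v where "v = arith_val f (ev d s) (ev e s)"
  have "v < H" using ev_bounded[OF assms(1) Bin.prems(3)] by (simp add: v_def)
  then have "v < B" using assms(5) by simp
  then have 3: "exec B (Arith f (tmp k) (tmp k) (tmp (Suc k))) z2 1 (set_reg (tmp k) v z2)"
    using 1(4) 2(4) 2(5)[rule_format, of "tmp k"] by (intro exec.Arith) (auto simp: v_def)
  have "exec B (ce k (Bin f d e)) z (t1 + (t2 + 1)) (set_reg (tmp k) v z2)"
    using exec.Seq[OF 1(1) exec.Seq[OF 2(1) 3]] by simp
  then show ?case using 1 2
    by (rule_tac exI[of _ "t1 + (t2 + 1)"], rule_tac exI[of _ "set_reg (tmp k) v z2"])
      (auto simp: v_def)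
qed

lemma ce_execE:
  assumes "bounded H s" "rel F s z" "earr e \<subseteq> {..<16}" "ok H F e s" "F + 16 * H + 16 \<le> B"
  obtains t z' where "exec B (ce k e) z t z'" "t \<le> esz e" "mem z' = mem z"
    "regs z' (tmp k) = ev e s" "\<And>r. r < tmp k \<Longrightarrow> regs z' r = regs z r" "rel F s z'"
proof -
  from ce_exec[OF assms] obtain t z' where *: "exec B (ce k e) z t z'" "t \<le> esz e"
    "mem z' = mem z" "regs z' (tmp k) = ev e s" "\<forall>r. r < tmp k \<or> odd r \<longrightarrow> regs z' r = regs z r"
    by blast
  then have "rel F s z'" by (intro rel_cong[OF assms(2)]) auto
  with * show ?thesis by (intro that) auto
qed

lemma cc_exec:
  assumes "bounded H s" "rel F s z" "earr d \<union> earr e \<subseteq> {..<16}" "ok H F d s" "ok H F e s"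
    "F + 16 * H + 16 \<le> B"
  shows "\<exists>t z'. exec B (cc d e) z t z' \<and> t \<le> esz d + esz e \<and> rel F s z' \<and>
    cond_val (ccond c (tmp 0) (tmp 1)) z' = cmpv c (ev d s) (ev e s)"
proof -
  have e: "earr d \<subseteq> {..<16}" "earr e \<subseteq> {..<16}" using assms(3) by auto
  obtain t1 z1 where 1: "exec B (ce 0 d) z t1 z1" "t1 \<le> esz d" "regs z1 (tmp 0) = ev d s" "rel F s z1"
    by (rule ce_execE[OF assms(1,2) e(1) assms(4,6)]) blast
  obtain t2 z2 where 2: "exec B (ce 1 e) z1 t2 z2" "t2 \<le> esz e" "regs z2 (tmp 1) = ev e s"
      "\<And>r. r < tmp 1 \<Longrightarrow> regs z2 r = regs z1 r" and "rel F s z2"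
    by (rule ce_execE[OF assms(1) 1(4) e(2) assms(5,6)]) blast
  have "exec B (cc d e) z (t1 + t2) z2"
    unfolding cc_def by (rule exec.Seq[OF 1(1) 2(1)])
  moreover have "cond_val (ccond c (tmp 0) (tmp 1)) z2 = cmpv c (ev d s) (ev e s)"
    using 1(3) 2(3) 2(4)[of "tmp 0"] by (cases c) auto
  ultimately show ?thesis using 1(2) 2(2) \<open>rel F s z2\<close> add_mono by blast
qed

text \<open>Induction on the source run. Each source step expands to at most \<open>psz p\<close>
  instructions, a constant for a fixed program, so the simulation loses only a constant
  factor.\<close>

theorem compile_correct:
  assumes "hex H F p s t s'" "bounded H s" "rel F s z" "parr p \<subseteq> {..<16}" "F + 16 * H + 16 \<le> B"
  shows "\<exists>t' z'. exec B (cp p) z t' z' \<and> t' \<le> psz p * t \<and> rel F s' z'"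
  using assms(1-4)
proof (induction arbitrary: z rule: hex.induct)
  case (Skip s)
  then show ?case by (intro exI[of _ 1] exI[of _ z]) (auto intro: exec_step')
next
  case (Asg e s x)
  have e: "earr e \<subseteq> {..<16}" using Asg.prems by simp
  obtain t1 z1 where 1: "exec B (ce 0 e) z t1 z1" "t1 \<le> esz e" "regs z1 (tmp 0) = ev e s"
    and r1: "rel F s z1"
    by (rule ce_execE[OF Asg.prems(1,2) e Asg.hyps assms(5)]) blast
  have "ev e s < B" using ev_bounded[of H s F e] Asg assms(5) by auto
  then have 2: "exec B (Arith Plus (2 * x + 1) (tmp 0) 0) z1 1 (set_reg (2 * x + 1) (ev e s) z1)"
    using 1 r1 by (intro exec.Arith) (auto simp: rel_def)
  have r2: "rel F (setv x (ev e s) s) (set_reg (2 * x + 1) (ev e s) z1)"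
    using r1 by (auto simp: rel_def)
  have "exec B (cp (Asg x e)) z (t1 + 1) (set_reg (2 * x + 1) (ev e s) z1)"
    using exec.Seq[OF 1(1) 2] by simp
  with r2 1 show ?case
    by (intro exI[of _ "t1 + 1"] exI[of _ "set_reg (2 * x + 1) (ev e s) z1"]) (auto simp del: cp.simps)
next
  case (St i s e a)
  have a: "a < 16" "earr i \<subseteq> {..<16}" "earr e \<subseteq> {..<16}" using St.prems by auto
  obtain t1 z1 where 1: "exec B (ce 0 i) z t1 z1" "t1 \<le> esz i" "regs z1 (tmp 0) = ev i s"
    and r1: "rel F s z1"
    by (rule ce_execE[OF St.prems(1,2) a(2) St.hyps(1) assms(5)]) blast
  have iH: "ev i s < H" using ev_bounded St by blast
  have "regs z1 (tmp 0) < H" "regs z1 2 = F" using 1 iH r1 by (auto simp: rel_def)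
  from adr_exec[OF this a(1) assms(5)] obtain t2 z2 where
    2: "exec B (adr a 0) z1 t2 z2" "t2 \<le> 5" "mem z2 = mem z1"
    "regs z2 (tmp 0) = adr_val F a (ev i s)" "\<forall>r. r < tmp 0 \<or> odd r \<longrightarrow> regs z2 r = regs z1 r"
    unfolding 1 by blast
  have r2: "rel F s z2" using 2 by (intro rel_cong[OF r1]) auto
  obtain t3 z3 where 3: "exec B (ce 1 e) z2 t3 z3" "t3 \<le> esz e" "regs z3 (tmp 1) = ev e s"
      "\<And>r. r < tmp 1 \<Longrightarrow> regs z3 r = regs z2 r" and r3: "rel F s z3"
    by (rule ce_execE[OF St.prems(1) r2 a(3) St.hyps(2) assms(5)]) blast
  have 30: "regs z3 (tmp 0) = adr_val F a (ev i s)" using 3(4)[of "tmp 0"] 2 by simp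
  define z4 where "z4 = z3\<lparr>mem := (mem z3)(adr_val F a (ev i s) := ev e s)\<rparr>"
  have 4: "exec B (Store (tmp 0) (tmp 1)) z3 1 z4"
    using exec.Store[of B "tmp 0" "tmp 1" z3] unfolding 30 3 z4_def .
  have inj: "adr_val F b j = adr_val F a (ev i s) \<longleftrightarrow> b = a \<and> j = ev i s"
    if "b < 16" "b = 0 \<Longrightarrow> j < F" for b j
    using adr_val_inj[of F b j a "ev i s"] that a St.hyps by auto
  have z: "adr_val F 0 j = j" for j by (simp add: adr_val_def)
  have r4: "rel F (seta a (ev i s) (ev e s) s) z4"
    using r3 inj inj[of 0, unfolded z] by (auto simp: rel_def z4_def)
  have "exec B (cp (St a i e)) z (t1 + (t2 + (t3 + 1))) z4"
    using exec.Seq[OF 1(1) exec.Seq[OF 2(1) exec.Seq[OF 3(1) 4]]] by simp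
  with r4 1 2 3 show ?case
    by (intro exI[of _ "t1 + (t2 + (t3 + 1))"] exI[of _ z4]) (auto simp del: cp.simps)
next
  case (Sq p s t s' q t' s'')
  from Sq.IH(1)[of z] Sq.prems obtain t1 z1 where
    1: "exec B (cp p) z t1 z1" "t1 \<le> psz p * t" "rel F s' z1" by auto
  from Sq.IH(2)[of z1] Sq.prems 1 Sq.hyps hex_bounded obtain t2 z2 where
    2: "exec B (cp q) z1 t2 z2" "t2 \<le> psz q * t'" "rel F s'' z2" by auto
  have "t1 + t2 \<le> psz (p ;; q) * (t + t')" using 1 2 by (simp add: algebra_simps)
  with exec.Seq[OF 1(1) 2(1)] 2 show ?case by auto
next
  case (IfT d s e c p t s' q)
  have e: "earr d \<union> earr e \<subseteq> {..<16}" using IfT.prems by simp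
  from cc_exec[OF IfT.prems(1,2) e IfT.hyps(1,2) assms(5), of c] IfT.hyps(3) obtain t1 z1 where
    1: "exec B (cc d e) z t1 z1" "t1 \<le> esz d + esz e" "rel F s z1"
      "cond_val (ccond c (tmp 0) (tmp 1)) z1" by blast
  from IfT.IH[of z1] IfT.prems 1 obtain t2 z2 where
    2: "exec B (cp p) z1 t2 z2" "t2 \<le> psz p * t" "rel F s' z2" by auto
  have "t1 + (1 + t2) \<le> psz (IF c d e p q) * (t + 1)"
    using 1 2 by (simp add: algebra_simps)
  with exec.Seq[OF 1(1) exec.IteTrue[OF 1(4) 2(1), of "cp q"]] 2(3) show ?case by (metis cp.simps(5))
next
  case (IfF d s e c q t s' p)
  have e: "earr d \<union> earr e \<subseteq> {..<16}" using IfF.prems by simp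
  from cc_exec[OF IfF.prems(1,2) e IfF.hyps(1,2) assms(5), of c] IfF.hyps(3) obtain t1 z1 where
    1: "exec B (cc d e) z t1 z1" "t1 \<le> esz d + esz e" "rel F s z1"
      "\<not> cond_val (ccond c (tmp 0) (tmp 1)) z1" by blast
  from IfF.IH[of z1] IfF.prems 1 obtain t2 z2 where
    2: "exec B (cp q) z1 t2 z2" "t2 \<le> psz q * t" "rel F s' z2" by auto
  have "t1 + (1 + t2) \<le> psz (IF c d e p q) * (t + 1)"
    using 1 2 by (simp add: algebra_simps)
  with exec.Seq[OF 1(1) exec.IteFalse[OF 1(4) 2(1), of "cp p"]] 2(3) show ?case by (metis cp.simps(5))
next
  case (WhF d s e c p)
  have e: "earr d \<union> earr e \<subseteq> {..<16}" using WhF.prems by simp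
  from cc_exec[OF WhF.prems(1,2) e WhF.hyps(1,2) assms(5), of c] WhF.hyps(3) obtain t1 z1 where
    1: "exec B (cc d e) z t1 z1" "t1 \<le> esz d + esz e" "rel F s z1"
      "\<not> cond_val (ccond c (tmp 0) (tmp 1)) z1" by blast
  have "t1 + 1 \<le> psz (WH c d e p) * 1" using 1 by simp
  with exec.Seq[OF 1(1) exec.WhileFalse[OF 1(4)]] 1(3) show ?case by (metis cp.simps(6))
next
  case (WhT d s e c p t s' t' s'')
  have e: "earr d \<union> earr e \<subseteq> {..<16}" using WhT.prems by simp
  from cc_exec[OF WhT.prems(1,2) e WhT.hyps(1,2) assms(5), of c] WhT.hyps(3) obtain t1 z1 where
    1: "exec B (cc d e) z t1 z1" "t1 \<le> esz d + esz e" "rel F s z1"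
      "cond_val (ccond c (tmp 0) (tmp 1)) z1" by blast
  from WhT.IH(1)[of z1] WhT.prems 1 obtain t2 z2 where
    2: "exec B (cp p) z1 t2 z2" "t2 \<le> psz p * t" "rel F s' z2" by auto
  from WhT.IH(2)[of z2] WhT.prems 2 WhT.hyps hex_bounded obtain t3 z3 where
    3: "exec B (cp (WH c d e p)) z2 t3 z3" "t3 \<le> psz (WH c d e p) * t'" "rel F s'' z3" by auto
  \<comment> \<open>The compiled loop evaluates its guard at the end of the body. The guard
    evaluation that opens the simulation of the remaining iterations is therefore split off and
    attached to the present body.\<close>
  from 3(1)[unfolded cp.simps] obtain ta za tb where
    4: "exec B (cc d e) z2 ta za"
      "exec B (While (ccond c (tmp 0) (tmp 1)) (Seq (cp p) (cc d e))) za tb z3" "t3 = ta + tb"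
    by (auto elim: exec_SeqE)
  have "exec B (cp (WH c d e p)) z (t1 + (1 + (t2 + ta) + tb)) z3"
    unfolding cp.simps
    by (rule exec.Seq[OF 1(1) exec.WhileTrue[OF 1(4) exec.Seq[OF 2(1) 4(1)] 4(2)]])
  moreover have "t1 + (1 + (t2 + ta) + tb) \<le> psz (WH c d e p) * (t + t' + 1)"
  proof -
    have "t1 + (1 + (t2 + ta) + tb) \<le> esz d + esz e + 1 + psz p * t + psz (WH c d e p) * t'"
      using 1 2 3 4 by linarith
    also have "\<dots> \<le> psz (WH c d e p) * (t + t' + 1)" by (simp add: algebra_simps)
    finally show ?thesis .
  qed
  ultimately show ?case using 3(3) by blast
qed

subsection \<open>Weakest preconditions with time\<close>

fun wv :: "prog \<Rightarrow> nat set" where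
  "wv SKIP = {}"
| "wv (Asg x e) = {x}"
| "wv (St a i e) = {}"
| "wv (p ;; q) = wv p \<union> wv q"
| "wv (IF c d e p q) = wv p \<union> wv q"
| "wv (WH c d e p) = wv p"

fun wa :: "prog \<Rightarrow> nat set" where
  "wa SKIP = {}"
| "wa (Asg x e) = {}"
| "wa (St a i e) = {a}"
| "wa (p ;; q) = wa p \<union> wa q"
| "wa (IF c d e p q) = wa p \<union> wa q"
| "wa (WH c d e p) = wa p"

lemma hex_frame:
  "hex H F p s t s' \<Longrightarrow>
    (\<forall>x. x \<notin> wv p \<longrightarrow> vr s' x = vr s x) \<and> (\<forall>a. a \<notin> wa p \<longrightarrow> ar s' a = ar s a)"
  by (induction rule: hex.induct) auto

text \<open>Existence of a run makes this total correctness. As an overflow has no transition,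
  proving such a statement includes proving that sums and products stay below
  \<open>H\<close>.\<close>

definition wp :: "nat \<Rightarrow> nat \<Rightarrow> prog \<Rightarrow> (nat \<Rightarrow> hst \<Rightarrow> bool) \<Rightarrow> hst \<Rightarrow> bool" where
  "wp H F p Q s \<longleftrightarrow> (\<exists>t s'. hex H F p s t s' \<and> Q t s')"

lemma wp_SKIP: "Q 1 s \<Longrightarrow> wp H F SKIP Q s"
  unfolding wp_def by (blast intro: hex.Skip)

lemma wp_Asg: "ok H F e s \<Longrightarrow> Q 1 (setv x (ev e s) s) \<Longrightarrow> wp H F (Asg x e) Q s"
  unfolding wp_def by (blast intro: hex.Asg)

lemma wp_St: "ok H F i s \<Longrightarrow> ok H F e s \<Longrightarrow> (a = 0 \<longrightarrow> ev i s < F) \<Longrightarrow>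
    Q 1 (seta a (ev i s) (ev e s) s) \<Longrightarrow> wp H F (St a i e) Q s"
  unfolding wp_def by (blast intro: hex.St)

lemma wp_Sq:
  assumes "wp H F p (\<lambda>t s'. wp H F q (\<lambda>t'. Q (t + t')) s') s"
  shows "wp H F (p ;; q) Q s"
  using assms unfolding wp_def by (blast intro: hex.Sq)

lemma wp_IF:
  assumes "ok H F d s" "ok H F e s"
    and "cmpv c (ev d s) (ev e s) \<Longrightarrow> wp H F p (\<lambda>t. Q (t + 1)) s"
    and "\<not> cmpv c (ev d s) (ev e s) \<Longrightarrow> wp H F q (\<lambda>t. Q (t + 1)) s"
  shows "wp H F (IF c d e p q) Q s"
  using assms unfolding wp_def by (metis hex.IfT hex.IfF)

inductive_cases hex_SKIP: "hex H F SKIP s t s'"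
inductive_cases hex_Asg: "hex H F (Asg x e) s t s'"
inductive_cases hex_St: "hex H F (St a i e) s t s'"
inductive_cases hex_Sq: "hex H F (p ;; q) s t s'"
inductive_cases hex_IF: "hex H F (IF c d e p q) s t s'"

text \<open>As equations, these rules let the simplifier execute straight-line code symbolically;
  loops are left to \<open>wp_WH\<close> and \<open>wp_FOR\<close>.\<close>

lemma wp_eqs:
  "wp H F SKIP Q s \<longleftrightarrow> Q 1 s"
  "wp H F (Asg x e) Q s \<longleftrightarrow> ok H F e s \<and> Q 1 (setv x (ev e s) s)"
  "wp H F (St a i e) Q s \<longleftrightarrow> ok H F i s \<and> ok H F e s \<and> (a = 0 \<longrightarrow> ev i s < F) \<and>
     Q 1 (seta a (ev i s) (ev e s) s)"
  "wp H F (p ;; q) Q s \<longleftrightarrow> wp H F p (\<lambda>t s'. wp H F q (\<lambda>t'. Q (t + t')) s') s"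
  "wp H F (IF c d e p q) Q s \<longleftrightarrow> ok H F d s \<and> ok H F e s \<and>
     (if cmpv c (ev d s) (ev e s) then wp H F p (\<lambda>t. Q (t + 1)) s else wp H F q (\<lambda>t. Q (t + 1)) s)"
  subgoal by (auto intro: wp_SKIP) (auto simp: wp_def elim: hex_SKIP)
  subgoal by (auto intro: wp_Asg) (auto simp: wp_def elim: hex_Asg)
  subgoal by (auto intro: wp_St) (auto simp: wp_def elim: hex_St)
  subgoal by (auto intro: wp_Sq) (auto simp: wp_def elim!: hex_Sq)
  subgoal by (auto intro: wp_IF) (auto simp: wp_def elim!: hex_IF)
  done

text \<open>Keeps the simplifier from touching the program and the postcondition.\<close>

lemma wp_cong [cong]: "s = s' \<Longrightarrow> wp H F p Q s \<longleftrightarrow> wp H F p Q s'"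
  by simp

text \<open>A consequence rule with built-in framing: whatever does not occur among the written
  variables and arrays is known to be unchanged, so postconditions mention changes only.\<close>

lemma wp_conseq:
  assumes "wp H F p Q s"
    and "\<And>t s'. Q t s' \<Longrightarrow> (\<And>x. x \<notin> wv p \<Longrightarrow> vr s' x = vr s x) \<Longrightarrow>
      (\<And>a. a \<notin> wa p \<Longrightarrow> ar s' a = ar s a) \<Longrightarrow> Q' t s'"
  shows "wp H F p Q' s"
  using assms hex_frame unfolding wp_def by meson

text \<open>The invariant may refer to the time \<open>t\<close> that has passed since the start of the loop.\<close>

lemma wp_WH:
  fixes m :: "hst \<Rightarrow> nat"
  assumes "I 0 s"
    and okc: "\<And>t s. I t s \<Longrightarrow> ok H F d s \<and> ok H F e s"
    and step: "\<And>t s. I t s \<Longrightarrow> cmpv c (ev d s) (ev e s) \<Longrightarrow>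
      wp H F p (\<lambda>t' s'. I (t + t' + 1) s' \<and> m s' < m s) s"
    and post: "\<And>t s. I t s \<Longrightarrow> \<not> cmpv c (ev d s) (ev e s) \<Longrightarrow> Q (t + 1) s"
  shows "wp H F (WH c d e p) Q s"
proof -
  have "I t s \<Longrightarrow> \<exists>t' s'. hex H F (WH c d e p) s t' s' \<and> Q (t + t') s'" for t
  proof (induction "m s" arbitrary: s t rule: less_induct)
    case less
    show ?case
    proof (cases "cmpv c (ev d s) (ev e s)")
      case False
      then show ?thesis using okc post less.prems by (meson hex.WhF)
    next
      case True
      from step[OF less.prems True] obtain t1 s1 where
        1: "hex H F p s t1 s1" "I (t + t1 + 1) s1" "m s1 < m s" unfolding wp_def by blast
      from less.hyps[OF 1(3,2)] obtain t2 s2 where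
        2: "hex H F (WH c d e p) s1 t2 s2" "Q (t + t1 + 1 + t2) s2" by blast
      have "hex H F (WH c d e p) s (t1 + t2 + 1) s2"
        using okc[OF less.prems] True 1 2 by (blast intro: hex.WhT)
      then show ?thesis using 2(2) by (metis add.assoc add.commute)
    qed
  qed
  from this[OF assms(1)] show ?thesis unfolding wp_def by simp
qed

definition FOR :: "nat \<Rightarrow> nat \<Rightarrow> prog \<Rightarrow> prog" where
  "FOR i l p = (Asg i (N 0) ;; WH CLess (V i) (V l) (p ;; Asg i (Bin Plus (V i) (N 1))))"

lemma FOR_sets [simp]:
  "wv (FOR i l p) = insert i (wv p)" "wa (FOR i l p) = wa p" "parr (FOR i l p) = parr p"
  by (auto simp: FOR_def)

text \<open>The 2 in \<open>step\<close> pays for the loop test and the increment, the 2 in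
  \<open>post\<close> for the initial assignment and the final failing test.\<close>

lemma wp_FOR:
  assumes "vr s l = n" "i \<notin> wv p" "l \<notin> wv p" "i \<noteq> l" "n < H" "1 < H"
    and I0: "I 0 0 (setv i 0 s)"
    and step: "\<And>k t s. k < n \<Longrightarrow> I k t s \<Longrightarrow> vr s i = k \<Longrightarrow> vr s l = n \<Longrightarrow>
      wp H F p (\<lambda>t' s'. I (Suc k) (t + t' + 2) (setv i (Suc k) s')) s"
    and post: "\<And>t s. I n t s \<Longrightarrow> vr s i = n \<Longrightarrow> vr s l = n \<Longrightarrow> Q (t + 2) s"
  shows "wp H F (FOR i l p) Q s"
  unfolding FOR_def
  apply (rule wp_Sq, rule wp_Asg)
  subgoal using assms by simp
  subgoal
    apply (rule wp_WH[where I = "\<lambda>t s. vr s l = n \<and> vr s i \<le> n \<and> I (vr s i) t s"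
          and m = "\<lambda>s. n - vr s i"])
    subgoal using assms by auto
    subgoal by simp
    subgoal for t s
      apply (rule wp_Sq, rule wp_conseq[where p = p], rule step[where k = "vr s i" and t = t])
          apply auto[4]
      apply (rule wp_Asg)
      using assms apply (auto simp: add_ac)
      done
    subgoal using post by (auto simp: add_ac)
    done
  done

section \<open>Shortest-path trees and short cycles\<close>

locale wgraph =
  fixes n :: nat and E :: "nat set set" and w :: "nat set \<Rightarrow> nat" and M :: nat
  assumes simple: "simple_graph n E"
    and weights: "e \<in> E \<Longrightarrow> w e \<in> {1..M}"
begin

lemma n_pos: "0 < n"
  using simple by (simp add: simple_graph_def)

lemma edgeD: "{x, y} \<in> E \<Longrightarrow> x < n \<and> y < n \<and> x \<noteq> y"
  using simple by (fastforce simp: simple_graph_def card_insert_if)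

lemma edge_commute: "{x, y} \<in> E \<longleftrightarrow> {y, x} \<in> E"
  by (simp add: insert_commute)

lemma weight_pos: "{x, y} \<in> E \<Longrightarrow> 0 < w {x, y}"
  using weights by fastforce

text \<open>Weights are positive, so \<open>D\<close> strictly decreases along \<open>par\<close>;
  this makes the parent pointers acyclic without a separate condition. The root is its own
  parent.\<close>

definition tree :: "nat \<Rightarrow> nat set \<Rightarrow> (nat \<Rightarrow> nat) \<Rightarrow> (nat \<Rightarrow> nat) \<Rightarrow> bool" where
  "tree v X D par \<longleftrightarrow> v \<in> X \<and> D v = 0 \<and> par v = v \<and> X \<subseteq> {..<n} \<and>
     (\<forall>x\<in>X. x \<noteq> v \<longrightarrow> par x \<in> X \<and> {par x, x} \<in> E \<and> D x = D (par x) + w {par x, x})"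

definition tedge :: "nat set \<Rightarrow> (nat \<Rightarrow> nat) \<Rightarrow> nat \<Rightarrow> nat \<Rightarrow> bool" where
  "tedge X par x y \<longleftrightarrow> x \<in> X \<and> y \<in> X \<and> (par x = y \<or> par y = x)"

text \<open>All edges scanned before radius \<open>k\<close> belong to the tree.\<close>

definition closed :: "nat set \<Rightarrow> (nat \<Rightarrow> nat) \<Rightarrow> (nat \<Rightarrow> nat) \<Rightarrow> nat \<Rightarrow> bool" where
  "closed X D par k \<longleftrightarrow>
     (\<forall>x\<in>X. \<forall>y. {x, y} \<in> E \<longrightarrow> \<not> tedge X par x y \<longrightarrow> k \<le> D x + w {x, y})"

lemma tedge_sym: "tedge X par x y \<longleftrightarrow> tedge X par y x"
  by (auto simp: tedge_def)

lemma closedD: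
  "closed X D par k \<Longrightarrow> x \<in> X \<Longrightarrow> {x, y} \<in> E \<Longrightarrow> D x + w {x, y} < k \<Longrightarrow> tedge X par x y"
  unfolding closed_def by (meson leD)

section \<open>Walks, and the distances certified by a closed tree\<close>

inductive walk :: "nat \<Rightarrow> nat \<Rightarrow> nat \<Rightarrow> bool" where
  walk_refl: "walk u u 0"
| walk_step: "walk u x l \<Longrightarrow> {x, y} \<in> E \<Longrightarrow> walk u y (l + w {x, y})"

lemma walk_trans: "walk x y k \<Longrightarrow> walk u x l \<Longrightarrow> walk u y (l + k)"
proof (induction rule: walk.induct)
  case (walk_step a x k y)
  then show ?case using walk.walk_step[of u x "l + k" y] by (simp add: add.assoc)
qed auto

lemma walk_edge: "{x, y} \<in> E \<Longrightarrow> walk x y (w {x, y})"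
  using walk_step[OF walk_refl] by simp

lemma walk_sym: "walk u x l \<Longrightarrow> walk x u l"
proof (induction rule: walk.induct)
  case (walk_step u x l y)
  then have "walk y x (w {x, y})" using walk_edge[of y x] by (simp add: insert_commute)
  from walk_trans[OF walk_step.IH this] show ?case by (simp add: add.commute)
qed (rule walk_refl)

text \<open>Below radius \<open>k\<close> every edge leaving the tree's vertices is a tree edge.
  Along it \<open>D\<close> grows by exactly its weight towards a child and shrinks towards a
  parent, so \<open>D\<close> never exceeds the length of a walk shorter than
  \<open>k\<close>.\<close>

lemma walk_reach:
  assumes "tree v X D par" "closed X D par k" "walk v x l" "l < k"
  shows "x \<in> X \<and> D x \<le> l"
  using assms(3,4,1)
proof (induction rule: walk.induct)
  case (walk_refl u)
  then show ?case by (simp add: tree_def)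
next
  case (walk_step v x l y)
  then have x: "x \<in> X" "D x \<le> l" by auto
  have te: "tedge X par x y" using closedD[OF assms(2) x(1)] walk_step.hyps x walk_step.prems by simp
  have "x \<noteq> y" using edgeD walk_step.hyps by blast
  show ?case
  proof (cases "y = v")
    case True
    then show ?thesis using walk_step.prems by (simp add: tree_def)
  next
    case False
    from te consider "par y = x" | "par x = y" by (auto simp: tedge_def)
    then show ?thesis
    proof cases
      case 1
      then show ?thesis using False te walk_step.prems x by (auto simp: tree_def tedge_def)
    next
      case 2
      with False walk_step.prems have "x \<noteq> v" by (auto simp: tree_def)
      then show ?thesis using 2 te walk_step.prems x by (auto simp: tree_def tedge_def)
    qed
  qed
qed

lemma tree_walk: "tree v X D par \<Longrightarrow> x \<in> X \<Longrightarrow> walk v x (D x)"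
proof (induction "D x" arbitrary: x rule: less_induct)
  case less
  show ?case
  proof (cases "x = v")
    case True
    with less.prems show ?thesis by (auto simp: tree_def intro: walk_refl)
  next
    case False
    with less.prems have p: "par x \<in> X" "{par x, x} \<in> E" "D x = D (par x) + w {par x, x}"
      by (auto simp: tree_def)
    with weight_pos have "D (par x) < D x" by simp
    from walk_step[OF less.hyps[OF this less.prems(1) p(1)] p(2)] p(3) show ?thesis by simp
  qed
qed

section \<open>Cycles, their prefix weights and their two arcs\<close>

definition cyc_next :: "nat list \<Rightarrow> nat \<Rightarrow> nat" where
  "cyc_next c i = c ! (Suc i mod length c)"

lemma cycle_edge: "is_cycle E c \<Longrightarrow> i < length c \<Longrightarrow> {c ! i, cyc_next c i} \<in> E"
  by (auto simp: is_cycle_def cycle_edges_def cyc_next_def)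

text \<open>A vertex of maximal depth on the cycle would have two parents.\<close>

lemma no_tree_cycle:
  assumes c: "is_cycle E c" and t: "tree v X D par"
    and te: "\<And>i. i < length c \<Longrightarrow> tedge X par (c ! i) (cyc_next c i)"
  shows False
proof -
  have len: "3 \<le> length c" "distinct c" using c by (auto simp: is_cycle_def)
  have "\<exists>i<length c. \<forall>j<length c. D (c ! j) \<le> D (c ! i)"
  proof -
    have "finite ((\<lambda>i. D (c ! i)) ` {..<length c})" "(\<lambda>i. D (c ! i)) ` {..<length c} \<noteq> {}"
      using len by (auto simp: lessThan_empty_iff)
    from Max_in[OF this] Max_ge[OF this(1)] show ?thesis by fastforce
  qed
  then obtain i where i: "i < length c" "\<And>j. j < length c \<Longrightarrow> D (c ! j) \<le> D (c ! i)" by blast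
  \<comment> \<open>A tree edge joins a child to its parent and the child is strictly deeper, so the
    end that is not the shallower one must be the child.\<close>
  have par: "par z = y" if "tedge X par z y" "D y \<le> D z" "{z, y} \<in> E" for z y
  proof (rule ccontr)
    assume "par z \<noteq> y"
    with that have "par y = z" "z \<in> X" "y \<in> X" by (auto simp: tedge_def)
    moreover have "y \<noteq> z" using edgeD that by blast
    ultimately have "D y = D z + w {z, y}" using t by (auto simp: tree_def)
    with weight_pos that show False by fastforce
  qed
  define j where "j = (if i = 0 then length c - 1 else i - 1)"
  have j: "j < length c" "Suc j mod length c = i" using i len by (auto simp: j_def)
  have si: "Suc i mod length c < length c" using len by (auto intro!: mod_less_divisor)
  have "par (c ! i) = cyc_next c i"
    using par te i cycle_edge[OF c] si by (auto simp: cyc_next_def)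
  moreover have "par (c ! i) = c ! j"
    using par[of "c ! i" "c ! j"] te[OF j(1)] i j cycle_edge[OF c j(1)]
    by (auto simp: cyc_next_def tedge_sym edge_commute)
  \<comment> \<open>Predecessor and successor of the deepest vertex would coincide, which is
    impossible on at least three vertices.\<close>
  ultimately have "Suc i mod length c = j"
    using len(2) si j by (auto simp: cyc_next_def nth_eq_iff_index_eq)
  then show False using len i by (auto simp: j_def mod_Suc split: if_splits)
qed

definition pre :: "nat list \<Rightarrow> nat \<Rightarrow> nat" where
  "pre c j = (\<Sum>i<j. w {c ! i, cyc_next c i})"

lemma pre_Suc: "pre c (Suc i) = pre c i + w {c ! i, cyc_next c i}"
  by (simp add: pre_def)

lemma pre_0 [simp]: "pre c 0 = 0"
  by (simp add: pre_def)

lemma pre_mono: "i \<le> j \<Longrightarrow> pre c i \<le> pre c j"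
  unfolding pre_def by (rule sum_mono2) auto

text \<open>\<open>cycle_weight\<close> sums over a set of edges, \<open>pre\<close> over positions.
  With at least three distinct vertices no two positions give the same edge, so nothing is counted
  twice.\<close>

lemma pre_length:
  assumes "is_cycle E c"
  shows "pre c (length c) = cycle_weight w c"
proof -
  have len: "3 \<le> length c" "distinct c" using assms by (auto simp: is_cycle_def)
  have "inj_on (\<lambda>i. {c ! i, cyc_next c i}) {..<length c}"
  proof (rule inj_onI)
    fix i j
    assume ij: "i \<in> {..<length c}" "j \<in> {..<length c}" "{c ! i, cyc_next c i} = {c ! j, cyc_next c j}"
    have s: "Suc i mod length c < length c" "Suc j mod length c < length c"
      using len by (auto intro!: mod_less_divisor)
    from ij(3) consider "c ! i = c ! j" | "c ! i = cyc_next c j" "cyc_next c i = c ! j"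
      by (auto simp: doubleton_eq_iff)
    then show "i = j"
    proof cases
      case 1
      with ij len show ?thesis by (simp add: nth_eq_iff_index_eq)
    next
      case 2
      then have "i = Suc j mod length c" "Suc i mod length c = j"
        using ij len s by (auto simp: cyc_next_def nth_eq_iff_index_eq)
      then show ?thesis using len ij by (auto simp: mod_Suc split: if_splits)
    qed
  qed
  moreover have "cycle_edges c = (\<lambda>i. {c ! i, cyc_next c i}) ` {..<length c}"
    by (auto simp: cycle_edges_def cyc_next_def)
  ultimately show ?thesis
    by (simp add: cycle_weight_def pre_def sum.reindex)
qed

lemma walk_pre:
  assumes c: "is_cycle E c" and "j \<le> length c" "i \<le> j" "i < length c"
  shows "walk (c ! i) (c ! (j mod length c)) (pre c j - pre c i)"
  using assms(3,2)
proof (induction j rule: dec_induct)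
  case base
  then show ?case using assms(4) by (auto intro: walk_refl)
next
  case (step j)
  then have "j < length c" by simp
  then have "{c ! j, c ! (Suc j mod length c)} \<in> E" using cycle_edge[OF c] by (simp add: cyc_next_def)
  moreover have "walk (c ! i) (c ! j) (pre c j - pre c i)"
    using step \<open>j < length c\<close> by simp
  ultimately have "walk (c ! i) (c ! (Suc j mod length c)) (pre c j - pre c i + w {c ! j, cyc_next c j})"
    unfolding cyc_next_def by (blast intro: walk_step)
  then show ?case using pre_mono[of i j c] step by (simp add: pre_Suc)
qed

text \<open>The two arcs from \<open>c ! 0\<close> to position \<open>j\<close>: the forward one,
  and the rest of the cycle traversed backwards.\<close>

lemma walk_cycle:
  assumes c: "is_cycle E c" and j: "j \<le> length c"
  shows "walk (c ! 0) (c ! (j mod length c)) (pre c j)"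
    and "walk (c ! 0) (c ! (j mod length c)) (pre c (length c) - pre c j)"
proof -
  have len: "0 < length c" using c by (auto simp: is_cycle_def)
  show "walk (c ! 0) (c ! (j mod length c)) (pre c j)"
    using walk_pre[OF c j, of 0] len by simp
  show "walk (c ! 0) (c ! (j mod length c)) (pre c (length c) - pre c j)"
  proof (cases "j = length c")
    case True
    then show ?thesis by (auto intro: walk_refl)
  next
    case False
    with j have "j < length c" by simp
    then show ?thesis using walk_sym[OF walk_pre[OF c order.refl, of j]] by simp
  qed
qed

text \<open>If \<open>k\<close> exceeded the cycle's weight, following the forward arc would reach
  every vertex early enough to make each cycle edge a tree edge, against
  \<open>no_tree_cycle\<close>.\<close>

lemma closed_le_from_cycle:
  assumes c: "is_cycle E c" and t: "tree (c ! 0) X D par" "closed X D par k"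
  shows "k \<le> pre c (length c)"
proof (rule ccontr)
  assume k: "\<not> k \<le> pre c (length c)"
  show False
  proof (rule no_tree_cycle[OF c t(1)])
    fix i
    assume i: "i < length c"
    then have "pre c (Suc i) < k" using pre_mono[of "Suc i" "length c" c] k by simp
    moreover have "walk (c ! 0) (c ! i) (pre c i)" using walk_cycle(1)[OF c, of i] i by simp
    ultimately show "tedge X par (c ! i) (cyc_next c i)"
      using walk_reach[OF t, of "c ! i" "pre c i"] closedD[OF t(2) _ cycle_edge[OF c i]]
      by (fastforce simp: pre_Suc)
  qed
qed

text \<open>An edge of the cycle may be scanned from either end, reached from \<open>u\<close>
  through \<open>c ! 0\<close> and then along the arc that avoids the edge. \<open>near\<close> asks
  that the cheaper way be completed by radius g, the weight of the cycle; the contradiction is again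
  a cycle of tree edges.\<close>

lemma closed_le_near_cycle:
  assumes c: "is_cycle E c" and t: "tree u X D par" "closed X D par k" and u: "walk u (c ! 0) r"
    and near: "\<And>i. i < length c \<Longrightarrow> r + min (pre c i) (pre c (length c) - pre c (Suc i)) +
      w {c ! i, cyc_next c i} \<le> pre c (length c)"
  shows "k \<le> pre c (length c)"
proof (rule ccontr)
  assume k: "\<not> k \<le> pre c (length c)"
  show False
  proof (rule no_tree_cycle[OF c t(1)])
    fix i
    assume i: "i < length c"
    note e = cycle_edge[OF c i]
    have w1: "walk u (c ! i) (r + pre c i)" using walk_trans[OF walk_cycle(1)[OF c, of i] u] i by simp
    have w2: "walk u (cyc_next c i) (r + (pre c (length c) - pre c (Suc i)))"
      using walk_trans[OF walk_cycle(2)[OF c, of "Suc i"] u] i by (simp add: cyc_next_def)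
    show "tedge X par (c ! i) (cyc_next c i)"
    proof (cases "pre c i \<le> pre c (length c) - pre c (Suc i)")
      case True
      then have "r + pre c i + w {c ! i, cyc_next c i} < k" using near[OF i] k by simp
      then show ?thesis
        using walk_reach[OF t w1] closedD[OF t(2) _ e] by fastforce
    next
      case False
      then have "r + (pre c (length c) - pre c (Suc i)) + w {c ! i, cyc_next c i} < k"
        using near[OF i] k by simp
      then show ?thesis
        using walk_reach[OF t w2] closedD[OF t(2), of "cyc_next c i" "c ! i"] e
        by (fastforce simp: insert_commute tedge_sym)
    qed
  qed
qed

text \<open>Let a and b be the weights of the two arcs from \<open>c ! 0\<close> to the ends of edge
  \<open>i\<close>, so that g = a + w + b. The hypothesis g < r + min a b + w then says max a b < r.
  Every vertex of the cycle lies on one of these arcs, hence closer than \<open>r\<close> to the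
  root, hence in the tree. Some cycle edge is not a tree edge, and its two tree distances plus its
  weight are bounded by walking once around the cycle.\<close>

lemma short_chord:
  assumes c: "is_cycle E c" and t: "tree (c ! 0) X D par" "closed X D par k" and r: "r \<le> k"
    and i: "i < length c" "pre c (length c) < r + min (pre c i) (pre c (length c) - pre c (Suc i)) +
      w {c ! i, cyc_next c i}"
  shows "\<exists>x\<in>X. \<exists>y\<in>X. {x, y} \<in> E \<and> \<not> tedge X par x y \<and> D x + D y + w {x, y} \<le> pre c (length c)"
proof -
  let ?g = "pre c (length c)"
  have g: "pre c i + w {c ! i, cyc_next c i} \<le> ?g"
    using pre_mono[of "Suc i" "length c" c] i by (simp add: pre_Suc)
  \<comment> \<open>Positions up to \<open>i\<close> are reached along the forward arc, later ones
    along the backward arc; position \<open>length c\<close> is the root again.\<close>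
  have near: "c ! (j mod length c) \<in> X \<and> D (c ! (j mod length c)) \<le> min (pre c j) (?g - pre c j)"
    if j: "j \<le> length c" for j
  proof -
    have "min (pre c j) (?g - pre c j) < r"
    proof (cases "j \<le> i")
      case True
      then show ?thesis using pre_mono[OF True, of c] i(2) g by (simp add: pre_Suc)
    next
      case False
      then have "pre c (Suc i) \<le> pre c j" by (intro pre_mono) simp
      then show ?thesis using i(2) g by (simp add: pre_Suc)
    qed
    moreover have "walk (c ! 0) (c ! (j mod length c)) (min (pre c j) (?g - pre c j))"
      using walk_cycle[OF c j] by (auto simp: min_def)
    ultimately show ?thesis using walk_reach[OF t] r by (meson less_le_trans)
  qed
  obtain j where j: "j < length c" "\<not> tedge X par (c ! j) (cyc_next c j)"
    using no_tree_cycle[OF c t(1)] by blast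
  have "pre c (Suc j) \<le> ?g" using j by (intro pre_mono) simp
  moreover have "D (c ! j) \<le> pre c j" "D (cyc_next c j) \<le> ?g - pre c (Suc j)"
    using near[of j] near[of "Suc j"] j by (auto simp: cyc_next_def)
  ultimately have "D (c ! j) + D (cyc_next c j) + w {c ! j, cyc_next c j} \<le> ?g"
    unfolding pre_Suc by linarith
  then show ?thesis
    using near[of j] near[of "Suc j"] j cycle_edge[OF c j(1)] by (auto simp: cyc_next_def)
qed

text \<open>
  \<open>b\<close> is the least weight of a closed walk found so far, and 0 if there is none.
\<close>

definition full_ok :: "nat \<Rightarrow> nat \<Rightarrow> bool" where
  "full_ok u b \<longleftrightarrow> (\<exists>X D par k. tree u X D par \<and> closed X D par k \<and>
     (b \<noteq> 0 \<and> b \<le> 2 * k \<or> (\<forall>k'. closed X D par k')))"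

text \<open>The certificate left by a search that was cut off. \<open>D x \<le> k\<close> is what
  allows the depth of a hitting vertex to serve as the radius \<open>r\<close> of
  \<open>short_chord\<close>. The condition \<open>b \<noteq> 0\<close> stands inside the
  quantifiers: a ball spanned by tree edges alone demands no cycle.\<close>

definition ball_ok :: "nat \<Rightarrow> nat \<Rightarrow> nat set \<Rightarrow> bool" where
  "ball_ok v b X \<longleftrightarrow> (\<exists>D par k. tree v X D par \<and> closed X D par k \<and> (\<forall>x\<in>X. D x \<le> k) \<and>
     (\<forall>x\<in>X. \<forall>y\<in>X. {x, y} \<in> E \<longrightarrow> \<not> tedge X par x y \<longrightarrow> b \<noteq> 0 \<and> b \<le> D x + D y + w {x, y}))"

lemma full_ok_better: "full_ok u b \<Longrightarrow> (b \<noteq> 0 \<longrightarrow> b' \<noteq> 0 \<and> b' \<le> b) \<Longrightarrow> full_ok u b'"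
  unfolding full_ok_def by (meson le_trans)

lemma ball_ok_better: "ball_ok u b X \<Longrightarrow> (b \<noteq> 0 \<longrightarrow> b' \<noteq> 0 \<and> b' \<le> b) \<Longrightarrow> ball_ok u b' X"
  unfolding ball_ok_def by (meson le_trans)

text \<open>The factor 2 stems from full searches only, by \<open>b \<le> 2 * k\<close> and k at
  most the weight of \<open>c\<close>; the pair test inside a ball gives a bound without it. A full
  search that ran out of edges is closed at every radius, which contradicts the existence of
  \<open>c\<close>.\<close>

lemma approximation:
  assumes c: "is_cycle E c"
    and ok: "full_ok (c ! 0) b \<or> (\<exists>X. ball_ok (c ! 0) b X \<and> (\<exists>u\<in>X. full_ok u b))"
  shows "b \<noteq> 0 \<and> b \<le> 2 * cycle_weight w c"
proof -
  let ?g = "pre c (length c)"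
  have "b \<noteq> 0 \<and> b \<le> 2 * ?g"
    using ok
  proof (elim disjE exE conjE bexE)
    assume "full_ok (c ! 0) b"
    then obtain X D par k where *: "tree (c ! 0) X D par" "closed X D par k"
       "b \<noteq> 0 \<and> b \<le> 2 * k \<or> (\<forall>k'. closed X D par k')" unfolding full_ok_def by blast
    then show ?thesis using closed_le_from_cycle[OF c *(1)] by (meson le_trans mult_le_mono2 not_less_eq_eq)
  next
    fix X u
    assume u: "u \<in> X" "full_ok u b" and "ball_ok (c ! 0) b X"
    then obtain D par k where *: "tree (c ! 0) X D par" "closed X D par k" "\<forall>x\<in>X. D x \<le> k"
      "\<And>x y. x \<in> X \<Longrightarrow> y \<in> X \<Longrightarrow> {x, y} \<in> E \<Longrightarrow> \<not> tedge X par x y \<Longrightarrow> b \<noteq> 0 \<and> b \<le> D x + D y + w {x, y}"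
      unfolding ball_ok_def by blast
    have wu: "walk u (c ! 0) (D u)" by (rule walk_sym[OF tree_walk[OF *(1) u(1)]])
    show ?thesis
    proof (cases "\<forall>i<length c. D u + min (pre c i) (?g - pre c (Suc i)) + w {c ! i, cyc_next c i} \<le> ?g")
      case True
      from u(2) obtain X D par k where f: "tree u X D par" "closed X D par k"
         "b \<noteq> 0 \<and> b \<le> 2 * k \<or> (\<forall>k'. closed X D par k')" unfolding full_ok_def by blast
      then show ?thesis using closed_le_near_cycle[OF c f(1) _ wu] True
        by (meson le_trans mult_le_mono2 not_less_eq_eq)
    next
      case False
      then obtain i where i: "i < length c"
        "?g < D u + min (pre c i) (?g - pre c (Suc i)) + w {c ! i, cyc_next c i}"
        by (meson not_le)
      have "D u \<le> k" using *(3) u(1) by blast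
      from short_chord[OF c *(1,2) this i] *(4) show ?thesis by fastforce
    qed
  qed
  then show ?thesis using pre_length[OF c] by simp
qed

end

context wgraph
begin

lemma no_loop [simp]: "{x} \<notin> E"
  using edgeD[of x x] by auto

lemma treeD:
  assumes "tree v X D par"
  shows "v \<in> X" "D v = 0" "par v = v" "X \<subseteq> {..<n}"
  using assms by (simp_all only: tree_def)

lemma tree_stepD:
  assumes "tree v X D par" "x \<in> X" "x \<noteq> v"
  shows "par x \<in> X" "{par x, x} \<in> E" "D x = D (par x) + w {par x, x}"
  using assms by (simp_all only: tree_def) blast+

subsection \<open>Closing a cycle in the tree\<close>

fun pweight :: "nat list \<Rightarrow> nat" where
  "pweight (a # b # xs) = w {a, b} + pweight (b # xs)"
| "pweight _ = 0"

lemma pweight_snoc: "xs \<noteq> [] \<Longrightarrow> pweight (xs @ [y]) = pweight xs + w {last xs, y}"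
  by (induction xs rule: pweight.induct) auto

lemma pweight_sum: "pweight xs = (\<Sum>i<length xs - 1. w {xs ! i, xs ! Suc i})"
proof (induction xs rule: pweight.induct)
  case (1 a b xs)
  then show ?case
    by (simp add: sum.lessThan_Suc_shift del: sum.lessThan_Suc)
qed auto

lemma successively_append_edge:
  "xs \<noteq> [] \<Longrightarrow> successively P (xs @ [y]) \<longleftrightarrow> successively P xs \<and> P (last xs) y"
  by (simp add: successively_append_iff)

text \<open>
  Two pointers climb from the ends of a non-tree edge, always the one of larger depth; \<open>seg\<close> is the
  path between them that has been left behind.
\<close>

definition climb ::
    "nat set \<Rightarrow> (nat \<Rightarrow> nat) \<Rightarrow> (nat \<Rightarrow> nat) \<Rightarrow> nat \<Rightarrow> nat \<Rightarrow> nat list \<Rightarrow> nat \<Rightarrow> bool" where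
  "climb X D par x y seg est \<longleftrightarrow> x \<in> X \<and> y \<in> X \<and> distinct seg \<and> set seg \<subseteq> X \<and>
     (\<forall>z\<in>set seg. D x \<le> D z \<and> D y \<le> D z \<and> x \<noteq> z \<and> y \<noteq> z) \<and>
     successively (\<lambda>a b. {a, b} \<in> E) (x # seg @ [y]) \<and> pweight (x # seg @ [y]) + D x + D y = est \<and>
     (seg = [] \<longrightarrow> par x \<noteq> y \<and> par y \<noteq> x) \<and> (length seg = 1 \<longrightarrow> x \<noteq> y)"

lemma climb_init:
  "x \<in> X \<Longrightarrow> y \<in> X \<Longrightarrow> {x, y} \<in> E \<Longrightarrow> \<not> tedge X par x y \<Longrightarrow> climb X D par x y [] (D x + D y + w {x, y})"
  by (simp add: climb_def tedge_def)

lemma tree_parent: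
  assumes "tree v X D par" "x \<in> X" "0 < D x"
  shows "par x \<in> X" "{par x, x} \<in> E" "D x = D (par x) + w {par x, x}" "D (par x) < D x"
proof -
  from assms treeD[OF assms(1)] have "x \<noteq> v" by auto
  from tree_stepD[OF assms(1,2) this]
  show *: "par x \<in> X" "{par x, x} \<in> E" "D x = D (par x) + w {par x, x}"
    by blast+
  then show "D (par x) < D x" using weight_pos by simp
qed

text \<open>Moving a pointer to its parent shifts the weight of one edge from the depth to the path,
  so \<open>est\<close> stays constant. The new position is strictly less deep than all of the
  segment and therefore cannot lie on it.\<close>

lemma climb_left:
  assumes t: "tree v X D par" and c: "climb X D par x y seg est" and d: "D y < D x"
  shows "climb X D par (par x) y (x # seg) est"
proof -
  have "x \<in> X" "0 < D x" using c d by (auto simp: climb_def)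
  note p = tree_parent[OF t this]
  have "x \<noteq> y" using d by blast
  moreover have "\<forall>z\<in>set (x # seg). D (par x) \<le> D z \<and> par x \<noteq> z"
    using p(4) c by (fastforce simp: climb_def)
  ultimately show ?thesis
    using c d p by (auto simp: climb_def)
qed

text \<open>On a tie the right pointer moves. It is not at the root: two distinct vertices cannot
  both have depth 0.\<close>

lemma climb_right:
  assumes t: "tree v X D par" and c: "climb X D par x y seg est" and d: "D x \<le> D y" "x \<noteq> y"
  shows "climb X D par x (par y) (seg @ [y]) est"
proof -
  have xy: "x \<in> X" "y \<in> X" using c by (auto simp: climb_def)
  have "0 < D y"
  proof (rule ccontr)
    assume "\<not> 0 < D y"
    then have "D x = 0" "D y = 0" using d by auto
    moreover have "0 < D z" if "z \<in> X" "z \<noteq> v" for z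
      using tree_stepD(3)[OF t that] weight_pos[OF tree_stepD(2)[OF t that]] by linarith
    ultimately show False using xy d by (metis less_irrefl)
  qed
  note p = tree_parent[OF t xy(2) this]
  have "\<forall>z\<in>set (seg @ [y]). D (par y) \<le> D z \<and> par y \<noteq> z"
    using p(4) c by (fastforce simp: climb_def)
  moreover have "x # (seg @ [y]) @ [par y] = (x # seg @ [y]) @ [par y]" by simp
  ultimately show ?thesis
    using c d p pweight_snoc[of "x # seg @ [y]" "par y"]
      successively_append_edge[of "x # seg @ [y]" "\<lambda>a b. {a, b} \<in> E" "par y"]
    by (auto simp: climb_def insert_commute)
qed

text \<open>When the pointers meet at \<open>x\<close>, the path is a closed walk of weight
  \<open>est - 2 * D x\<close>; the stem up to the root is dropped. The last two conjuncts of
  \<open>climb\<close> and the absence of loops force at least three vertices.\<close>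

lemma climb_cycle:
  assumes c: "climb X D par x x seg est"
  shows "is_cycle E (x # seg) \<and> cycle_weight w (x # seg) \<le> est"
proof -
  define cy where "cy = x # seg"
  have sc: "successively (\<lambda>a b. {a, b} \<in> E) (cy @ [x])" using c by (auto simp: climb_def cy_def)
  have "seg \<noteq> []" "length seg \<noteq> 1"
    using c edgeD by (auto simp: climb_def)
  then have len: "3 \<le> length cy" unfolding cy_def by (cases seg) (auto simp: Suc_le_eq)
  have nxt: "(cy @ [x]) ! Suc i = cyc_next cy i" if "i < length cy" for i
  proof (cases "Suc i = length cy")
    case True
    then show ?thesis by (simp add: cyc_next_def nth_append) (simp add: cy_def)
  next
    case False
    with that show ?thesis by (simp add: cyc_next_def nth_append)
  qed
  have "{cy ! i, cyc_next cy i} \<in> E" if "i < length cy" for i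
    using sc[unfolded successively_conv_nth, rule_format, of i] that nxt by (simp add: nth_append)
  then have "cycle_edges cy \<subseteq> E" by (auto simp: cycle_edges_def cyc_next_def)
  moreover have "distinct cy" using c by (auto simp: climb_def cy_def)
  ultimately have ic: "is_cycle E cy" using len by (simp add: is_cycle_def)
  have "pweight (cy @ [x]) = pre cy (length cy)"
    unfolding pweight_sum pre_def using nxt by (intro sum.cong) (auto simp: nth_append)
  with ic c pre_length[OF ic] show ?thesis by (simp add: climb_def cy_def)
qed

end

subsection \<open>Lazy search with sorted adjacency lists\<close>

locale sgraph = wgraph +
  fixes srt :: "nat \<Rightarrow> nat list"
  assumes srt_distinct: "x < n \<Longrightarrow> distinct (srt x)"
    and srt_set: "x < n \<Longrightarrow> set (srt x) = {y. {x, y} \<in> E}"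
    and srt_sorted: "x < n \<Longrightarrow> i \<le> j \<Longrightarrow> j < length (srt x) \<Longrightarrow> w {x, srt x ! i} \<le> w {x, srt x ! j}"
begin

section \<open>Search states and their invariant\<close>

definition active :: "nat \<Rightarrow> nat \<Rightarrow> bool" where
  "active x i \<longleftrightarrow> i < length (srt x)"

definition key :: "(nat \<Rightarrow> nat) \<Rightarrow> nat \<Rightarrow> nat \<Rightarrow> nat" where
  "key D x i = D x + w {x, srt x ! i}"

text \<open>A neighbour occurs once in a list, so a single step makes the current entry differ from
  the parent.\<close>

definition skip :: "nat \<Rightarrow> nat \<Rightarrow> nat \<Rightarrow> nat" where
  "skip p x i = (if active x i \<and> srt x ! i = p then Suc i else i)"

text \<open>Read in order: the part of each list before \<open>idx\<close> consists of tree edges,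
  the current entry is not the parent and not due before radius \<open>k\<close>, and the entry of
  every child in its parent's list has been passed. The last two together ensure that an edge found
  to end in a visited vertex really closes a cycle. \<open>D (ord j) \<le> M * j\<close> supplies
  the word bounds.\<close>

definition sinv :: "nat \<Rightarrow> nat \<Rightarrow> (nat \<Rightarrow> nat) \<Rightarrow> (nat \<Rightarrow> nat) \<Rightarrow> (nat \<Rightarrow> nat) \<Rightarrow> (nat \<Rightarrow> nat) \<Rightarrow> nat \<Rightarrow> bool"
  where
  "sinv v cnt ord D par idx k \<longleftrightarrow> (let X = ord ` {..<cnt} in
     0 < cnt \<and> ord 0 = v \<and> inj_on ord {..<cnt} \<and> tree v X D par \<and>
     (\<forall>x\<in>X. idx x \<le> length (srt x)) \<and> (\<forall>x\<in>X. \<forall>j<idx x. tedge X par x (srt x ! j)) \<and>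
     (\<forall>x\<in>X. active x (idx x) \<longrightarrow> srt x ! idx x \<noteq> par x \<and> k \<le> key D x (idx x)) \<and>
     (\<forall>y\<in>X. y \<noteq> v \<longrightarrow> (\<exists>j<idx (par y). srt (par y) ! j = y)) \<and>
     (\<forall>x\<in>X. D x \<le> k) \<and> (\<forall>j<cnt. D (ord j) \<le> M * j))"

lemma srt_edge: "x < n \<Longrightarrow> active x i \<Longrightarrow> {x, srt x ! i} \<in> E"
  using srt_set nth_mem unfolding active_def by blast

lemma length_srt: "x < n \<Longrightarrow> length (srt x) < n"
proof -
  assume x: "x < n"
  have "set (srt x) \<subseteq> {..<n} - {x}" using srt_set[OF x] edgeD by auto
  then have "card (set (srt x)) \<le> card ({..<n} - {x})" by (intro card_mono) auto
  then show ?thesis using x distinct_card[OF srt_distinct[OF x]] by simp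
qed

lemma sinv_init:
  assumes "v < n" "ord 0 = v" "D v = 0" "par v = v" "idx v = 0"
  shows "sinv v 1 ord D par idx 0"
proof -
  have "srt v ! 0 \<noteq> v" if "active v 0" using srt_edge[OF assms(1) that] by auto
  then show ?thesis
    using assms by (auto simp: sinv_def tree_def Let_def inj_on_def)
qed

lemma sinvD:
  assumes "sinv v cnt ord D par idx k"
  shows "0 < cnt" "ord 0 = v" "inj_on ord {..<cnt}" "tree v (ord ` {..<cnt}) D par"
    "x \<in> ord ` {..<cnt} \<Longrightarrow> idx x \<le> length (srt x)"
    "x \<in> ord ` {..<cnt} \<Longrightarrow> active x (idx x) \<Longrightarrow> k \<le> key D x (idx x)"
    "x \<in> ord ` {..<cnt} \<Longrightarrow> D x \<le> k" "j < cnt \<Longrightarrow> D (ord j) \<le> M * j"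
  using assms unfolding sinv_def Let_def by blast+

lemma sinv_tree: "sinv v cnt ord D par idx k \<Longrightarrow> tree v (ord ` {..<cnt}) D par"
  by (simp add: sinv_def Let_def)

lemma sinv_vertex: "sinv v cnt ord D par idx k \<Longrightarrow> x \<in> ord ` {..<cnt} \<Longrightarrow> x < n"
  using treeD(4)[OF sinv_tree] by blast

text \<open>Sorting makes the current entry of each list the lightest unscanned one, so a lower
  bound on the current keys bounds all edges outside the tree.\<close>

lemma sinv_closed:
  assumes s: "sinv v cnt ord D par idx k"
    and m: "\<And>x. x \<in> ord ` {..<cnt} \<Longrightarrow> active x (idx x) \<Longrightarrow> k' \<le> key D x (idx x)"
  shows "closed (ord ` {..<cnt}) D par k'"
  unfolding closed_def
proof (intro ballI allI impI)
  fix x y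
  assume x: "x \<in> ord ` {..<cnt}" and e: "{x, y} \<in> E" and te: "\<not> tedge (ord ` {..<cnt}) par x y"
  have xn: "x < n" using edgeD e by blast
  then obtain j where j: "j < length (srt x)" "y = srt x ! j"
    using srt_set e by (metis in_set_conv_nth mem_Collect_eq)
  have "\<not> j < idx x" using s x te j by (auto simp: sinv_def Let_def)
  then have le: "idx x \<le> j" by simp
  then have "k' \<le> key D x (idx x)" using m[OF x] j by (auto simp: active_def)
  also have "\<dots> \<le> D x + w {x, y}" using srt_sorted[OF xn le j(1)] j by (simp add: key_def)
  finally show "k' \<le> D x + w {x, y}" .
qed

text \<open>A tree edge could only lead to the parent, which is stepped over, or to a child, whose
  unique entry lies before \<open>idx x\<close>.\<close>

lemma sinv_closing:
  assumes s: "sinv v cnt ord D par idx k" and x: "x \<in> ord ` {..<cnt}" "active x (idx x)"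
    and y: "srt x ! idx x \<in> ord ` {..<cnt}"
  shows "\<not> tedge (ord ` {..<cnt}) par x (srt x ! idx x)"
proof
  let ?y = "srt x ! idx x"
  assume "tedge (ord ` {..<cnt}) par x ?y"
  moreover have "par x \<noteq> ?y" using s x by (auto simp: sinv_def Let_def)
  ultimately have p: "par ?y = x" by (auto simp: tedge_def)
  have xn: "x < n" by (rule sinv_vertex[OF s x(1)])
  have "?y \<noteq> v"
    using p treeD(3)[OF sinv_tree[OF s]] srt_edge[OF xn x(2)] edgeD by auto
  then obtain j where "j < idx x" "srt x ! j = ?y" using s y p by (auto simp: sinv_def Let_def)
  with x srt_distinct[OF xn] show False by (auto simp: active_def nth_eq_iff_index_eq)
qed

text \<open>The least key \<open>K\<close> becomes both the depth of the new vertex and the new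
  radius: other keys are at least \<open>K\<close> by minimality, the next key of \<open>x\<close>
  by sorting, and those of \<open>y\<close> because \<open>y\<close> itself has depth
  \<open>K\<close>.\<close>

lemma sinv_visit:
  assumes s: "sinv v cnt ord D par idx k" and x: "x \<in> ord ` {..<cnt}" "active x (idx x)"
    and K: "K = key D x (idx x)" and y: "y = srt x ! idx x" "y \<notin> ord ` {..<cnt}"
    and m: "\<And>z. z \<in> ord ` {..<cnt} \<Longrightarrow> active z (idx z) \<Longrightarrow> K \<le> key D z (idx z)"
  shows "sinv v (Suc cnt) (ord(cnt := y)) (D(y := K)) (par(y := x))
    (idx(y := skip x y 0, x := skip (par x) x (Suc (idx x)))) K"
proof -
  define X where "X = ord ` {..<cnt}"
  define Y where "Y = insert y X"
  define D' where "D' = D(y := K)"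
  define par' where "par' = par(y := x)"
  define idx' where "idx' = idx(y := skip x y 0, x := skip (par x) x (Suc (idx x)))"
  have Y: "(ord(cnt := y)) ` {..<Suc cnt} = Y"
    by (auto simp: Y_def X_def lessThan_Suc)
  have i: "0 < cnt" "ord 0 = v" "inj_on ord {..<cnt}" and t: "tree v X D par"
    and idx: "\<And>x. x \<in> X \<Longrightarrow> idx x \<le> length (srt x)"
    and te: "\<And>x j. x \<in> X \<Longrightarrow> j < idx x \<Longrightarrow> tedge X par x (srt x ! j)"
    and ac: "\<And>x. x \<in> X \<Longrightarrow> active x (idx x) \<Longrightarrow> srt x ! idx x \<noteq> par x \<and> k \<le> key D x (idx x)"
    and pa: "\<And>y. y \<in> X \<Longrightarrow> y \<noteq> v \<Longrightarrow> \<exists>j<idx (par y). srt (par y) ! j = y"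
    and Dk: "\<And>x. x \<in> X \<Longrightarrow> D x \<le> k" and DM: "\<And>j. j < cnt \<Longrightarrow> D (ord j) \<le> M * j"
    using s by (auto simp: sinv_def Let_def X_def)
  have xX: "x \<in> X" "y \<notin> X" using x y by (auto simp: X_def)
  have xn: "x < n" by (rule sinv_vertex[OF s x(1)])
  have e: "{x, y} \<in> E" using srt_edge[OF xn x(2)] y by simp
  then have yn: "y < n" "x \<noteq> y" using edgeD by auto
  have vX: "v \<in> X" by (rule treeD[OF t])
  have kK: "k \<le> K" using ac[OF xX(1) x(2)] K by simp
  have t': "tree v Y D' par'"
    unfolding tree_def
  proof (intro conjI ballI impI)
    fix z assume z: "z \<in> Y" "z \<noteq> v"
    consider "z = y" | "z \<in> X" "z \<noteq> y" using z Y_def by blast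
    then have "par' z \<in> Y \<and> {par' z, z} \<in> E \<and> D' z = D' (par' z) + w {par' z, z}"
    proof cases
      case 1
      with e xX yn K y show ?thesis by (simp add: Y_def D'_def par'_def key_def)
    next
      case 2
      note p = tree_stepD[OF t 2(1) z(2)]
      have "par z \<noteq> y" using p(1) xX by blast
      then show ?thesis using p 2 by (simp add: Y_def D'_def par'_def)
    qed
    then show "par' z \<in> Y" "{par' z, z} \<in> E" "D' z = D' (par' z) + w {par' z, z}" by blast+
  qed (use treeD[OF t] xX yn vX in \<open>auto simp: Y_def D'_def par'_def\<close>)
  have te': "tedge Y par' a b" if "tedge X par a b" for a b
    using that xX by (auto simp: tedge_def Y_def par'_def)
  have ac': "z \<in> Y \<Longrightarrow> active z (idx' z) \<Longrightarrow> srt z ! idx' z \<noteq> par' z \<and> K \<le> key D' z (idx' z)" for z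
  proof -
    assume z: "z \<in> Y" "active z (idx' z)"
    consider "z = y" | "z = x" | "z \<in> X" "z \<noteq> x" "z \<noteq> y" using z Y_def by blast
    then show ?thesis
    proof cases
      case 1
      have "srt y ! idx' y \<noteq> x"
        using z 1 yn srt_distinct[OF yn(1)]
        by (auto simp: idx'_def skip_def active_def nth_eq_iff_index_eq split: if_splits)
      with 1 show ?thesis using yn by (simp add: par'_def key_def D'_def)
    next
      case 2
      have si: "Suc (idx x) \<le> idx' x" by (auto simp: idx'_def skip_def)
      have "srt x ! idx' x \<noteq> par x"
        using z 2 srt_distinct[OF xn]
        by (auto simp: idx'_def skip_def active_def nth_eq_iff_index_eq split: if_splits)
          (metis Suc_lessD n_not_Suc_n nth_eq_iff_index_eq)
      moreover have "K \<le> key D x (idx' x)"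
        using srt_sorted[OF xn, of "idx x" "idx' x"] si z 2 by (simp add: K key_def active_def)
      ultimately show ?thesis using 2 yn by (simp add: par'_def key_def D'_def)
    next
      case 3
      then have "idx' z = idx z" by (simp add: idx'_def)
      then show ?thesis using 3 z m[of z] ac[of z] by (auto simp: X_def par'_def D'_def key_def)
    qed
  qed
  \<comment> \<open>An entry stepped over as the parent also counts as scanned. At the root, whose
    parent is itself, no entry matches, as there are no loops.\<close>
  have xpar: "active x (Suc (idx x)) \<Longrightarrow> srt x ! Suc (idx x) = par x \<Longrightarrow> tedge X par x (par x)"
  proof -
    assume "active x (Suc (idx x))" "srt x ! Suc (idx x) = par x"
    then have "{x, par x} \<in> E" using srt_edge[OF xn] by metis
    then have "x \<noteq> v" using treeD(3)[OF t] by auto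
    then show ?thesis using tree_stepD(1)[OF t xX(1)] xX by (simp add: tedge_def)
  qed
  have te2: "tedge Y par' z (srt z ! j)" if z: "z \<in> Y" "j < idx' z" for z j
  proof -
    consider "z = y" | "z = x" | "z \<in> X" "z \<noteq> x" "z \<noteq> y" using z Y_def by blast
    then show ?thesis
    proof cases
      case 1
      then have "srt z ! j = x" using z yn by (auto simp: idx'_def skip_def split: if_splits)
      then show ?thesis using 1 xX by (simp add: tedge_def Y_def par'_def)
    next
      case 2
      then consider "j < idx x" | "j = idx x" | "j = Suc (idx x)" "active x j" "srt x ! j = par x"
        using z by (force simp: idx'_def skip_def split: if_splits)
      then show ?thesis
      proof cases
        case 1
        then show ?thesis using te xX 2 te' by blast
      next
        case 22: 2
        then show ?thesis using 2 xX y by (simp add: tedge_def Y_def par'_def)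
      next
        case 3
        then show ?thesis using xpar te' 2 by metis
      qed
    next
      case 3
      then show ?thesis using te[of z j] z te' by (simp add: idx'_def)
    qed
  qed
  have len: "idx' z \<le> length (srt z)" if "z \<in> Y" for z
    using that idx x(2) by (auto simp: idx'_def skip_def active_def Y_def Suc_le_eq)
  have pa': "\<exists>j<idx' (par' z). srt (par' z) ! j = z" if z: "z \<in> Y" "z \<noteq> v" for z
  proof (cases "z = y")
    case True
    have "idx x < idx' x" by (auto simp: idx'_def skip_def)
    with True y yn show ?thesis by (auto simp: par'_def)
  next
    case False
    with z have zX: "z \<in> X" by (simp add: Y_def)
    with z tree_stepD(1)[OF t] have "par z \<in> X" by blast
    then have "idx (par z) \<le> idx' (par z)" using xX by (auto simp: idx'_def skip_def)
    then show ?thesis using pa[OF zX z(2)] False by (auto simp: par'_def intro: less_le_trans)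
  qed
  \<comment> \<open>The new vertex is one edge beyond an earlier one in visiting order, so its depth
    grows by at most \<open>M\<close> per position.\<close>
  have KM: "K \<le> M * cnt"
  proof -
    obtain j where j: "j < cnt" "x = ord j" using x by auto
    then have "Suc j \<le> cnt" by simp
    have "w {x, y} \<le> M" using weights[OF e] by simp
    then have "K \<le> M * j + M" using DM[OF j(1)] j by (simp add: K key_def y)
    also have "\<dots> = M * Suc j" by simp
    also have "\<dots> \<le> M * cnt" using \<open>Suc j \<le> cnt\<close> by (rule mult_le_mono2)
    finally show ?thesis .
  qed
  have "D' ((ord(cnt := y)) j) \<le> M * j" if "j < Suc cnt" for j
    using that DM KM xX by (auto simp: D'_def X_def less_Suc_eq)
  moreover have "inj_on (ord(cnt := y)) {..<Suc cnt}"
    using i(3) y(2) by (auto simp: inj_on_def less_Suc_eq)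
  moreover have "D' z \<le> K" if "z \<in> Y" for z
    using that Dk kK by (fastforce simp: D'_def Y_def)
  ultimately show ?thesis
    unfolding sinv_def Let_def Y D'_def[symmetric] par'_def[symmetric] idx'_def[symmetric]
    using i t' len te2 ac' pa' by auto
qed

lemma sinv_card: "sinv v cnt ord D par idx k \<Longrightarrow> card (ord ` {..<cnt}) = cnt \<and> cnt \<le> n"
proof -
  assume s: "sinv v cnt ord D par idx k"
  then have "card (ord ` {..<cnt}) = cnt" by (auto simp: sinv_def Let_def card_image)
  moreover have "card (ord ` {..<cnt}) \<le> card {..<n}"
    using sinv_vertex[OF s] by (intro card_mono) auto
  ultimately show ?thesis by simp
qed

end

subsection \<open>Tournament trees\<close>

text \<open>0 stands for an empty slot.\<close>

definition mn :: "nat \<Rightarrow> nat \<Rightarrow> nat" where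
  "mn a b = (if a = 0 then b else if b = 0 then a else min a b)"

text \<open>The heap numbering: root 1, inner nodes below \<open>n\<close>, leaves \<open>n\<close>
  to \<open>2 * n - 1\<close>, for every positive \<open>n\<close>; with one vertex the root is the
  only leaf.\<close>

definition tourn :: "nat \<Rightarrow> (nat \<Rightarrow> nat) \<Rightarrow> bool" where
  "tourn n T \<longleftrightarrow> (\<forall>i. 0 < i \<and> i < n \<longrightarrow> T i = mn (T (2 * i)) (T (2 * i + 1)))"

lemma tourn_zero: "(\<And>i. T i = 0) \<Longrightarrow> tourn n T"
  by (simp add: tourn_def mn_def)

text \<open>Climbing from a nonempty node to the root never increases the value and never loses it.
  Together with \<open>tourn_attained\<close> the root is the minimum of the nonempty
  leaves.\<close>

lemma tourn_lower:
  assumes "tourn n T"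
  shows "0 < i \<Longrightarrow> i < 2 * n \<Longrightarrow> T i \<noteq> 0 \<Longrightarrow> T 1 \<noteq> 0 \<and> T 1 \<le> T i"
proof (induction i rule: less_induct)
  case (less i)
  show ?case
  proof (cases "i = 1")
    case True
    with less.prems show ?thesis by simp
  next
    case False
    define j where "j = i div 2"
    have j: "0 < j" "j < i" "j < n" "i = 2 * j \<or> i = 2 * j + 1"
      using False less.prems by (auto simp: j_def)
    then have "T j = mn (T (2 * j)) (T (2 * j + 1))" using assms by (auto simp: tourn_def)
    then have "T j \<noteq> 0" "T j \<le> T i" using j(4) less.prems(3) by (auto simp: mn_def)
    then show ?thesis using less.IH[of j] j by auto
  qed
qed

lemma tourn_attained:
  assumes "tourn n T"
  shows "0 < i \<Longrightarrow> i < 2 * n \<Longrightarrow> T i \<noteq> 0 \<Longrightarrow> \<exists>x<n. T i = T (n + x)"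
proof (induction "2 * n - i" arbitrary: i rule: less_induct)
  case less
  show ?case
  proof (cases "n \<le> i")
    case True
    then show ?thesis using less.prems by (intro exI[of _ "i - n"]) auto
  next
    case False
    then have "T i = mn (T (2 * i)) (T (2 * i + 1))" using assms less.prems by (auto simp: tourn_def)
    then have "T i = T (2 * i) \<or> T i = T (2 * i + 1)" by (auto simp: mn_def min_def)
    then show ?thesis
      using less.hyps[of "2 * i"] less.hyps[of "2 * i + 1"] less.prems False by force
  qed
qed

section \<open>The program\<close>

text \<open>
  From position \<open>x * n\<close> on, array \<open>aNb\<close> lists the neighbours of \<open>x\<close> by increasing weight, each
  increased by 1 and followed by 0. The leaf of \<open>x\<close> in the tournament tree \<open>aT\<close> is
  \<open>key * n + x\<close>, where \<open>key\<close> is the radius at which the next edge of \<open>x\<close> is scanned. No variable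
  or array is numbered 1, as the simplifier would rewrite 1 to \<open>Suc 0\<close>.
\<close>

abbreviation (input) "vLen \<equiv> 0 :: nat"
abbreviation (input) "vN \<equiv> 28 :: nat"
abbreviation (input) "tI \<equiv> 2 :: nat"
abbreviation (input) "tA \<equiv> 3 :: nat"
abbreviation (input) "tB \<equiv> 4 :: nat"
abbreviation (input) "vP \<equiv> 5 :: nat"
abbreviation (input) "qI \<equiv> 6 :: nat"
abbreviation (input) "qY \<equiv> 7 :: nat"
abbreviation (input) "qV \<equiv> 8 :: nat"
abbreviation (input) "vS \<equiv> 9 :: nat"
abbreviation (input) "vL \<equiv> 10 :: nat"
abbreviation (input) "vCnt \<equiv> 11 :: nat"
abbreviation (input) "vGo \<equiv> 12 :: nat"
abbreviation (input) "vK \<equiv> 13 :: nat"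
abbreviation (input) "vX \<equiv> 14 :: nat"
abbreviation (input) "vY \<equiv> 15 :: nat"
abbreviation (input) "vE \<equiv> 16 :: nat"
abbreviation (input) "vEx \<equiv> 17 :: nat"
abbreviation (input) "vEy \<equiv> 18 :: nat"
abbreviation (input) "vI \<equiv> 19 :: nat"
abbreviation (input) "vJ \<equiv> 20 :: nat"
abbreviation (input) "vW \<equiv> 21 :: nat"
abbreviation (input) "vBest \<equiv> 22 :: nat"
abbreviation (input) "vLo \<equiv> 23 :: nat"
abbreviation (input) "vHi \<equiv> 24 :: nat"
abbreviation (input) "vZ \<equiv> 25 :: nat"
abbreviation (input) "vV \<equiv> 26 :: nat"
abbreviation (input) "vEnd \<equiv> 27 :: nat"

abbreviation (input) "aT \<equiv> 14 :: nat"
abbreviation (input) "aW \<equiv> 2 :: nat"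
abbreviation (input) "aNb \<equiv> 3 :: nat"
abbreviation (input) "aVis \<equiv> 4 :: nat"
abbreviation (input) "aD \<equiv> 5 :: nat"
abbreviation (input) "aPar \<equiv> 6 :: nat"
abbreviation (input) "aIdx \<equiv> 7 :: nat"
abbreviation (input) "aOrd \<equiv> 8 :: nat"
abbreviation (input) "aMem \<equiv> 9 :: nat"
abbreviation (input) "aCnt \<equiv> 10 :: nat"
abbreviation (input) "aBig \<equiv> 11 :: nat"
abbreviation (input) "aCy \<equiv> 12 :: nat"
abbreviation (input) "aLst \<equiv> 13 :: nat"

abbreviation (input) plus_exp (infixl \<open>.+\<close> 65) where "d .+ e \<equiv> Bin Plus d e"
abbreviation (input) minus_exp (infixl \<open>.-\<close> 65) where "d .- e \<equiv> Bin Minus d e"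
abbreviation (input) times_exp (infixl \<open>.*\<close> 70) where "d .* e \<equiv> Bin Times d e"
abbreviation (input) div_exp (infixl \<open>.div\<close> 70) where "d .div e \<equiv> Bin Div d e"

lemmas wps = wp_Sq wp_Asg wp_St wp_IF wp_SKIP

text \<open>A point update: only the ancestors of the changed leaf are recomputed. Writing 0
  deletes, so the tournament serves as a priority queue with changing keys.\<close>

definition tset :: "exp \<Rightarrow> exp \<Rightarrow> prog" where
  "tset x v =
    (Asg tI (V vN .+ x) ;; St aT (V tI) v ;;
     WH CLess (N 1) (V tI)
       (Asg tI (V tI .div N 2) ;;
        Asg tA (Rd aT (N 2 .* V tI)) ;;
        Asg tB (Rd aT (N 2 .* V tI .+ N 1)) ;;
        IF CEq (V tA) (N 0) (St aT (V tI) (V tB))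
          (IF CEq (V tB) (N 0) (St aT (V tI) (V tA))
             (IF CLeq (V tA) (V tB) (St aT (V tI) (V tA)) (St aT (V tI) (V tB))))))"

lemma tset_sets [simp]: "wv (tset x v) = {tI, tA, tB}" "wa (tset x v) = {aT}"
    "parr (tset x v) = insert aT (earr x \<union> earr v)"
  by (auto simp: tset_def)

definition push_leaf :: prog where
  "push_leaf =
    (IF CEq (V qY) (N 0) (Asg qV (N 0))
       (Asg qV ((Rd aD (V vP) .+ Rd aW (V vP .* V vN .+ (V qY .- N 1))) .* V vN .+ V vP)) ;;
     tset (V vP) (V qV))"

lemma push_leaf_sets [simp]: "wv push_leaf = {tI, tA, tB, qV}" "wa push_leaf = {aT}"
    "parr push_leaf = {aD, aW, aT}"
  by (auto simp: push_leaf_def)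

text \<open>Brings the leaf of \<open>vP\<close> up to date after its list position has changed.
  Arrays hold neighbours shifted by 1, hence the comparison with parent plus 1.\<close>

definition push :: prog where
  "push =
    (Asg qI (Rd aIdx (V vP)) ;; Asg qY (Rd aNb (V vP .* V vN .+ V qI)) ;;
     IF CEq (V qY) (Rd aPar (V vP) .+ N 1)
       (Asg qI (V qI .+ N 1) ;; St aIdx (V vP) (V qI) ;; Asg qY (Rd aNb (V vP .* V vN .+ V qI)))
       SKIP ;;
     push_leaf)"

lemma push_sets [simp]: "wv push = {tI, tA, tB, qI, qY, qV}" "wa push = {aT, aIdx}"
    "parr push = {aIdx, aNb, aPar, aD, aW, aT}"
  by (auto simp: push_def)

text \<open>The dominant words are tournament leaves, a key of at most M n + M multiplied by n plus
  a vertex. The factor 8 leaves room for sums of two depths and an edge, input addresses, and the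
  cube tried in \<open>ball_size\<close>. \<open>n < F\<close> lets the output overwrite the
  input.\<close>

locale ram_graph = wgraph +
  fixes H F lg :: nat
  assumes H: "8 * ((n + 1) * (n + 1) * (M + 1)) \<le> H"
    and F: "n < F"
    and lg: "2 * n \<le> 2 ^ lg"
begin

lemma bnd_key: "d \<le> M * n + M \<Longrightarrow> x \<le> n \<Longrightarrow> d * n + x < H"
proof -
  assume a: "d \<le> M * n + M" "x \<le> n"
  have "d * n + x \<le> (M * n + M) * n + n" using a by (intro add_mono mult_le_mono1)
  also have "\<dots> < 8 * ((n + 1) * (n + 1) * (M + 1))" by (simp add: algebra_simps)
  finally show ?thesis using H by simp
qed

lemma bnd_sq: "x \<le> n \<Longrightarrow> y \<le> n \<Longrightarrow> x * n + y < H"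
proof -
  assume a: "x \<le> n" "y \<le> n"
  then have "x * n + y \<le> n * n + n" by (intro add_mono mult_le_mono1)
  also have "\<dots> < 8 * ((n + 1) * (n + 1) * (M + 1))" by (simp add: algebra_simps)
  finally show ?thesis using H by simp
qed

lemma bnd_sum: "d \<le> 4 * (M * n) + 4 * M + 4 * n + 4 \<Longrightarrow> d < H"
proof -
  assume "d \<le> 4 * (M * n) + 4 * M + 4 * n + 4"
  also have "\<dots> < 8 * ((n + 1) * (n + 1) * (M + 1))" by (simp add: algebra_simps)
  finally show ?thesis using H by simp
qed

lemma bnd_const [simp]: "0 < H" "Suc 0 < H" "2 < H"
  by (auto intro: bnd_sum)

lemma bnd_prod: "x \<le> n \<Longrightarrow> x * n < H"
  using bnd_sq[of x 0] by simp

text \<open>Only the parent of the current node may violate the tournament condition.\<close>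

lemma wp_tset:
  assumes t: "tourn n (ar s aT)" and n: "vr s vN = n" and x: "ok H F x s" "ev x s < n"
    and v: "ok H F v (setv tI (n + ev x s) s)"
    and post: "\<And>t s'. t \<le> 8 * lg + 3 \<Longrightarrow> tourn n (ar s' aT) \<Longrightarrow>
      (\<And>y. y < n \<Longrightarrow> ar s' aT (n + y) =
        (if y = ev x s then ev v (setv tI (n + ev x s) s) else ar s aT (n + y))) \<Longrightarrow>
      (\<And>y. y \<notin> {tI, tA, tB} \<Longrightarrow> vr s' y = vr s y) \<Longrightarrow> (\<And>a. a \<noteq> aT \<Longrightarrow> ar s' a = ar s a) \<Longrightarrow> Q t s'"
  shows "wp H F (tset x v) Q s"
proof -
  define x' where "x' = ev x s"
  define v' where "v' = ev v (setv tI (n + ev x s) s)"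
  \<comment> \<open>\<open>k\<close> counts the halvings of \<open>tI\<close>, so
    \<open>vr s' tI * 2 ^ k < 2 * n\<close> bounds it by \<open>lg\<close>. An iteration costs at
    most 8: the loop test, three assignments, up to three comparisons and a store.\<close>
  define I where "I = (\<lambda>t s'. \<exists>k. t \<le> 8 * k \<and> 0 < vr s' tI \<and> vr s' tI * 2 ^ k < 2 * n \<and> 
      (\<forall>j. 0 < j \<and> j < n \<and> j \<noteq> vr s' tI div 2 \<longrightarrow>
        ar s' aT j = mn (ar s' aT (2 * j)) (ar s' aT (2 * j + 1))) \<and>
      (\<forall>y<n. ar s' aT (n + y) = (if y = x' then v' else ar s aT (n + y))))"
  have "wp H F (tset x v) (\<lambda>t s'. t \<le> 8 * lg + 3 \<and> tourn n (ar s' aT) \<and>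
      (\<forall>y<n. ar s' aT (n + y) = (if y = x' then v' else ar s aT (n + y)))) s"
    unfolding tset_def
    apply (intro wp_Sq wp_Asg wp_St)
        apply (use x n in \<open>auto intro: bnd_sum\<close>)[1]
       apply simp
      apply (use n v in simp)
     apply simp
    apply (rule wp_WH[where I = I and m = "\<lambda>s. vr s tI"])
    subgoal
      unfolding I_def
    proof (intro exI[of _ 0] conjI allI impI)
      fix j
      assume j: "0 < j \<and> j < n \<and> j \<noteq> vr (seta aT (ev (V tI) (setv tI (ev (V vN .+ x) s) s))
        (ev v (setv tI (ev (V vN .+ x) s) s)) (setv tI (ev (V vN .+ x) s) s)) tI div 2"
      then have "2 * j \<noteq> n + x'" "2 * j + 1 \<noteq> n + x'" using n by (auto simp: x'_def)
      moreover have "ar s aT j = mn (ar s aT (2 * j)) (ar s aT (2 * j + 1))"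
        using t j by (simp only: tourn_def)
      ultimately show "ar (seta aT (ev (V tI) (setv tI (ev (V vN .+ x) s) s))
        (ev v (setv tI (ev (V vN .+ x) s) s)) (setv tI (ev (V vN .+ x) s) s)) aT j =
         mn (ar (seta aT (ev (V tI) (setv tI (ev (V vN .+ x) s) s))
        (ev v (setv tI (ev (V vN .+ x) s) s)) (setv tI (ev (V vN .+ x) s) s)) aT (2 * j))
          (ar (seta aT (ev (V tI) (setv tI (ev (V vN .+ x) s) s))
        (ev v (setv tI (ev (V vN .+ x) s) s)) (setv tI (ev (V vN .+ x) s) s)) aT (2 * j + 1))"
        using j n by (simp add: x'_def)
    qed (use x n in \<open>auto simp: x'_def v'_def\<close>)
    subgoal by simp
    subgoal for t s'
    proof -
      assume I: "I t s'" and c: "cmpv CLess (ev (N 1) s') (ev (V tI) s')"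
      define i where "i = vr s' tI"
      from I obtain k where k: "t \<le> 8 * k" "i * 2 ^ k < 2 * n"
        and T: "\<And>j. 0 < j \<Longrightarrow> j < n \<Longrightarrow> j \<noteq> i div 2 \<Longrightarrow>
          ar s' aT j = mn (ar s' aT (2 * j)) (ar s' aT (2 * j + 1))"
        and lf: "\<And>y. y < n \<Longrightarrow> ar s' aT (n + y) = (if y = x' then v' else ar s aT (n + y))"
        unfolding I_def i_def by blast
      define j where "j = i div 2"
      have "i \<le> i * 2 ^ k" by simp
      then have i: "1 < i" "i < 2 * n" using c k(2) by (simp add: i_def, linarith)
      have j: "0 < j" "j < n" "j < i" using i by (auto simp: j_def)
      have jk: "j * 2 ^ Suc k < 2 * n"
      proof -
        have "j * 2 \<le> i" by (simp add: j_def)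
        then have "j * 2 * 2 ^ k \<le> i * 2 ^ k" by (rule mult_le_mono1)
        then have "j * 2 * 2 ^ k < 2 * n" using k(2) by linarith
        then show ?thesis by (simp only: power_Suc mult.assoc)
      qed
      have fin: "I u s'' \<and> j < i"
        if "u \<le> t + 8" "vr s'' tI = j" 
          "ar s'' aT = (ar s' aT)(j := mn (ar s' aT (2 * j)) (ar s' aT (2 * j + 1)))" for u s''
        unfolding I_def
      proof (intro conjI exI[of _ "Suc k"])
        show "u \<le> 8 * Suc k" using k that by simp
        show "\<forall>l. 0 < l \<and> l < n \<and> l \<noteq> vr s'' tI div 2 \<longrightarrow>
          ar s'' aT l = mn (ar s'' aT (2 * l)) (ar s'' aT (2 * l + 1))"
        proof (intro allI impI)
          fix l assume l: "0 < l \<and> l < n \<and> l \<noteq> vr s'' tI div 2"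
          then have "2 * l \<noteq> j" "2 * l + 1 \<noteq> j" using that by auto
          then show "ar s'' aT l = mn (ar s'' aT (2 * l)) (ar s'' aT (2 * l + 1))"
            using l that T[of l] j by (cases "l = j") (auto simp: j_def)
        qed
      qed (use that j jk lf i in \<open>auto simp: i_def[symmetric]\<close>)
      have b: "j < H" "2 * j < H" "2 * j + 1 < H" using j by (auto intro!: bnd_sum)
      show ?thesis
        apply (intro wps)
                            apply (simp_all add: i_def[symmetric] j_def[symmetric] b[simplified])
        apply (rule fin; simp add: mn_def min_def)+
        done
    qed
    subgoal for t s'
    proof -
      assume I: "I t s'" and c: "\<not> cmpv CLess (ev (N 1) s') (ev (V tI) s')"
      then obtain k where k: "t \<le> 8 * k" "vr s' tI * 2 ^ k < 2 * n" "0 < vr s' tI"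
        and T: "\<And>j. 0 < j \<Longrightarrow> j < n \<Longrightarrow> j \<noteq> vr s' tI div 2 \<Longrightarrow>
          ar s' aT j = mn (ar s' aT (2 * j)) (ar s' aT (2 * j + 1))"
        and lf: "\<And>y. y < n \<Longrightarrow> ar s' aT (n + y) = (if y = x' then v' else ar s aT (n + y))"
        unfolding I_def by blast
      have 1: "vr s' tI = 1" using k c by simp
      from k(2) lg have "vr s' tI * 2 ^ k < 2 ^ lg" by linarith
      then have "k < lg" unfolding 1 by simp
      moreover have "tourn n (ar s' aT)" unfolding tourn_def using T 1 by simp
      ultimately show ?thesis using k(1) lf by simp
    qed
    done
  from wp_conseq[OF this] show ?thesis
    by (rule wp_conseq) (use post in \<open>auto simp: x'_def v'_def\<close>)
qed

end

section \<open>Search from a vertex\<close>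

definition visit_init :: prog where
  "visit_init =
    (St aVis (V vY) (N 1) ;; St aD (V vY) (V vK) ;; St aPar (V vY) (V vX) ;;
     St aIdx (V vY) (N 0) ;; St aIdx (V vX) (Rd aIdx (V vX) .+ N 1) ;;
     St aOrd (V vCnt) (V vY) ;; Asg vCnt (V vCnt .+ N 1) ;; Asg vP (V vY))"

lemma visit_init_sets [simp]:
    "wv visit_init = {vCnt, vP}" "wa visit_init = {aVis, aD, aPar, aIdx, aOrd}"
    "parr visit_init = {aVis, aD, aPar, aIdx, aOrd}"
  by (auto simp: visit_init_def)

definition visit :: prog where
  "visit = (visit_init ;; push ;; Asg vP (V vX) ;; push)"

lemma visit_sets [simp]:
    "wv visit = {vCnt, vP, tI, tA, tB, qI, qY, qV}" "wa visit = {aVis, aD, aPar, aIdx, aOrd, aT}"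
    "parr visit = {aVis, aD, aPar, aIdx, aOrd, aNb, aW, aT}"
  by (auto simp: visit_def)

definition search_start :: prog where
  "search_start =
    (St aOrd (N 0) (V vS) ;; St aVis (V vS) (N 1) ;; St aD (V vS) (N 0) ;; St aPar (V vS) (V vS) ;;
     St aIdx (V vS) (N 0) ;; Asg vCnt (N 1) ;; Asg vE (N 0) ;; Asg vP (V vS))"

lemma search_start_sets [simp]:
    "wv search_start = {vCnt, vE, vP}" "wa search_start = {aOrd, aVis, aD, aPar, aIdx}"
    "parr search_start = {aOrd, aVis, aD, aPar, aIdx}"
  by (auto simp: search_start_def)

definition search_init :: prog where
  "search_init = (search_start ;; push)"

lemma search_init_sets [simp]:
    "wv search_init = {vCnt, vE, vP, tI, tA, tB, qI, qY, qV}"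
    "wa search_init = {aOrd, aVis, aD, aPar, aIdx, aT}"
    "parr search_init = {aOrd, aVis, aD, aPar, aIdx, aT, aNb, aW}"
  by (auto simp: search_init_def)

text \<open>The word at the root splits into key and vertex by division by \<open>vN\<close>. For a
  visited end the value stored in \<open>vE\<close> is the closed walk along both tree paths; no
  cycle is built yet.\<close>

definition search_step :: prog where
  "search_step =
    (Asg vK (Rd aT (N 1) .div V vN) ;; Asg vX (Rd aT (N 1) .- V vK .* V vN) ;;
     Asg vY (Rd aNb (V vX .* V vN .+ Rd aIdx (V vX)) .- N 1) ;;
     IF CNeq (Rd aVis (V vY)) (N 0)
       (Asg vE (Rd aD (V vX) .+ Rd aD (V vY) .+ Rd aW (V vX .* V vN .+ V vY)) ;;
        Asg vEx (V vX) ;; Asg vEy (V vY) ;; Asg vGo (N 0))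
       visit)"

lemma search_step_sets [simp]:
    "wv search_step = {tI, tA, tB, qI, qY, qV, vCnt, vE, vP, vGo, vK, vX, vY, vEx, vEy}"
    "wa search_step = {aOrd, aVis, aD, aPar, aIdx, aT}"
    "parr search_step = {aOrd, aVis, aD, aPar, aIdx, aT, aNb, aW}"
  by (auto simp: search_step_def)

text \<open>There are three exits: empty tournament, size limit \<open>vL\<close>, closing edge.
  Emptiness is tested before the limit, so a search complete exactly at the limit still counts as
  complete. Only a closing edge makes \<open>vE\<close> nonzero.\<close>

definition search :: prog where
  "search =
    (search_init ;; Asg vGo (N 1) ;;
     WH CNeq (V vGo) (N 0)
       (IF CEq (Rd aT (N 1)) (N 0) (Asg vGo (N 0))
       (IF CLeq (V vL) (V vCnt) (Asg vGo (N 0)) search_step)))"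

lemma search_sets [simp]:
    "wv search = {tI, tA, tB, qI, qY, qV, vCnt, vE, vP, vGo, vK, vX, vY, vEx, vEy}"
    "wa search = {aOrd, aVis, aD, aPar, aIdx, aT}"
    "parr search = {aOrd, aVis, aD, aPar, aIdx, aT, aNb, aW}"
  by (auto simp: search_def)

locale ram_search = ram_graph n E w M H F lg + sgraph n E w M srt
  for n E w M H F lg srt
begin

text \<open>The tables that no search modifies. A list has fewer than \<open>n\<close> entries, so
  each row of \<open>aNb\<close> ends with a 0 inside its \<open>n\<close> cells.\<close>

definition stat :: "hst \<Rightarrow> bool" where
  "stat s \<longleftrightarrow> vr s vN = n \<and>
     (\<forall>x<n. \<forall>y<n. ar s aW (x * n + y) = (if {x, y} \<in> E then w {x, y} else 0)) \<and>
     (\<forall>x<n. \<forall>i<n. ar s aNb (x * n + i) = (if active x i then Suc (srt x ! i) else 0))"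

text \<open>Positive weights make an active key nonzero, which frees 0 to mark absence. Packing key
  and vertex into one word orders leaves by key first.\<close>

definition leaf :: "(nat \<Rightarrow> nat) \<Rightarrow> (nat \<Rightarrow> nat) \<Rightarrow> nat \<Rightarrow> nat" where
  "leaf D idx x = (if active x (idx x) then key D x (idx x) * n + x else 0)"

lemma statD:
  assumes "stat s"
  shows "vr s vN = n" "x < n \<Longrightarrow> {x, y} \<in> E \<Longrightarrow> ar s aW (x * n + y) = w {x, y}"
    "x < n \<Longrightarrow> y < n \<Longrightarrow> ar s aW (x * n + y) = (if {x, y} \<in> E then w {x, y} else 0)"
    "x < n \<Longrightarrow> i < n \<Longrightarrow> ar s aNb (x * n + i) = (if active x i then Suc (srt x ! i) else 0)"
proof -
  have st: "vr s vN = n"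
    "\<forall>x<n. \<forall>y<n. ar s aW (x * n + y) = (if {x, y} \<in> E then w {x, y} else 0)"
    "\<forall>x<n. \<forall>i<n. ar s aNb (x * n + i) = (if active x i then Suc (srt x ! i) else 0)"
    using assms unfolding stat_def by blast+
  show "vr s vN = n" by (rule st)
  show *: "ar s aW (x * n + y) = (if {x, y} \<in> E then w {x, y} else 0)" if "x < n" "y < n"
    using st(2) that by blast
  show "ar s aW (x * n + y) = w {x, y}" if "x < n" "{x, y} \<in> E"
    using *[OF that(1)] that(2) edgeD[OF that(2)] by presburger
  show "x < n \<Longrightarrow> i < n \<Longrightarrow> ar s aNb (x * n + i) = (if active x i then Suc (srt x ! i) else 0)"
    using st(3) by blast
qed

lemma stat_cong:
  "stat s \<Longrightarrow> vr s' vN = vr s vN \<Longrightarrow> ar s' aW = ar s aW \<Longrightarrow> ar s' aNb = ar s aNb \<Longrightarrow> stat s'"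
  unfolding stat_def by metis

lemma active_lt: "x < n \<Longrightarrow> active x i \<Longrightarrow> srt x ! i < n \<and> i < n \<and> Suc i < n"
  using edgeD[OF srt_edge, of x i] length_srt[of x] by (simp add: active_def)

lemma key_le: "x < n \<Longrightarrow> active x i \<Longrightarrow> D x \<le> M * n \<Longrightarrow> key D x i \<le> M * n + M"
  using weights[OF srt_edge, of x i] by (simp add: key_def)

lemma wp_push:
  assumes st: "stat s" and x: "x = vr s vP" "x < n" and t: "tourn n (ar s aT)"
    and i: "ar s aIdx x \<le> length (srt x)" and D: "ar s aD x \<le> M * n"
    and p: "ar s aPar x < n"
  shows "wp H F push (\<lambda>t s'. t \<le> 8 * lg + 12 \<and> tourn n (ar s' aT) \<and>
    ar s' aIdx = (ar s aIdx)(x := skip (ar s aPar x) x (ar s aIdx x)) \<and>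
    (\<forall>y<n. ar s' aT (n + y) = (if y = x then leaf (ar s aD) (ar s' aIdx) x else ar s aT (n + y)))) s"
proof -
  define j where "j = ar s aIdx x"
  define j' where "j' = skip (ar s aPar x) x j"
  note S = statD[OF st]
  have jn: "j < n" using i length_srt[OF x(2)] by (simp add: j_def)
  have j'n: "j' < n" using active_lt[OF x(2)] jn by (auto simp: j'_def skip_def)
  note sj = S(4)[OF x(2) jn] and sj' = S(4)[OF x(2) j'n]
  have b: "y < n \<Longrightarrow> x * n + y < H" for y using x bnd_sq by simp
  have bs: "y \<le> n \<Longrightarrow> Suc y < H" for y by (intro bnd_sum) simp
  have skip': "j' = (if active x j \<and> srt x ! j = ar s aPar x then Suc j else j)"
    by (simp add: j'_def skip_def)
  have e: "active x j' \<Longrightarrow> ar s aW (x * n + srt x ! j') = w {x, srt x ! j'}"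
    using S(2) srt_edge x by blast
  have kb: "key (ar s aD) x j' * n + x < H" "key (ar s aD) x j' < H" "key (ar s aD) x j' * n < H"
    if "active x j'"
  proof -
    have k: "key (ar s aD) x j' \<le> M * n + M" by (rule key_le[where D = "ar s aD", OF x(2) that D])
    show "key (ar s aD) x j' * n + x < H" using bnd_key[OF k, of x] x by simp
    show "key (ar s aD) x j' * n < H" using bnd_key[OF k, of 0] by simp
    show "key (ar s aD) x j' < H" using k by (intro bnd_sum) linarith
  qed
  have A: "wp H F push (\<lambda>t s'. t \<le> 8 * lg + 12 \<and> tourn n (ar s' aT) \<and>
    ar s' aIdx = (ar s aIdx)(x := j') \<and>
    (\<forall>y<n. ar s' aT (n + y) = (if y = x then leaf (ar s aD) ((ar s aIdx)(x := j')) x else ar s aT (n + y)))) s"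
  proof -
    define y where "y = ar s aNb (x * n + j')"
    have y: "y = (if active x j' then Suc (srt x ! j') else 0)" using sj' by (simp add: y_def)
    have yn: "y - 1 < n" using active_lt[OF x(2), of j'] y n_pos by simp
    have B: "wp H F push_leaf (\<lambda>t s'. t \<le> 8 * lg + 5 \<and> tourn n (ar s' aT) \<and> (\<forall>y<n. ar s' aT (n + y) =
         (if y = x then leaf (ar s aD) ((ar s aIdx)(x := j')) x else ar s aT (n + y)))) s'"
      if s': "vr s' qY = y" "ar s' aD = ar s aD" "ar s' aW = ar s aW" "vr s' vN = n" "vr s' vP = x"
        "ar s' aT = ar s aT" for s'
    proof (cases "active x j'")
      case False
      then have "y = 0" by (simp add: y)
      with False show ?thesis
        unfolding push_leaf_def
        apply (simp add: wp_eqs s')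
        apply (rule wp_tset)
        apply (simp_all add: s' t x(2) leaf_def)
        done
    next
      case True
      then have y: "y = Suc (srt x ! j')" by (simp add: y)
      have k: "ar s aD x + ar s aW (x * n + srt x ! j') = key (ar s aD) x j'"
        using e[OF True] by (simp add: key_def)
      have z: "srt x ! j' < n" using active_lt[OF x(2) True] by simp
      from True show ?thesis
        unfolding push_leaf_def
        apply (simp add: wp_eqs s' y k kb b z bnd_prod x(2) less_imp_le)
        apply (rule wp_tset)
        apply (simp_all add: s' t x(2) leaf_def)
        done
    qed
    show ?thesis
    proof (cases "active x j \<and> srt x ! j = ar s aPar x")
      case True
      then have j': "j' = Suc j" and y0: "ar s aNb (x * n + j) = Suc (ar s aPar x)"
        using skip' sj by simp_all
      have y1: "ar s aNb (Suc (x * n + j)) = y" "Suc (x * n + j) < H"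
        using b[OF j'n] by (simp_all add: y_def j')
      show ?thesis
        unfolding push_def
        apply (simp add: wp_eqs S(1) j_def[symmetric] x(1)[symmetric] x(2) b jn bnd_prod y0 y1 bs p less_imp_le)
        apply (rule wp_conseq, rule B)
        apply (simp_all add: y_def S(1) j' x(1)[symmetric])
        done
    next
      case False
      then have j': "j' = j" and y0: "y \<noteq> Suc (ar s aPar x)"
        using skip' sj by (simp_all add: y_def split: if_splits)
      have y1: "ar s aNb (x * n + j) = y" by (simp add: y_def j')
      have idj: "(ar s aIdx)(x := j) = ar s aIdx" by (simp add: j_def)
      show ?thesis
        unfolding push_def
        apply (simp add: wp_eqs S(1) j_def[symmetric] x(1)[symmetric] x(2) b jn bnd_prod y0 y1 bs p less_imp_le)
        apply (rule wp_conseq, rule B)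
        apply (simp_all add: y_def S(1) j' x(1)[symmetric] idj)
        done
    qed
  qed
  show ?thesis
    by (rule wp_conseq[OF A]) (simp add: j'_def j_def)
qed

section \<open>Machine states during a search\<close>

definition vis :: "hst \<Rightarrow> nat set" where
  "vis s = ar s aOrd ` {..<vr s vCnt}"

text \<open>The radius \<open>k\<close> is a ghost parameter. Leaves and marks vanish outside the
  visited set, so the tournament contains exactly the pending edges of the tree.\<close>

definition sst :: "nat \<Rightarrow> nat \<Rightarrow> hst \<Rightarrow> bool" where
  "sst v k s \<longleftrightarrow> stat s \<and> tourn n (ar s aT) \<and>
     sinv v (vr s vCnt) (ar s aOrd) (ar s aD) (ar s aPar) (ar s aIdx) k \<and>
     (\<forall>x<n. ar s aVis x = (if x \<in> vis s then 1 else 0)) \<and>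
     (\<forall>x<n. ar s aT (n + x) = (if x \<in> vis s then leaf (ar s aD) (ar s aIdx) x else 0))"

text \<open>The promise behind a nonzero \<open>vE\<close>: these are the data from which
  \<open>climb\<close> can start, and \<open>vE\<close> is the estimate it preserves.\<close>

definition cand :: "hst \<Rightarrow> bool" where
  "cand s \<longleftrightarrow> vr s vEx \<in> vis s \<and> vr s vEy \<in> vis s \<and> {vr s vEx, vr s vEy} \<in> E \<and>
     \<not> tedge (vis s) (ar s aPar) (vr s vEx) (vr s vEy) \<and>
     vr s vE = ar s aD (vr s vEx) + ar s aD (vr s vEy) + w {vr s vEx, vr s vEy}"

lemma sstD:
  assumes "sst v k s"
  shows "stat s" "tourn n (ar s aT)"
    "sinv v (vr s vCnt) (ar s aOrd) (ar s aD) (ar s aPar) (ar s aIdx) k"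
    "x < n \<Longrightarrow> ar s aVis x = (if x \<in> vis s then 1 else 0)"
    "x < n \<Longrightarrow> ar s aT (n + x) = (if x \<in> vis s then leaf (ar s aD) (ar s aIdx) x else 0)"
  using assms unfolding sst_def by blast+

lemma sst_vis:
  assumes "sst v k s" "x \<in> vis s"
  shows "x < n" "ar s aD x \<le> M * n" "ar s aIdx x \<le> length (srt x)" "ar s aPar x < n"
    "ar s aD x \<le> k" "active x (ar s aIdx x) \<Longrightarrow> k \<le> key (ar s aD) x (ar s aIdx x)"
proof -
  note s = sstD(3)[OF assms(1)]
  have x: "x \<in> ar s aOrd ` {..<vr s vCnt}" using assms(2) by (simp add: vis_def)
  show "x < n" by (rule sinv_vertex[OF s x])
  obtain j where j: "j < vr s vCnt" "x = ar s aOrd j" using x by blast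
  have "ar s aD x \<le> M * j" using sinvD(8)[OF s j(1)] j by simp
  also have "\<dots> \<le> M * n" using j sinv_card[OF s] by (intro mult_le_mono2) simp
  finally show "ar s aD x \<le> M * n" .
  show "ar s aIdx x \<le> length (srt x)" by (rule sinvD(5)[OF s x])
  show "ar s aD x \<le> k" by (rule sinvD(7)[OF s x])
  show "active x (ar s aIdx x) \<Longrightarrow> k \<le> key (ar s aD) x (ar s aIdx x)"
    by (rule sinvD(6)[OF s x])
  have "ar s aPar x \<in> ar s aOrd ` {..<vr s vCnt}"
    using tree_stepD(1)[OF sinv_tree[OF s] x] treeD[OF sinv_tree[OF s]] by (cases "x = v") simp_all
  then show "ar s aPar x < n" by (rule sinv_vertex[OF s])
qed

text \<open>Active leaves are positive, so an empty root means that nothing is pending. Dividing the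
  comparison of packed words by \<open>n\<close> leaves the comparison of keys.\<close>

lemma leaf_root:
  assumes "sst v k s"
  shows "ar s aT 1 = 0 \<Longrightarrow> x \<in> vis s \<Longrightarrow> \<not> active x (ar s aIdx x)"
    and "ar s aT 1 \<noteq> 0 \<Longrightarrow> \<exists>x\<in>vis s. active x (ar s aIdx x) \<and>
      ar s aT 1 = key (ar s aD) x (ar s aIdx x) * n + x \<and>
      (\<forall>z\<in>vis s. active z (ar s aIdx z) \<longrightarrow> key (ar s aD) x (ar s aIdx x) \<le> key (ar s aD) z (ar s aIdx z))"
proof -
  note s = sstD[OF assms]
  have leaf: "ar s aT (n + x) = key (ar s aD) x (ar s aIdx x) * n + x \<and> ar s aT (n + x) \<noteq> 0"
    if "x \<in> vis s" "active x (ar s aIdx x)" for x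
  proof -
    have "0 < key (ar s aD) x (ar s aIdx x)"
      using weight_pos[OF srt_edge[OF sst_vis(1)[OF assms that(1)] that(2)]] by (simp add: key_def)
    then show ?thesis using s(5)[of x] sst_vis(1)[OF assms that(1)] that n_pos by (simp add: leaf_def)
  qed
  have low: "ar s aT 1 \<noteq> 0 \<and> ar s aT 1 \<le> ar s aT (n + x)"
    if "x \<in> vis s" "active x (ar s aIdx x)" for x
    by (rule tourn_lower[OF s(2)]) (use leaf[OF that] sst_vis(1)[OF assms that(1)] n_pos in auto)
  show "ar s aT 1 = 0 \<Longrightarrow> x \<in> vis s \<Longrightarrow> \<not> active x (ar s aIdx x)" using low by blast
  assume nz: "ar s aT 1 \<noteq> 0"
  obtain x where x: "x < n" "ar s aT 1 = ar s aT (n + x)"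
    using tourn_attained[OF s(2), of 1] nz n_pos by auto
  then have xv: "x \<in> vis s" "active x (ar s aIdx x)"
    using nz s(5)[of x] by (auto simp: leaf_def split: if_splits)
  have "key (ar s aD) x (ar s aIdx x) \<le> key (ar s aD) z (ar s aIdx z)"
    if z: "z \<in> vis s" "active z (ar s aIdx z)" for z
  proof -
    have "key (ar s aD) x (ar s aIdx x) * n + x \<le> key (ar s aD) z (ar s aIdx z) * n + z"
      using low[OF z] leaf[OF z] leaf[OF xv] x by simp
    from div_le_mono[OF this, of n] show ?thesis
      using x sst_vis(1)[OF assms z(1)] by simp
  qed
  then show "\<exists>x\<in>vis s. active x (ar s aIdx x) \<and>
      ar s aT 1 = key (ar s aD) x (ar s aIdx x) * n + x \<and>
      (\<forall>z\<in>vis s. active z (ar s aIdx z) \<longrightarrow> key (ar s aD) x (ar s aIdx x) \<le> key (ar s aD) z (ar s aIdx z))"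
    using xv leaf[OF xv] x by auto
qed

text \<open>Both ends need a fresh leaf: \<open>y\<close> enters the queue and \<open>x\<close>
  moves past the entry of \<open>y\<close>. The two updates account for
  \<open>16 * lg\<close>.\<close>

lemma wp_visit:
  assumes s: "sst v k s" and x: "x \<in> vis s" "active x (ar s aIdx x)" "x = vr s vX"
    and y: "y = srt x ! ar s aIdx x" "y \<notin> vis s" "y = vr s vY"
    and K: "vr s vK = key (ar s aD) x (ar s aIdx x)"
    and m: "\<And>z. z \<in> vis s \<Longrightarrow> active z (ar s aIdx z) \<Longrightarrow> vr s vK \<le> key (ar s aD) z (ar s aIdx z)"
  shows "wp H F visit (\<lambda>t s'. t \<le> 16 * lg + 40 \<and> sst v (vr s vK) s' \<and> vr s' vCnt = Suc (vr s vCnt)) s"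
proof -
  define K where "K = vr s vK"
  define cnt where "cnt = vr s vCnt"
  define D' where "D' = (ar s aD)(y := K)"
  define par' where "par' = (ar s aPar)(y := x)"
  \<comment> \<open>The positions before the two calls of \<open>push\<close>; stepping over parents
    turns \<open>ix\<close> into \<open>idx'\<close>.\<close>
  define ix where "ix = (ar s aIdx)(y := 0, x := Suc (ar s aIdx x))"
  define idx' where "idx' = (ar s aIdx)(y := skip x y 0, x := skip (ar s aPar x) x (Suc (ar s aIdx x)))"
  note S = sstD[OF s]
  note X = sst_vis[OF s x(1)]
  have yn: "y < n" using active_lt[OF X(1) x(2)] y by simp
  have xy: "x \<noteq> y" using x y by blast
  have cn: "cnt \<le> n" using sinv_card[OF S(3)] by (simp add: cnt_def)
  have lenx: "Suc (ar s aIdx x) \<le> length (srt x)" using x(2) by (simp add: active_def)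
  \<comment> \<open>The first call of \<open>push\<close> already needs a bound on the depth of
    \<open>y\<close>; it is read off the invariant for the enlarged tree, where \<open>y\<close> has
    position \<open>cnt \<le> n\<close>.\<close>
  have KM: "K \<le> M * n"
  proof -
    have "sinv v (Suc cnt) ((ar s aOrd)(cnt := y)) D' par' idx' K"
      unfolding D'_def par'_def idx'_def cnt_def K_def
      using sinv_visit[OF S(3), of x "vr s vK" y] x(1,2) y(1,2) K m by (simp add: vis_def)
    note si = this
    have "D' (((ar s aOrd)(cnt := y)) cnt) \<le> M * cnt"
      by (rule sinvD(8)[OF si]) simp
    also have "\<dots> \<le> M * n" using cn by simp
    finally show ?thesis by (simp add: D'_def)
  qed
  have si: "sinv v (Suc cnt) ((ar s aOrd)(cnt := y)) D' par' idx' K"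
    unfolding D'_def par'_def idx'_def cnt_def K_def
    using sinv_visit[OF S(3), of x "vr s vK" y] x(1,2) y(1,2) K m by (simp add: vis_def)
  have vis': "((ar s aOrd)(cnt := y)) ` {..<Suc cnt} = insert y (vis s)"
    by (auto simp: vis_def cnt_def lessThan_Suc)
  have 1: "wp H F visit_init (\<lambda>t s'. t = 8 \<and> ar s' aVis = (ar s aVis)(y := 1) \<and> ar s' aD = D' \<and>
      ar s' aPar = par' \<and> ar s' aIdx = ix \<and> ar s' aOrd = (ar s aOrd)(cnt := y) \<and>
      vr s' vCnt = Suc cnt \<and> vr s' vP = y) s"
    unfolding visit_init_def
    using lenx length_srt[OF X(1)] cn xy
    by (simp add: wp_eqs x(3)[symmetric] y(3)[symmetric] D'_def par'_def ix_def K_def cnt_def bnd_sum)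
  have leafz: "leaf D' ix z = leaf (ar s aD) (ar s aIdx) z" "leaf D' idx' z = leaf (ar s aD) (ar s aIdx) z"
    if "z \<noteq> x" "z \<noteq> y" for z
    using that by (simp_all add: leaf_def D'_def ix_def idx'_def key_def)
  show ?thesis
    unfolding visit_def
    apply (rule wp_Sq, rule wp_conseq, rule 1)
    apply (rule wp_Sq, rule wp_conseq, rule wp_push[where x = y])
    subgoal by (rule stat_cong[OF S(1)]) simp_all
    subgoal by simp
    subgoal using yn by simp
    subgoal using S(2) by simp
    subgoal using xy by (simp add: ix_def)
    subgoal using KM by (simp add: D'_def)
    subgoal using X(1) by (simp add: par'_def)
    subgoal for t1 s1 t2 s2
      apply (simp add: wp_eqs)
      apply (rule wp_conseq, rule wp_push[where x = x])
      subgoal by (rule stat_cong[OF S(1)]) simp_all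
      subgoal by (simp add: x(3))
      subgoal using X(1) by simp
      subgoal by simp
      subgoal using lenx xy by (simp add: ix_def x(3)[symmetric])
      subgoal using X(2) xy by (simp add: D'_def x(3)[symmetric])
      subgoal using X(4) xy by (simp add: par'_def x(3)[symmetric])
      subgoal premises p for t3 s3
      proof -
        have idx2: "ar s2 aIdx = ix(y := skip x y 0)"
          using p xy by (simp add: par'_def ix_def)
        have "ar s3 aIdx = (ar s2 aIdx)(x := skip (par' x) x (ar s2 aIdx x))"
          using p by (simp add: x(3))
        then have idx3: "ar s3 aIdx = idx'"
          using xy by (auto simp: idx2 par'_def ix_def idx'_def)
        have arr: "ar s3 aVis = (ar s aVis)(y := 1)" "ar s3 aD = D'" "ar s3 aPar = par'"
          "ar s3 aOrd = (ar s aOrd)(cnt := y)" "vr s3 vCnt = Suc cnt"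
          using p by simp_all
        have T: "ar s3 aT (n + z) = (if z = x then leaf D' idx' x
            else if z = y then leaf D' (ar s2 aIdx) y else ar s aT (n + z))" if "z < n" for z
          using p that idx3 by (simp add: x(3))
        have V: "vis s3 = insert y (vis s)" using vis' by (simp add: vis_def arr)
        have "leaf D' (ar s2 aIdx) y = leaf D' idx' y"
          using xy by (simp add: idx2 leaf_def idx'_def)
        then have "\<forall>z<n. ar s3 aT (n + z) = (if z \<in> vis s3 then leaf D' idx' z else 0)"
          using T S(5) leafz x(1) unfolding V by auto
        moreover have "stat s3" by (rule stat_cong[OF S(1)]) (use p in simp_all)
        moreover have "\<forall>z<n. ar s3 aVis z = (if z \<in> vis s3 then 1 else 0)"
          using S(4) unfolding V arr by auto
        moreover have "tourn n (ar s3 aT)" using p by simp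
        ultimately have "sst v K s3" unfolding sst_def arr idx3 using si by blast
        then show ?thesis using p by (simp add: K_def cnt_def)
      qed
      done
    done
qed

text \<open>What a search expects to find. Depths, parents, positions and visiting order may hold
  stale values, since a vertex gets new ones when it is visited.\<close>

definition clean :: "hst \<Rightarrow> bool" where
  "clean s \<longleftrightarrow> stat s \<and> tourn n (ar s aT) \<and> (\<forall>x<n. ar s aT (n + x) = 0 \<and> ar s aVis x = 0)"

lemma sst_cong:
  "sst v k s \<Longrightarrow> ar s' = ar s \<Longrightarrow> vr s' vN = vr s vN \<Longrightarrow> vr s' vCnt = vr s vCnt \<Longrightarrow> sst v k s'"
  unfolding sst_def vis_def using stat_cong[of s s'] by simp

lemma wp_search_init:
  assumes c: "clean s" and v: "v = vr s vS" "v < n"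
  shows "wp H F search_init (\<lambda>t s'. t \<le> 8 * lg + 20 \<and> sst v 0 s' \<and> vr s' vCnt = 1 \<and> vr s' vE = 0) s"
proof -
  have st: "stat s" and T: "tourn n (ar s aT)" and z: "\<And>x. x < n \<Longrightarrow> ar s aT (n + x) = 0 \<and> ar s aVis x = 0"
    using c by (auto simp: clean_def)
  have 1: "wp H F search_start (\<lambda>t s'. t = 8 \<and> ar s' aVis = (ar s aVis)(v := 1) \<and>
      ar s' aD = (ar s aD)(v := 0) \<and> ar s' aPar = (ar s aPar)(v := v) \<and>
      ar s' aIdx = (ar s aIdx)(v := 0) \<and> ar s' aOrd = (ar s aOrd)(0 := v) \<and>
      vr s' vCnt = 1 \<and> vr s' vE = 0 \<and> vr s' vP = v) s"
    unfolding search_start_def by (simp add: wp_eqs v(1)[symmetric])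
  \<comment> \<open>The root is its own parent and not its own neighbour, so the first entry is
    never stepped over.\<close>
  have sk: "skip v v 0 = 0" using srt_edge[OF v(2), of 0] by (auto simp: skip_def)
  show ?thesis
    unfolding search_init_def
    apply (rule wp_Sq, rule wp_conseq, rule 1)
    apply (rule wp_conseq, rule wp_push[where x = v])
    subgoal by (rule stat_cong[OF st]) simp_all
    subgoal by simp
    subgoal by (rule v)
    subgoal using T by simp
    subgoal by simp
    subgoal by simp
    subgoal using v by simp
    subgoal premises p for t1 s1 t2 s2
    proof -
      have arr: "ar s2 aVis = (ar s aVis)(v := 1)" "ar s2 aD = (ar s aD)(v := 0)"
        "ar s2 aPar = (ar s aPar)(v := v)" "ar s2 aOrd = (ar s aOrd)(0 := v)"
        "ar s2 aIdx = (ar s aIdx)(v := 0)" "vr s2 vCnt = 1"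
        using p sk by simp_all
      have V: "vis s2 = {v}" by (auto simp: vis_def arr)
      have "\<forall>x<n. ar s2 aT (n + x) = (if x \<in> vis s2 then leaf (ar s2 aD) (ar s2 aIdx) x else 0)"
        using p z unfolding V by simp
      moreover have "\<forall>x<n. ar s2 aVis x = (if x \<in> vis s2 then 1 else 0)"
        using z unfolding V arr by simp
      moreover have "sinv v (vr s2 vCnt) (ar s2 aOrd) (ar s2 aD) (ar s2 aPar) (ar s2 aIdx) 0"
        unfolding arr by (rule sinv_init) (use v in auto)
      moreover have "stat s2" by (rule stat_cong[OF st]) (use p in simp_all)
      moreover have "tourn n (ar s2 aT)" using p by simp
      ultimately have "sst v 0 s2" unfolding sst_def by blast
      then show ?thesis using p by simp
    qed
    done
qed

text \<open>Minimality of the root key makes the tree closed at \<open>K\<close>, so an edge into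
  the visited set yields a full certificate at radius \<open>K\<close>; otherwise the step visits
  one new vertex.\<close>

lemma wp_search_step:
  assumes s: "sst v k s" and e: "vr s vE = 0" and T: "ar s aT 1 \<noteq> 0"
  shows "wp H F search_step (\<lambda>t s'. t \<le> 16 * lg + 46 \<and>
    (vr s' vGo = vr s vGo \<and> vr s' vE = 0 \<and> (\<exists>k. sst v k s') \<and> vr s' vCnt = Suc (vr s vCnt) \<or>
     vr s' vGo = 0 \<and> (\<exists>k. sst v k s') \<and> vr s' vCnt = vr s vCnt \<and> cand s' \<and> full_ok v (vr s' vE))) s"
proof -
  note S = sstD[OF s]
  obtain x where x: "x \<in> vis s" "active x (ar s aIdx x)"
    and T1: "ar s aT 1 = key (ar s aD) x (ar s aIdx x) * n + x"
    and m: "\<And>z. z \<in> vis s \<Longrightarrow> active z (ar s aIdx z) \<Longrightarrow>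
      key (ar s aD) x (ar s aIdx x) \<le> key (ar s aD) z (ar s aIdx z)"
    using leaf_root(2)[OF s T] by blast
  define i where "i = ar s aIdx x"
  define y where "y = srt x ! i"
  define K where "K = key (ar s aD) x i"
  note X = sst_vis[OF s x(1)]
  have T1': "ar s aT (Suc 0) = K * n + x" using T1 by (simp add: K_def i_def)
  have yn: "y < n" "i < n" using active_lt[OF X(1) x(2)] by (simp_all add: y_def i_def)
  have ed: "{x, y} \<in> E" unfolding y_def i_def by (rule srt_edge[OF X(1) x(2)])
  have Nb: "ar s aNb (x * n + i) = Suc y"
    using statD(4)[OF S(1) X(1) yn(2)] x(2) by (simp add: y_def i_def)
  have KM: "K \<le> M * n + M" unfolding K_def i_def by (rule key_le[where D = "ar s aD", OF X(1) x(2) X(2)])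
  have N: "vr s vN = n" by (rule statD(1)[OF S(1)])
  have Kn: "K * n < H" "x * n < H" "x * n + i < H" "x * n + y < H"
    using bnd_key[OF KM, of 0] bnd_prod[of x] bnd_sq[of x i] bnd_sq[of x y] X(1) yn by simp_all
  have arith: "(K * n + x) div n = K" using X(1) by simp
  note F1 = T1' N arith Kn Nb i_def[symmetric]
  show ?thesis
  proof (cases "y \<in> vis s")
    case False
    define s1 where "s1 = setv vY y (setv vX x (setv vK K s))"
    have "sst v k s1" by (rule sst_cong[OF s]) (simp_all add: s1_def)
    moreover have "vis s1 = vis s" "ar s1 = ar s" by (simp_all add: s1_def vis_def)
    ultimately have "wp H F visit (\<lambda>t s'. t \<le> 16 * lg + 40 \<and> sst v (vr s1 vK) s' \<and>
        vr s' vCnt = Suc (vr s1 vCnt)) s1"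
      by (intro wp_visit[where x = x and y = y])
        (use x m False in \<open>auto simp: s1_def y_def K_def i_def\<close>)
    then have W: "wp H F visit (\<lambda>t s'. t \<le> 16 * lg + 40 \<and> (\<exists>k. sst v k s') \<and>
        vr s' vGo = vr s vGo \<and> vr s' vE = 0 \<and> vr s' vCnt = Suc (vr s vCnt)) s1"
      by (rule wp_conseq) (auto simp: s1_def e)
    show ?thesis
      unfolding search_step_def
      using False S(4)[OF yn(1)]
      apply (simp add: wp_eqs F1)
      apply (rule wp_conseq, rule W[unfolded s1_def])
      apply auto
      done
  next
    case True
    have te: "\<not> tedge (vis s) (ar s aPar) x y"
      using sinv_closing[OF S(3), of x] x True unfolding vis_def y_def i_def by blast
    have cl: "closed (vis s) (ar s aD) (ar s aPar) K"
      unfolding vis_def K_def i_def by (rule sinv_closed[OF S(3)]) (use m in \<open>simp add: vis_def\<close>)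
    have Wxy: "ar s aW (x * n + y) = w {x, y}" by (rule statD(2)[OF S(1) X(1) ed])
    have Dxy: "ar s aD x + w {x, y} = K" by (simp add: K_def key_def y_def)
    \<comment> \<open>\<open>y\<close> was reached no later than the current radius, so both
      summands of the closed walk, \<open>D x + w\<close> and \<open>D y\<close>, are at most
      \<open>K\<close>.\<close>
    have "ar s aD y \<le> k" "k \<le> K" using sst_vis(5)[OF s True] X(6) x(2) by (simp_all add: K_def i_def)
    then have "ar s aD x + ar s aD y + w {x, y} \<le> 2 * K" using Dxy by simp
    moreover have "ar s aD x + ar s aD y + w {x, y} \<noteq> 0" using weight_pos[OF ed] by simp
    ultimately have fo: "full_ok v (ar s aD x + ar s aD y + w {x, y})"
      unfolding full_ok_def using cl sinv_tree[OF S(3)] unfolding vis_def by blast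
    have wM: "w {x, y} \<le> M" using weights[OF ed] by simp
    have Dy: "ar s aD y \<le> M * n" by (rule sst_vis(2)[OF s True])
    have b1: "ar s aD x + ar s aD y < H" using X(2) Dy by (intro bnd_sum) simp
    have b2: "ar s aD x + ar s aD y + w {x, y} < H" using X(2) Dy wM by (intro bnd_sum) simp
    have ss: "sst v k s'" if "ar s' = ar s" "vr s' vN = vr s vN" "vr s' vCnt = vr s vCnt" for s'
      using sst_cong[OF s] that by blast
    show ?thesis
      unfolding search_step_def
      using True S(4)[OF yn(1)]
      apply (simp add: wp_eqs F1 b1 b2 Wxy)
      apply (intro disjI2 conjI exI[of _ k] ss)
      apply (simp_all add: cand_def vis_def[symmetric] fo)
      apply (use x True ed te in \<open>auto simp: vis_def\<close>)
      done
  qed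
qed

text \<open>Only the cut-off case, with no edge found and exactly \<open>vL\<close> vertices, lacks
  a full certificate; the pair test has to supply a ball certificate there.\<close>

definition searched :: "nat \<Rightarrow> hst \<Rightarrow> bool" where
  "searched v s \<longleftrightarrow> (\<exists>k. sst v k s) \<and> vr s vCnt \<le> vr s vL \<and> (vr s vE \<noteq> 0 \<longrightarrow> cand s) \<and>
     (full_ok v (vr s vE) \<or> vr s vE = 0 \<and> vr s vL = vr s vCnt)"

text \<open>Every round except the last adds a vertex, so the number of rounds, and with it the
  time, is governed by the visited vertices and not by their degrees.\<close>

lemma wp_search:
  assumes c: "clean s" and v: "v = vr s vS" "v < n" and L: "1 \<le> vr s vL"
  shows "wp H F search (\<lambda>t s'. t \<le> (16 * lg + 50) * (vr s' vCnt + 2) \<and> searched v s') s"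
proof -
  define C where "C = 16 * lg + 50"
  define I where "I = (\<lambda>t s'. vr s' vL = vr s vL \<and> vr s' vCnt \<le> vr s vL \<and> (\<exists>k. sst v k s') \<and>
    (if vr s' vGo = 0 then t \<le> C * (vr s' vCnt + 1) \<and> searched v s'
     else vr s' vE = 0 \<and> t \<le> C * vr s' vCnt))"
  show ?thesis
    unfolding search_def
    apply (rule wp_Sq, rule wp_conseq, rule wp_search_init[OF c v])
    apply (rule wp_Sq, simp add: wp_eqs)
    apply (rule wp_WH[where I = I and m = "\<lambda>s. if vr s vGo = 0 then 0 else Suc (n - vr s vCnt)"])
    subgoal for t s1 using L
      by (auto simp: I_def intro!: sst_cong[of v 0 s1] exI[of _ 0])
    subgoal by simp
    subgoal premises p for t0 s0 t1 s1
    proof -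
      from p have I: "I t1 s1" and go: "vr s1 vGo \<noteq> 0" by simp_all
      then obtain k where k: "sst v k s1" and i: "vr s1 vL = vr s vL" "vr s1 vCnt \<le> vr s vL"
        "vr s1 vE = 0" "t1 \<le> C * vr s1 vCnt" by (auto simp: I_def)
      note S = sstD[OF k]
      show ?thesis
      proof (cases "ar s1 aT (Suc 0) = 0")
        case True
        have "closed (vis s1) (ar s1 aD) (ar s1 aPar) k'" for k'
          unfolding vis_def
          by (rule sinv_closed[OF S(3)]) (use leaf_root(1)[OF k] True in \<open>auto simp: vis_def\<close>)
        then have "full_ok v 0" unfolding full_ok_def vis_def using sinv_tree[OF S(3)] by blast
        then have "searched v (setv vGo 0 s1)"
          using i k by (auto simp: searched_def intro!: exI[of _ k] sst_cong[OF k])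
        then show ?thesis using True i go k
          by (auto simp: wp_eqs I_def C_def intro!: exI[of _ k] sst_cong[OF k])
      next
        case T: False
        show ?thesis
        proof (cases "vr s1 vL \<le> vr s1 vCnt")
          case True
          then have "searched v (setv vGo 0 s1)"
            using i k by (auto simp: searched_def intro!: exI[of _ k] sst_cong[OF k])
          then show ?thesis using True T i go k
            by (auto simp: wp_eqs I_def C_def intro!: exI[of _ k] sst_cong[OF k])
        next
          case False
          have T': "ar s1 aT 1 \<noteq> 0" using T by simp
          show ?thesis
            using T False go
            apply (simp add: wp_eqs)
            apply (rule wp_conseq, rule wp_search_step[OF k i(3) T'])
            subgoal premises q for t2 s2
            proof -
              have f: "vr s2 vL = vr s1 vL" using q by simp
              from q have t2: "t2 \<le> 16 * lg + 46" by blast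
              from q consider (a) k' where "vr s2 vGo = vr s1 vGo" "vr s2 vE = 0" "sst v k' s2"
                 "vr s2 vCnt = Suc (vr s1 vCnt)"
                | (b) k' where "vr s2 vGo = 0" "sst v k' s2" "vr s2 vCnt = vr s1 vCnt" "cand s2"
                  "full_ok v (vr s2 vE)" by blast
              then show ?thesis
              proof cases
                case a
                have "vr s2 vCnt \<le> n" using sinv_card[OF sstD(3)[OF a(3)]] by simp
                then show ?thesis using a i f go t2 False by (auto simp: I_def C_def)
              next
                case b
                then have "searched v s2" using i f by (auto simp: searched_def)
                then show ?thesis using b i f go t2 by (auto simp: I_def C_def)
              qed
            qed
            done
        qed
      qed
    qed
    subgoal for t0 s0 t1 s1
      by (auto simp: I_def C_def algebra_simps)
    done
qed

end

section \<open>Closing edges and their cycles\<close>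

text \<open>The matrix \<open>aW\<close> decides adjacency in constant time, so a ball costs the
  square of its size rather than the sum of its degrees. Tree edges are recognised by their
  parents.\<close>

definition pair_step :: prog where
  "pair_step =
    (Asg vY (Rd aOrd (V vJ)) ;; Asg vW (Rd aW (V vX .* V vN .+ V vY)) ;;
     IF CEq (V vW) (N 0) SKIP (IF CEq (Rd aPar (V vX)) (V vY) SKIP (IF CEq (Rd aPar (V vY)) (V vX) SKIP
       (Asg vW (Rd aD (V vX) .+ Rd aD (V vY) .+ V vW) ;;
        IF CEq (V vE) (N 0)
          (Asg vE (V vW) ;; Asg vEx (V vX) ;; Asg vEy (V vY))
          (IF CLess (V vW) (V vE) (Asg vE (V vW) ;; Asg vEx (V vX) ;; Asg vEy (V vY)) SKIP)))))"

lemma pair_step_sets [simp]: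
    "wv pair_step = {vY, vW, vE, vEx, vEy}" "wa pair_step = {}" "parr pair_step = {aOrd, aW, aPar, aD}"
  by (auto simp: pair_step_def)

definition pairs :: prog where
  "pairs = FOR vI vCnt (Asg vX (Rd aOrd (V vI)) ;; FOR vJ vCnt pair_step)"

lemma pairs_sets [simp]:
    "wv pairs = {vI, vJ, vX, vY, vW, vE, vEx, vEy}" "wa pairs = {}" "parr pairs = {aOrd, aW, aPar, aD}"
  by (auto simp: pairs_def)

definition climb_step :: prog where
  "climb_step =
    (IF CLess (Rd aD (V vY)) (Rd aD (V vX))
       (Asg vLo (V vLo .- N 1) ;; St aCy (V vLo) (V vX) ;; Asg vX (Rd aPar (V vX)))
       (St aCy (V vHi) (V vY) ;; Asg vHi (V vHi .+ N 1) ;; Asg vY (Rd aPar (V vY))))"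

lemma climb_step_sets [simp]:
    "wv climb_step = {vLo, vHi, vX, vY}" "wa climb_step = {aCy}" "parr climb_step = {aD, aPar, aCy}"
  by (auto simp: climb_step_def)

text \<open>The segment grows at both ends and stays shorter than \<open>n\<close>, so it starts in
  the middle of \<open>aCy\<close>, at position \<open>n\<close>. The previous cycle is overwritten;
  \<open>finish\<close> calls this only for a better value.\<close>

definition improve :: prog where
  "improve =
    (Asg vBest (V vE) ;; Asg vLo (V vN) ;; Asg vHi (V vN) ;; Asg vX (V vEx) ;; Asg vY (V vEy) ;;
     WH CNeq (V vX) (V vY) climb_step ;;
     Asg vLo (V vLo .- N 1) ;; St aCy (V vLo) (V vX))"

lemma improve_sets [simp]:
    "wv improve = {vBest, vLo, vHi, vX, vY}" "wa improve = {aCy}" "parr improve = {aD, aPar, aCy}"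
  by (auto simp: improve_def)

definition finish :: prog where
  "finish = IF CEq (V vE) (N 0) SKIP
    (IF CEq (V vBest) (N 0) improve (IF CLess (V vE) (V vBest) improve SKIP))"

lemma finish_sets [simp]:
    "wv finish = {vBest, vLo, vHi, vX, vY}" "wa finish = {aCy}" "parr finish = {aD, aPar, aCy}"
  by (auto simp: finish_def)

definition cleanup :: prog where
  "cleanup = FOR vJ vCnt (Asg vX (Rd aOrd (V vJ)) ;; St aVis (V vX) (N 0) ;; tset (V vX) (N 0))"

lemma cleanup_sets [simp]:
    "wv cleanup = {vJ, vX, tI, tA, tB}" "wa cleanup = {aVis, aT}" "parr cleanup = {aOrd, aVis, aT}"
  by (auto simp: cleanup_def)

context ram_search
begin

section \<open>Correctness of pair testing, resetting and cycle extraction\<close>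

lemma vis_set [simp]:
  "i \<noteq> vCnt \<Longrightarrow> vis (setv i x s) = vis s"
  "a \<noteq> aOrd \<Longrightarrow> vis (seta a i x s) = vis s"
  by (simp_all add: vis_def)

lemma ord_vis: "j < vr s vCnt \<Longrightarrow> ar s aOrd j \<in> vis s"
  by (auto simp: vis_def)

lemma wp_pair_step:
  assumes s: "sst v k s" and x: "vr s vX \<in> vis s" and j: "vr s vJ < vr s vCnt"
    and c: "vr s vE \<noteq> 0 \<longrightarrow> cand s"
  shows "wp H F pair_step (\<lambda>t s'. t \<le> 11 \<and> (vr s' vE \<noteq> 0 \<longrightarrow> cand s') \<and>
    (vr s vE \<noteq> 0 \<longrightarrow> vr s' vE \<noteq> 0 \<and> vr s' vE \<le> vr s vE) \<and>
    ({vr s vX, ar s aOrd (vr s vJ)} \<in> E \<longrightarrow>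
     \<not> tedge (vis s) (ar s aPar) (vr s vX) (ar s aOrd (vr s vJ)) \<longrightarrow>
     vr s' vE \<noteq> 0 \<and> vr s' vE \<le> ar s aD (vr s vX) + ar s aD (ar s aOrd (vr s vJ)) +
       w {vr s vX, ar s aOrd (vr s vJ)})) s"
proof -
  define x where "x = vr s vX"
  define y where "y = ar s aOrd (vr s vJ)"
  have xy: "x \<in> vis s" "y \<in> vis s" using x ord_vis[OF j] by (simp_all add: x_def y_def)
  note X = sst_vis[OF s xy(1)] and Y = sst_vis[OF s xy(2)]
  note S = sstD[OF s]
  have b: "x * n < H" "x * n + y < H" using X(1) Y(1) bnd_prod bnd_sq by simp_all
  have W: "ar s aW (x * n + y) = (if {x, y} \<in> E then w {x, y} else 0)"
    by (rule statD(3)[OF S(1) X(1) Y(1)])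
  note F1 = x_def[symmetric] y_def[symmetric] statD(1)[OF S(1)] b W
  show ?thesis
  proof (cases "{x, y} \<in> E \<and> \<not> tedge (vis s) (ar s aPar) x y")
    case True
    then have ed: "{x, y} \<in> E" and te: "\<not> tedge (vis s) (ar s aPar) x y" by auto
    then have p: "ar s aPar x \<noteq> y" "ar s aPar y \<noteq> x" using xy by (auto simp: tedge_def)
    have "w {x, y} \<le> M" "0 < w {x, y}" using weights[OF ed] weight_pos[OF ed] by auto
    then have b2: "ar s aD x + ar s aD y < H" "ar s aD x + ar s aD y + w {x, y} < H" "0 < w {x, y}"
      using X(2) Y(2) by (auto intro!: bnd_sum)
    consider "vr s vE = 0" | "ar s aD x + ar s aD y + w {x, y} < vr s vE"
      | "vr s vE \<noteq> 0" "vr s vE \<le> ar s aD x + ar s aD y + w {x, y}" by linarith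
    then show ?thesis
    proof cases
      case 1
      then show ?thesis
        unfolding pair_step_def using ed te p xy by (simp add: wp_eqs F1 b2 cand_def)
    next
      case 2
      then have "vr s vE \<noteq> 0" "w {x, y} \<noteq> 0" using b2 by simp_all
      with 2 show ?thesis
        unfolding pair_step_def using ed te p xy by (simp add: wp_eqs F1 b2 cand_def)
    next
      case 3
      then have cs: "cand s" using c by simp
      have "cand (setv vW (ar s aD x + ar s aD y + w {x, y}) (setv vW (w {x, y}) (setv vY y s)))"
        using cs by (simp add: cand_def)
      then show ?thesis
        unfolding pair_step_def using 3 ed te p xy b2(3) by (simp add: wp_eqs F1 b2(1,2))
    qed
  next
    case False
    then show ?thesis
      unfolding pair_step_def x_def[symmetric] y_def[symmetric]
      using c xy X(1) Y(1) weight_pos[of x y]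
      by (auto simp add: wp_eqs F1 tedge_def cand_def)
  qed
qed

text \<open>After a cut-off, the radius of the search bounds all depths and
  \<open>sinv_closed\<close> applies with it, so covering all pairs completes the ball certificate.
  After a full search the pair test can only lower \<open>vE\<close>, which preserves
  \<open>full_ok\<close>.\<close>

lemma wp_pairs:
  assumes s: "searched v s"
  shows "wp H F pairs (\<lambda>t s'. t \<le> vr s vCnt * (vr s vCnt * 13 + 6) + 2 \<and> (\<exists>k. sst v k s') \<and>
    (vr s' vE \<noteq> 0 \<longrightarrow> cand s') \<and>
    (full_ok v (vr s' vE) \<or> vr s' vL = vr s' vCnt \<and> ball_ok v (vr s' vE) (vis s'))) s"
proof -
  define cnt where "cnt = vr s vCnt"
  from s obtain k where k: "sst v k s" and c: "vr s vE \<noteq> 0 \<longrightarrow> cand s"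
    and f: "full_ok v (vr s vE) \<or> vr s vE = 0 \<and> vr s vL = vr s vCnt"
    unfolding searched_def by blast
  note S = sstD[OF k]
  have cn: "cnt < H"
    using sinv_card[OF S(3)] by (auto simp: cnt_def intro!: bnd_sum)
  define G where "G = (\<lambda>s'. ar s' = ar s \<and> vr s' vN = vr s vN \<and> vr s' vCnt = cnt \<and> vr s' vL = vr s vL \<and>
    (vr s' vE \<noteq> 0 \<longrightarrow> cand s') \<and> (vr s vE \<noteq> 0 \<longrightarrow> vr s' vE \<noteq> 0 \<and> vr s' vE \<le> vr s vE))"
  \<comment> \<open>Coverage of a pair survives every later improvement of \<open>vE\<close>
    (\<open>cov_mono\<close>), so pairs treated earlier stay covered.\<close>
  define cov where "cov = (\<lambda>s' x y. {x, y} \<in> E \<longrightarrow> \<not> tedge (vis s) (ar s aPar) x y \<longrightarrow>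
     vr s' vE \<noteq> 0 \<and> vr s' vE \<le> ar s aD x + ar s aD y + w {x, y})"
  have G: "sst v k s'" "vis s' = vis s" if "G s'" for s'
    using that sst_cong[OF k, of s'] by (auto simp: G_def cnt_def vis_def)
  have cov_mono: "cov s'' x y" if "cov s' x y" "vr s' vE \<noteq> 0 \<longrightarrow> vr s'' vE \<noteq> 0 \<and> vr s'' vE \<le> vr s' vE"
    for s' s'' x y
    using that unfolding cov_def by (meson le_trans)
  have cand_set: "cand (setv i x s') \<longleftrightarrow> cand s'" if "i \<in> {vI, vJ, vX}" for i x s'
    using that by (auto simp: cand_def vis_def)
  have inner: "wp H F (FOR vJ vCnt pair_step) (\<lambda>t s''. t \<le> cnt * 13 + 2 \<and> G s'' \<and>
      (vr s' vE \<noteq> 0 \<longrightarrow> vr s'' vE \<noteq> 0 \<and> vr s'' vE \<le> vr s' vE) \<and>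
      (\<forall>j<cnt. cov s'' x (ar s aOrd j))) s'"
    if g: "G s'" and x: "vr s' vX = x" "x \<in> vis s" for s' x
  proof (rule wp_FOR[where n = cnt and I = "\<lambda>j t s''. t \<le> j * 13 \<and> G s'' \<and> vr s'' vX = x \<and>
      (vr s' vE \<noteq> 0 \<longrightarrow> vr s'' vE \<noteq> 0 \<and> vr s'' vE \<le> vr s' vE) \<and>
      (\<forall>i<j. cov s'' x (ar s aOrd i))"])
    show "vr s' vCnt = cnt" using g by (simp add: G_def)
    show "0 \<le> (0::nat) * 13 \<and> G (setv vJ 0 s') \<and> vr (setv vJ 0 s') vX = x \<and>
      (vr s' vE \<noteq> 0 \<longrightarrow> vr (setv vJ 0 s') vE \<noteq> 0 \<and> vr (setv vJ 0 s') vE \<le> vr s' vE) \<and>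
      (\<forall>i<0. cov (setv vJ 0 s') x (ar s aOrd i))"
      using g x by (simp add: G_def cand_set)
    fix j t :: nat and s2 :: hst
    assume j: "j < cnt" and I: "t \<le> j * 13 \<and> G s2 \<and> vr s2 vX = x \<and>
      (vr s' vE \<noteq> 0 \<longrightarrow> vr s2 vE \<noteq> 0 \<and> vr s2 vE \<le> vr s' vE) \<and>
      (\<forall>i<j. cov s2 x (ar s aOrd i))" and ij: "vr s2 vJ = j" "vr s2 vCnt = cnt"
    then have g2: "G s2" by blast
    have ars: "ar s2 = ar s" using g2 by (simp add: G_def)
    have "wp H F pair_step (\<lambda>t s'. t \<le> 11 \<and> (vr s' vE \<noteq> 0 \<longrightarrow> cand s') \<and>
      (vr s2 vE \<noteq> 0 \<longrightarrow> vr s' vE \<noteq> 0 \<and> vr s' vE \<le> vr s2 vE) \<and> cov s' x (ar s aOrd j)) s2"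
    proof (rule wp_conseq, rule wp_pair_step[OF G(1)[OF g2]])
      show "vr s2 vX \<in> vis s2" using I x(2) G(2)[OF g2] by simp
      show "vr s2 vJ < vr s2 vCnt" using j ij by simp
      show "vr s2 vE \<noteq> 0 \<longrightarrow> cand s2" using g2 by (simp add: G_def)
    qed (use I ij G(2)[OF g2] in \<open>simp add: cov_def ars\<close>)
    then show "wp H F pair_step (\<lambda>t' s''. t + t' + 2 \<le> Suc j * 13 \<and> G (setv vJ (Suc j) s'') \<and>
      vr (setv vJ (Suc j) s'') vX = x \<and>
      (vr s' vE \<noteq> 0 \<longrightarrow> vr (setv vJ (Suc j) s'') vE \<noteq> 0 \<and> vr (setv vJ (Suc j) s'') vE \<le> vr s' vE) \<and>
      (\<forall>i<Suc j. cov (setv vJ (Suc j) s'') x (ar s aOrd i))) s2"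
    proof (rule wp_conseq)
      fix t' :: nat and s3 :: hst
      assume q: "t' \<le> 11 \<and> (vr s3 vE \<noteq> 0 \<longrightarrow> cand s3) \<and>
        (vr s2 vE \<noteq> 0 \<longrightarrow> vr s3 vE \<noteq> 0 \<and> vr s3 vE \<le> vr s2 vE) \<and> cov s3 x (ar s aOrd j)"
       and fv: "\<And>x. x \<notin> wv pair_step \<Longrightarrow> vr s3 x = vr s2 x"
       and fa: "\<And>a. a \<notin> wa pair_step \<Longrightarrow> ar s3 a = ar s2 a"
      have ar3: "ar s3 = ar s2" using fa by auto
      have "G s3" using g2 q ar3 fv unfolding G_def by auto
      then have g3: "G (setv vJ (Suc j) s3)" by (simp add: G_def cand_set)
      have "cov s3 x (ar s aOrd i)" if "i < Suc j" for i
        using that q I cov_mono[of s2 x _ s3] by (auto simp: less_Suc_eq)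
      then have "\<forall>i<Suc j. cov (setv vJ (Suc j) s3) x (ar s aOrd i)" by (simp add: cov_def)
      then show "t + t' + 2 \<le> Suc j * 13 \<and> G (setv vJ (Suc j) s3) \<and>
        vr (setv vJ (Suc j) s3) vX = x \<and>
        (vr s' vE \<noteq> 0 \<longrightarrow> vr (setv vJ (Suc j) s3) vE \<noteq> 0 \<and> vr (setv vJ (Suc j) s3) vE \<le> vr s' vE) \<and>
        (\<forall>i<Suc j. cov (setv vJ (Suc j) s3) x (ar s aOrd i))"
        using g3 q I fv by auto
    qed
  qed (use cn in auto)
  have "wp H F pairs (\<lambda>t s'. t \<le> cnt * (cnt * 13 + 6) + 2 \<and> G s' \<and>
      (\<forall>i<cnt. \<forall>j<cnt. cov s' (ar s aOrd i) (ar s aOrd j))) s"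
    unfolding pairs_def
  proof (rule wp_FOR[where n = cnt and I = "\<lambda>i t s'. t \<le> i * (cnt * 13 + 6) \<and> G s' \<and>
      (\<forall>a<i. \<forall>j<cnt. cov s' (ar s aOrd a) (ar s aOrd j))"])
    show "0 \<le> (0::nat) * (cnt * 13 + 6) \<and> G (setv vI 0 s) \<and>
      (\<forall>i<0. \<forall>j<cnt. cov (setv vI 0 s) (ar s aOrd i) (ar s aOrd j))"
      using c by (simp add: G_def cand_set cnt_def)
    fix i t :: nat and s2 :: hst
    assume i: "i < cnt" and I: "t \<le> i * (cnt * 13 + 6) \<and> G s2 \<and>
      (\<forall>a<i. \<forall>j<cnt. cov s2 (ar s aOrd a) (ar s aOrd j))" and ij: "vr s2 vI = i" "vr s2 vCnt = cnt"
    define x where "x = ar s aOrd i"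
    have g2: "G s2" using I by blast
    have x: "x \<in> vis s" unfolding x_def using ord_vis[of i s] i by (simp add: cnt_def)
    have ars: "ar s2 = ar s" using g2 by (simp add: G_def)
    define s3 where "s3 = setv vX x s2"
    have g3: "G s3" using g2 by (simp add: s3_def G_def cand_set)
    have W: "wp H F (FOR vJ vCnt pair_step) (\<lambda>t s''. t \<le> cnt * 13 + 2 \<and> G s'' \<and>
      (vr s3 vE \<noteq> 0 \<longrightarrow> vr s'' vE \<noteq> 0 \<and> vr s'' vE \<le> vr s3 vE) \<and>
      (\<forall>j<cnt. cov s'' x (ar s aOrd j))) s3"
      by (rule inner[OF g3 _ x]) (simp add: s3_def)
    show "wp H F (Asg vX (Rd aOrd (V vI)) ;; FOR vJ vCnt pair_step)
      (\<lambda>t' s'. t + t' + 2 \<le> Suc i * (cnt * 13 + 6) \<and> G (setv vI (Suc i) s') \<and>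
        (\<forall>a<Suc i. \<forall>j<cnt. cov (setv vI (Suc i) s') (ar s aOrd a) (ar s aOrd j))) s2"
      apply (simp add: wp_eqs ij ars x_def[symmetric])
      apply (rule wp_conseq, rule W[unfolded s3_def])
      subgoal premises q for t' s4
      proof -
        have g4: "G (setv vI (Suc i) s4)" using q by (simp add: G_def cand_set)
        have "cov s4 (ar s aOrd a) (ar s aOrd b)" if "a < Suc i" "b < cnt" for a b
          using that q I cov_mono[of s2 _ _ s4] x_def by (auto simp: less_Suc_eq)
        then have "\<forall>a<Suc i. \<forall>j<cnt. cov (setv vI (Suc i) s4) (ar s aOrd a) (ar s aOrd j)"
          by (simp add: cov_def)
        then show ?thesis using q I g4 by (simp add: algebra_simps)
      qed
      done
  qed (use cn in \<open>auto simp: cnt_def\<close>)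
  then show ?thesis
  proof (rule wp_conseq)
    fix t :: nat and s' :: hst
    assume q: "t \<le> cnt * (cnt * 13 + 6) + 2 \<and> G s' \<and>
      (\<forall>i<cnt. \<forall>j<cnt. cov s' (ar s aOrd i) (ar s aOrd j))"
    then have g: "G s'" by blast
    have cov: "cov s' x y" if "x \<in> vis s" "y \<in> vis s" for x y
      using that q by (auto simp: vis_def cnt_def)
    have gE: "vr s' vE \<noteq> 0 \<longrightarrow> cand s'" "vr s vE \<noteq> 0 \<longrightarrow> vr s' vE \<noteq> 0 \<and> vr s' vE \<le> vr s vE"
      "ar s' = ar s" "vr s' vL = vr s vL" "vr s' vCnt = cnt"
      using g by (simp_all add: G_def)
    have "full_ok v (vr s' vE) \<or> vr s' vL = vr s' vCnt \<and> ball_ok v (vr s' vE) (vis s')"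
    proof (cases "full_ok v (vr s vE)")
      case True
      have "full_ok v (vr s' vE)" by (rule full_ok_better[OF True gE(2)])
      then show ?thesis ..
    next
      case False
      then have "vr s vL = vr s vCnt" using f by blast
      moreover have "closed (vis s) (ar s aD) (ar s aPar) k"
        unfolding vis_def by (rule sinv_closed[OF S(3)]) (use sst_vis(6)[OF k] in \<open>simp add: vis_def\<close>)
      then have "ball_ok v (vr s' vE) (vis s)"
        unfolding ball_ok_def using sinv_tree[OF S(3)] sst_vis(5)[OF k] cov
        by (intro exI[of _ "ar s aD"] exI[of _ "ar s aPar"] exI[of _ k]) (auto simp: vis_def cov_def)
      ultimately show ?thesis using G(2)[OF g] gE by (simp add: cnt_def)
    qed
    then show "t \<le> vr s vCnt * (vr s vCnt * 13 + 6) + 2 \<and> (\<exists>k. sst v k s') \<and>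
      (vr s' vE \<noteq> 0 \<longrightarrow> cand s') \<and>
      (full_ok v (vr s' vE) \<or> vr s' vL = vr s' vCnt \<and> ball_ok v (vr s' vE) (vis s'))"
      using q G(1)[OF g] gE by (auto simp: cnt_def)
  qed
qed

text \<open>Leaves and marks can be nonzero only at vertices still listed in \<open>aOrd\<close>
  from position \<open>i\<close> on. Resetting these costs O(log n) per visited vertex and never a
  pass over all \<open>n\<close>.\<close>

lemma wp_cleanup:
  assumes s: "sst v k s"
  shows "wp H F cleanup (\<lambda>t s'. t \<le> (8 * lg + 8) * vr s vCnt + 2 \<and> clean s') s"
proof -
  define cnt where "cnt = vr s vCnt"
  note S = sstD[OF s]
  have cn: "cnt < H"
    using sinv_card[OF S(3)] by (auto simp: cnt_def intro!: bnd_sum)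
  define Z where "Z = (\<lambda>i s'. \<forall>x<n. x \<notin> ar s aOrd ` {i..<cnt} \<longrightarrow> ar s' aVis x = 0 \<and> ar s' aT (n + x) = 0)"
  have "wp H F cleanup (\<lambda>t s'. t \<le> (8 * lg + 8) * cnt + 2 \<and> tourn n (ar s' aT) \<and> Z cnt s') s"
    unfolding cleanup_def
  proof (rule wp_FOR[where n = cnt and I = "\<lambda>i t s'. t \<le> (8 * lg + 8) * i \<and> tourn n (ar s' aT) \<and>
      Z i s' \<and> vr s' vN = n \<and> ar s' aOrd = ar s aOrd"])
    show "0 \<le> (8 * lg + 8) * 0 \<and> tourn n (ar (setv vJ 0 s) aT) \<and> Z 0 (setv vJ 0 s) \<and>
      vr (setv vJ 0 s) vN = n \<and> ar (setv vJ 0 s) aOrd = ar s aOrd"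
      using S statD(1)[OF S(1)] by (auto simp: Z_def vis_def cnt_def atLeast0LessThan)
    fix i t :: nat and s2 :: hst
    assume i: "i < cnt" and I: "t \<le> (8 * lg + 8) * i \<and> tourn n (ar s2 aT) \<and>
      Z i s2 \<and> vr s2 vN = n \<and> ar s2 aOrd = ar s aOrd" and ij: "vr s2 vJ = i" "vr s2 vCnt = cnt"
    define x where "x = ar s aOrd i"
    have xn: "x < n" using sst_vis(1)[OF s ord_vis[of i s]] i by (simp add: x_def cnt_def)
    have U: "{i..<cnt} = insert i {Suc i..<cnt}" using i by auto
    show "wp H F (Asg vX (Rd aOrd (V vJ)) ;; St aVis (V vX) (N 0) ;; tset (V vX) (N 0))
      (\<lambda>t' s'. t + t' + 2 \<le> (8 * lg + 8) * Suc i \<and> tourn n (ar (setv vJ (Suc i) s') aT) \<and>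
        Z (Suc i) (setv vJ (Suc i) s') \<and> vr (setv vJ (Suc i) s') vN = n \<and>
        ar (setv vJ (Suc i) s') aOrd = ar s aOrd) s2"
      using I ij
      apply (simp add: wp_eqs x_def[symmetric])
      apply (rule wp_tset)
      apply (simp_all add: xn)
      apply (auto simp: Z_def U x_def[symmetric])
      done
  qed (use cn in \<open>auto simp: cnt_def\<close>)
  then show ?thesis
  proof (rule wp_conseq)
    fix t :: nat and s' :: hst
    assume q: "t \<le> (8 * lg + 8) * cnt + 2 \<and> tourn n (ar s' aT) \<and> Z cnt s'"
      and f: "\<And>x. x \<notin> wv cleanup \<Longrightarrow> vr s' x = vr s x" "\<And>a. a \<notin> wa cleanup \<Longrightarrow> ar s' a = ar s a"
    have "stat s'" by (rule stat_cong[OF S(1)]) (use f in simp_all)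
    then show "t \<le> (8 * lg + 8) * vr s vCnt + 2 \<and> clean s'"
      using q by (auto simp: clean_def Z_def cnt_def)
  qed
qed

section \<open>The stored cycle\<close>

definition cyl :: "hst \<Rightarrow> nat list" where
  "cyl s = map (ar s aCy) [vr s vLo..<vr s vHi]"

text \<open>\<open>vBest\<close> is only an upper bound for the weight of the stored cycle, as the
  extraction drops the common stem. While nothing has been found, \<open>vLo = vHi\<close> makes the
  output empty.\<close>

definition sound :: "hst \<Rightarrow> bool" where
  "sound s \<longleftrightarrow> vr s vLo \<le> vr s vHi \<and> vr s vHi \<le> 2 * n \<and> (vr s vBest = 0 \<longrightarrow> vr s vLo = vr s vHi) \<and>
     (vr s vBest \<noteq> 0 \<longrightarrow> is_cycle E (cyl s) \<and> cycle_weight w (cyl s) \<le> vr s vBest)"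

text \<open>\<open>x\<close> and the segment consist of distinct visited vertices. This one fact
  bounds the number of steps by \<open>vCnt\<close>, keeps the ends inside the array, and makes the
  truncated \<open>vLo - 1\<close> a true predecessor.\<close>

lemma wp_improve:
  assumes s: "sst v k s" and c: "cand s" "vr s vE \<noteq> 0"
  shows "wp H F improve (\<lambda>t s'. t \<le> 6 * vr s vCnt + 8 \<and> sound s' \<and> vr s' vBest = vr s vE) s"
proof -
  note S = sstD[OF s]
  note T = sinv_tree[OF S(3), folded vis_def]
  note N = statD(1)[OF S(1)]
  have nH: "n < H" by (rule bnd_sum) simp
  define I where "I = (\<lambda>t s'. vr s' vLo \<le> n \<and> n \<le> vr s' vHi \<and> t \<le> 6 * (vr s' vHi - vr s' vLo) \<and>
    climb (vis s) (ar s aD) (ar s aPar) (vr s' vX) (vr s' vY) (cyl s') (vr s vE) \<and>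
    ar s' aD = ar s aD \<and> ar s' aPar = ar s aPar \<and> vr s' vBest = vr s vE)"
  have len: "vr s' vHi - vr s' vLo < vr s vCnt" "vr s' vHi - vr s' vLo < n" "0 < vr s' vLo" "vr s' vHi < 2 * n"
    if "I t s'" for t s'
  proof -
    have cl: "climb (vis s) (ar s aD) (ar s aPar) (vr s' vX) (vr s' vY) (cyl s') (vr s vE)"
      and ln: "vr s' vLo \<le> n" "n \<le> vr s' vHi" using that by (auto simp: I_def)
    have d: "distinct (vr s' vX # cyl s')" "set (vr s' vX # cyl s') \<subseteq> vis s"
      using cl by (auto simp: climb_def)
    have "finite (vis s)" by (simp add: vis_def)
    from card_mono[OF this d(2)] have "length (vr s' vX # cyl s') \<le> card (vis s)"
      using distinct_card[OF d(1)] by simp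
    moreover have "card (vis s) = vr s vCnt" "vr s vCnt \<le> n" using sinv_card[OF S(3)] by (simp_all add: vis_def)
    ultimately show "vr s' vHi - vr s' vLo < vr s vCnt" "vr s' vHi - vr s' vLo < n"
      by (simp_all add: cyl_def)
    then show "0 < vr s' vLo" "vr s' vHi < 2 * n" using ln by auto
  qed
  have step: "wp H F climb_step (\<lambda>t' s''. I (t + t' + 1) s'' \<and>
      n - (vr s'' vHi - vr s'' vLo) < n - (vr s' vHi - vr s' vLo)) s'"
    if I: "I t s'" and ne: "vr s' vX \<noteq> vr s' vY" for t s'
  proof -
    note L = len[OF I]
    have cl: "climb (vis s) (ar s aD) (ar s aPar) (vr s' vX) (vr s' vY) (cyl s') (vr s vE)"
      and ln: "vr s' vLo \<le> n" "n \<le> vr s' vHi" "t \<le> 6 * (vr s' vHi - vr s' vLo)"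
      and f: "ar s' aD = ar s aD" "ar s' aPar = ar s aPar" "vr s' vBest = vr s vE"
      using I by (auto simp: I_def)
    show ?thesis
    proof (cases "ar s aD (vr s' vY) < ar s aD (vr s' vX)")
      case True
      define lo where "lo = vr s' vLo - 1"
      have lo: "vr s' vLo = Suc lo" using L by (simp add: lo_def)
      have "[lo..<vr s' vHi] = lo # [Suc lo..<vr s' vHi]" using lo ln by (intro upt_conv_Cons) simp
      then have "map ((ar s' aCy)(lo := vr s' vX)) [lo..<vr s' vHi] = vr s' vX # cyl s'"
        using lo by (auto simp: cyl_def)
      then show ?thesis
        unfolding climb_step_def
        using True climb_left[OF T cl True] ln L
        by (simp add: wp_eqs I_def f lo cyl_def[of "setv _ _ _"] del: upt_Suc) linarith
    next
      case False
      have "map ((ar s' aCy)(vr s' vHi := vr s' vY)) [vr s' vLo..<Suc (vr s' vHi)] = cyl s' @ [vr s' vY]"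
        using ln by (auto simp: cyl_def)
      moreover have "Suc (vr s' vHi) < H" using L by (intro bnd_sum) simp
      moreover have "ar s aD (vr s' vX) \<le> ar s aD (vr s' vY)" using False by simp
      ultimately show ?thesis
        unfolding climb_step_def
        using False climb_right[OF T cl _ ne] ln L
        by (simp add: wp_eqs I_def f cyl_def[of "setv _ _ _"] del: upt_Suc) linarith
    qed
  qed
  show ?thesis
    unfolding improve_def
    apply (simp add: wp_eqs N)
    apply (rule wp_WH[where I = I and m = "\<lambda>s'. n - (vr s' vHi - vr s' vLo)"])
    subgoal using c climb_init[of "vr s vEx" "vis s" "vr s vEy" "ar s aPar" "ar s aD"]
      by (simp add: I_def cyl_def cand_def)
    subgoal by simp
    subgoal using step by simp
    subgoal premises p for t s'
    proof -
      from p have I: "I t s'" and e: "vr s' vY = vr s' vX" by simp_all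
      note L = len[OF I]
      define lo where "lo = vr s' vLo - 1"
      have lo: "vr s' vLo = Suc lo" using L by (simp add: lo_def)
      have ln: "vr s' vLo \<le> n" "n \<le> vr s' vHi" using I by (auto simp: I_def)
      have "[lo..<vr s' vHi] = lo # [Suc lo..<vr s' vHi]" using lo ln by (intro upt_conv_Cons) simp
      then have m: "map ((ar s' aCy)(lo := vr s' vX)) [lo..<vr s' vHi] = vr s' vX # cyl s'"
        using lo by (auto simp: cyl_def)
      have "is_cycle E (vr s' vX # cyl s') \<and> cycle_weight w (vr s' vX # cyl s') \<le> vr s vE"
        using climb_cycle I e by (auto simp: I_def)
      then show ?thesis
        using I L ln c by (simp add: wp_eqs I_def lo sound_def cyl_def[of "seta _ _ _ _"] m)
    qed
    done
qed

lemma wp_finish: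
  assumes s: "sst v k s" and c: "vr s vE \<noteq> 0 \<longrightarrow> cand s" and so: "sound s"
  shows "wp H F finish (\<lambda>t s'. t \<le> 6 * vr s vCnt + 11 \<and> sound s' \<and>
    (vr s vE \<noteq> 0 \<longrightarrow> vr s' vBest \<noteq> 0 \<and> vr s' vBest \<le> vr s vE) \<and>
    (vr s vBest \<noteq> 0 \<longrightarrow> vr s' vBest \<noteq> 0 \<and> vr s' vBest \<le> vr s vBest)) s"
proof (cases "vr s vE = 0")
  case True
  then show ?thesis unfolding finish_def using so by (simp add: wp_eqs)
next
  case False
  then have W: "wp H F improve (\<lambda>t s'. t \<le> 6 * vr s vCnt + 8 \<and> sound s' \<and> vr s' vBest = vr s vE) s"
    using wp_improve[OF s] c by blast
  show ?thesis
    unfolding finish_def using False so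
    apply (simp add: wp_eqs)
    apply (intro conjI impI)
    apply (rule wp_conseq[OF W], simp)
    apply (rule wp_conseq[OF W], simp)
    done
qed

end

section \<open>Balls and the hitting set\<close>

abbreviation (input) "vBall \<equiv> 29 :: nat"

definition register_loop :: prog where
  "register_loop =
     FOR vJ vCnt (Asg vX (Rd aOrd (V vJ)) ;; St aMem (V vV .* V vN .+ V vX) (N 1) ;;
       St aCnt (V vX) (Rd aCnt (V vX) .+ N 1) ;; St aLst (V vV .* V vN .+ V vJ) (V vX))"

text \<open>A search that ran out of edges exactly at \<open>vL\<close> vertices is registered as
  well; this only gives the greedy phase one more set of the common size to hit.\<close>

definition register :: prog where
  "register = IF CEq (V vL) (V vCnt) (St aBig (V vV) (N 1) ;; register_loop) SKIP"

lemma register_sets [simp]: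
    "wv register = {vJ, vX}" "wa register = {aBig, aMem, aCnt, aLst}"
    "parr register = {aOrd, aBig, aMem, aCnt, aLst}"
  by (auto simp: register_def register_loop_def)

definition balls :: prog where
  "balls = FOR vV vN (Asg vS (V vV) ;; search ;; pairs ;; register ;; finish ;; cleanup)"

lemma balls_sets [simp]:
    "wv balls = {tI, tA, tB, qI, qY, qV, vCnt, vE, vP, vGo, vK, vX, vY, vEx, vEy, vV, vS, vI, vJ, vW,
      vBest, vLo, vHi}"
    "wa balls = {aOrd, aVis, aD, aPar, aIdx, aT, aBig, aMem, aCnt, aLst, aCy}"
    "parr balls = {aOrd, aVis, aD, aPar, aIdx, aT, aNb, aW, aBig, aMem, aCnt, aLst, aCy}"
  by (auto simp: balls_def)

definition findmax :: prog where
  "findmax = (Asg vZ (N 0) ;;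
    FOR vI vN (IF CLess (Rd aCnt (V vZ)) (Rd aCnt (V vI)) (Asg vZ (V vI)) SKIP))"

lemma findmax_sets [simp]: "wv findmax = {vZ, vI}" "wa findmax = {}" "parr findmax = {aCnt}"
  by (auto simp: findmax_def)

definition unregister_loop :: prog where
  "unregister_loop =
    FOR vJ vBall (Asg vX (Rd aLst (V vI .* V vN .+ V vJ)) ;; St aCnt (V vX) (Rd aCnt (V vX) .- N 1))"

definition unregister :: prog where
  "unregister = (St aBig (V vI) (N 0) ;; unregister_loop)"

lemma unregister_sets [simp]:
    "wv unregister = {vJ, vX}" "wa unregister = {aBig, aCnt}" "parr unregister = {aLst, aBig, aCnt}"
  by (auto simp: unregister_def unregister_loop_def)

definition hit :: prog where
  "hit = FOR vI vN (IF CEq (Rd aBig (V vI)) (N 0) SKIP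
    (IF CEq (Rd aMem (V vI .* V vN .+ V vZ)) (N 0) SKIP unregister))"

lemma hit_sets [simp]:
    "wv hit = {vI, vJ, vX}" "wa hit = {aBig, aCnt}" "parr hit = {aLst, aBig, aCnt, aMem}"
  by (auto simp: hit_def)

definition greedy_round :: prog where
  "greedy_round = (hit ;; Asg vS (V vZ) ;; search ;; finish ;; cleanup ;; findmax)"

lemma greedy_round_sets [simp]:
    "wv greedy_round = {tI, tA, tB, qI, qY, qV, vCnt, vE, vP, vGo, vK, vX, vY, vEx, vEy, vS, vI, vJ, vZ,
      vBest, vLo, vHi}"
    "wa greedy_round = {aOrd, aVis, aD, aPar, aIdx, aT, aBig, aCnt, aCy}"
    "parr greedy_round = {aOrd, aVis, aD, aPar, aIdx, aT, aNb, aW, aBig, aMem, aCnt, aLst, aCy}"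
  by (auto simp: greedy_round_def)

text \<open>At most \<open>n\<close> vertices can be visited, so the limit \<open>n + 1\<close> is
  never reached and the searches are unbounded. The loop ends when no vertex lies in an unhit
  ball.\<close>

definition greedy :: prog where
  "greedy = (Asg vL (V vN .+ N 1) ;; findmax ;; WH CNeq (Rd aCnt (V vZ)) (N 0) greedy_round)"

lemma greedy_sets [simp]:
    "parr greedy = {aOrd, aVis, aD, aPar, aIdx, aT, aNb, aW, aBig, aMem, aCnt, aLst, aCy}"
  by (auto simp: greedy_def)

lemma row_index_inj:
  fixes u v x y n :: nat
  assumes "x < n" "y < n"
  shows "u * n + x = v * n + y \<longleftrightarrow> u = v \<and> x = y"
proof
  assume *: "u * n + x = v * n + y"
  from arg_cong[OF *, of "\<lambda>k. k div n"] arg_cong[OF *, of "\<lambda>k. k mod n"] assms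
  show "u = v \<and> x = y" by simp
qed simp

context ram_search
begin

section \<open>Registered balls and their counters\<close>

definition ball :: "hst \<Rightarrow> nat \<Rightarrow> nat set" where
  "ball s v = {z. z < n \<and> ar s aMem (v * n + z) \<noteq> 0}"

definition unhit :: "hst \<Rightarrow> nat set" where
  "unhit s = {v. v < n \<and> ar s aBig v \<noteq> 0}"

text \<open>The incidence structure of the hitting set problem: \<open>aMem\<close> answers
  membership, \<open>aLst\<close> enumerates a ball, \<open>aCnt\<close> counts unhit balls through
  a vertex. A hit clears \<open>aBig\<close> only; the row of \<open>aMem\<close> remains, since
  \<open>ginv\<close> keeps referring to the ball.\<close>

definition reg :: "nat \<Rightarrow> hst \<Rightarrow> bool" where
  "reg L s \<longleftrightarrow>
     (\<forall>v\<in>unhit s. card (ball s v) = L \<and> (\<lambda>j. ar s aLst (v * n + j)) ` {..<L} = ball s v) \<and>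
     (\<forall>z<n. ar s aCnt z = card {v \<in> unhit s. z \<in> ball s v})"

lemma unhit_finite: "finite (unhit s)" "card (unhit s) \<le> n"
proof -
  have "unhit s \<subseteq> {..<n}" by (auto simp: unhit_def)
  then show "finite (unhit s)" "card (unhit s) \<le> n"
    using finite_subset[of _ "{..<n}"] card_mono[of "{..<n}"] by fastforce+
qed

lemma ball_finite: "finite (ball s v)" "ball s v \<subseteq> {..<n}"
  by (auto simp: ball_def)

text \<open>\<open>aOrd\<close> enumerates the visited vertices injectively, so each counter is
  raised exactly once and matches the enlarged family.\<close>

lemma wp_register:
  assumes s: "sst v k s" and r: "reg L s" and v: "vr s vV = v" "v < n" and L: "vr s vL = L" "1 \<le> L"
    and fresh: "ar s aBig v = 0" "ball s v = {}"
  shows "wp H F register (\<lambda>t s'. t \<le> 8 * vr s vCnt + 6 \<and> reg L s' \<and>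
    (\<forall>u<n. ar s' aBig u = (if u = v \<and> L = vr s vCnt then 1 else ar s aBig u)) \<and>
    (\<forall>u<n. ball s' u = (if u = v \<and> L = vr s vCnt then vis s else ball s u))) s"
proof (cases "L = vr s vCnt")
  case False
  have "\<forall>u<n. ar s aBig u = (if u = v \<and> L = vr s vCnt then 1 else ar s aBig u)"
    "\<forall>u<n. ball s u = (if u = v \<and> L = vr s vCnt then vis s else ball s u)"
    using False by simp_all
  with False r L show ?thesis unfolding register_def by (simp add: wp_eqs)
next
  case True
  define cnt where "cnt = vr s vCnt"
  note S = sstD[OF s]
  note cd = sinv_card[OF S(3), folded vis_def]
  have cn: "cnt \<le> n" "cnt < H" "card (vis s) = cnt" using cd by (auto simp: cnt_def intro!: bnd_sum)
  have inj: "inj_on (ar s aOrd) {..<cnt}" unfolding cnt_def by (rule sinvD(3)[OF S(3)])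
  define O' where "O' = (\<lambda>j. ar s aOrd ` {..<j})"
  have Ocnt: "O' cnt = vis s" by (simp add: O'_def vis_def cnt_def)
  have OS: "O' (Suc j) = insert (ar s aOrd j) (O' j)" for j by (auto simp: O'_def lessThan_Suc)
  have Onew: "ar s aOrd j \<notin> O' j" if "j < cnt" for j
    using inj that by (force simp: O'_def inj_on_def)
  have On: "ar s aOrd j < n" if "j < cnt" for j
    using sst_vis(1)[OF s ord_vis[of j s]] that by (simp add: cnt_def)
  have cntn: "ar s aCnt z \<le> n" if "z < n" for z
  proof -
    have "card {v \<in> unhit s. z \<in> ball s v} \<le> card (unhit s)"
      by (intro card_mono) (auto simp: unhit_finite)
    then show ?thesis using r that unhit_finite(2)[of s] by (simp add: reg_def)
  qed
  define I where "I = (\<lambda>j t s'. t \<le> 7 * j \<and> vr s' vN = n \<and> vr s' vV = v \<and>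
    ar s' aOrd = ar s aOrd \<and> ar s' aBig = (ar s aBig)(v := 1) \<and>
    (\<forall>u<n. \<forall>z<n. ar s' aMem (u * n + z) = (if u = v \<and> z \<in> O' j then 1 else ar s aMem (u * n + z))) \<and>
    (\<forall>u<n. \<forall>i<n. ar s' aLst (u * n + i) = (if u = v \<and> i < j then ar s aOrd i else ar s aLst (u * n + i))) \<and>
    (\<forall>z<n. ar s' aCnt z = (if z \<in> O' j then Suc (ar s aCnt z) else ar s aCnt z)))"
  have loop: "wp H F register_loop
      (\<lambda>t s'. t \<le> 7 * cnt + 2 \<and> I cnt 0 s') (seta aBig v 1 s)"
    unfolding register_loop_def
  proof (rule wp_FOR[where n = cnt and I = I])
    show "I 0 0 (setv vJ 0 (seta aBig v 1 s))"
      using v statD(1)[OF S(1)] by (simp add: I_def O'_def)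
    fix j t :: nat and s2 :: hst
    assume j: "j < cnt" and I: "I j t s2" and ij: "vr s2 vJ = j" "vr s2 vCnt = cnt"
    define x where "x = ar s aOrd j"
    have x: "x < n" "x \<notin> O' j" using On Onew j by (simp_all add: x_def)
    have jn: "j < n" using j cn by simp
    have b: "v * n < H" "v * n + x < H" "v * n + j < H" "Suc (ar s aCnt x) < H"
      using bnd_prod[of v] bnd_sq[of v] v x jn cntn[OF x(1)] by (auto intro!: bnd_sum)
    have cx: "ar s2 aCnt x = ar s aCnt x" using I x by (simp add: I_def)
    have M: "ar s2 aMem (u * n + z) = (if u = v \<and> z \<in> O' j then 1 else ar s aMem (u * n + z))"
      if "u < n" "z < n" for u z using I that unfolding I_def by blast
    have Ls: "ar s2 aLst (u * n + z) = (if u = v \<and> z < j then ar s aOrd z else ar s aLst (u * n + z))"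
      if "u < n" "z < n" for u z using I that unfolding I_def by blast
    have Cn: "ar s2 aCnt z = (if z \<in> O' j then Suc (ar s aCnt z) else ar s aCnt z)"
      if "z < n" for z using I that unfolding I_def by blast
    have I': "vr s2 vN = n" "vr s2 vV = v" "ar s2 aOrd = ar s aOrd" "t \<le> 7 * j"
      "ar s2 aBig = (ar s aBig)(v := 1)"
      using I unfolding I_def by blast+
    show "wp H F (Asg vX (Rd aOrd (V vJ)) ;; St aMem (V vV .* V vN .+ V vX) (N 1) ;;
       St aCnt (V vX) (Rd aCnt (V vX) .+ N 1) ;; St aLst (V vV .* V vN .+ V vJ) (V vX))
       (\<lambda>t' s'. I (Suc j) (t + t' + 2) (setv vJ (Suc j) s')) s2"
      apply (simp add: wp_eqs ij I' x_def[symmetric] b cx)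
      unfolding I_def
      apply (intro conjI allI impI)
      using I'(4) x v jn
      apply (simp_all add: I'(1-3,5) row_index_inj M Ls Cn OS x_def[symmetric] less_Suc_eq)
      apply (auto simp: x_def)
      done
  qed (use cn in \<open>auto simp: cnt_def I_def\<close>)
  have fin: "reg L s' \<and> (\<forall>u<n. ar s' aBig u = (if u = v then 1 else ar s aBig u)) \<and>
    (\<forall>u<n. ball s' u = (if u = v then vis s else ball s u))" if I: "I cnt 0 s'" for s'
  proof -
    have Bg: "ar s' aBig = (ar s aBig)(v := 1)" and
      M: "\<And>u z. u < n \<Longrightarrow> z < n \<Longrightarrow> ar s' aMem (u * n + z) =
        (if u = v \<and> z \<in> vis s then 1 else ar s aMem (u * n + z))" and
      Ls: "\<And>u i. u < n \<Longrightarrow> i < n \<Longrightarrow> ar s' aLst (u * n + i) =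
        (if u = v \<and> i < cnt then ar s aOrd i else ar s aLst (u * n + i))" and
      Cn: "\<And>z. z < n \<Longrightarrow> ar s' aCnt z = (if z \<in> vis s then Suc (ar s aCnt z) else ar s aCnt z)"
      using I unfolding I_def Ocnt by blast+
    have vn: "vis s \<subseteq> {..<n}" using sst_vis(1)[OF s] by blast
    have B: "ball s' u = (if u = v then vis s else ball s u)" if "u < n" for u
      using that vn M fresh(2) by (auto simp: ball_def split: if_splits)
    have U: "unhit s' = insert v (unhit s)" using v by (auto simp: unhit_def Bg)
    have vU: "v \<notin> unhit s" using fresh by (simp add: unhit_def)
    have un: "u < n" if "u \<in> unhit s" for u using that by (simp add: unhit_def)
    have "card (ball s' u) = L \<and> (\<lambda>j. ar s' aLst (u * n + j)) ` {..<L} = ball s' u"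
      if "u \<in> unhit s'" for u
    proof (cases "u = v")
      case uv: True
      have "(\<lambda>j. ar s' aLst (u * n + j)) ` {..<L} = vis s"
        unfolding Ocnt[symmetric] O'_def using uv v True cn(1) by (intro image_cong) (auto simp: Ls cnt_def)
      then show ?thesis using uv v B cn(3) True by (simp add: cnt_def)
    next
      case False
      with that U have u: "u \<in> unhit s" by simp
      have "(\<lambda>j. ar s' aLst (u * n + j)) ` {..<L} = (\<lambda>j. ar s aLst (u * n + j)) ` {..<L}"
        using False un[OF u] True cn(1) by (intro image_cong) (auto simp: Ls cnt_def)
      then show ?thesis using False u r B un[OF u] by (simp add: reg_def)
    qed
    moreover have "ar s' aCnt z = card {u \<in> unhit s'. z \<in> ball s' u}" if z: "z < n" for z
    proof -
      have "{u \<in> unhit s'. z \<in> ball s' u} =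
        (if z \<in> vis s then insert v {u \<in> unhit s. z \<in> ball s u} else {u \<in> unhit s. z \<in> ball s u})"
        using U B un v(2) vU by (auto split: if_splits)
      then show ?thesis using Cn[OF z] r z vU unhit_finite[of s] by (simp add: reg_def)
    qed
    ultimately have "reg L s'" by (simp add: reg_def)
    then show ?thesis using B Bg by simp
  qed
  show ?thesis
    unfolding register_def
    using True L v
    apply (simp add: wp_eqs)
    apply (rule wp_conseq, rule loop[simplified])
    apply (use fin in \<open>auto simp: cnt_def\<close>)
    done
qed

text \<open>The sum of the bounds for search, pair test, resetting and the linear parts; the
  quadratic term of the pair test yields n^(2/3) per ball.\<close>

definition ball_time :: "nat \<Rightarrow> nat" where
  "ball_time L = (16 * lg + 50) * (L + 2) + L * (L * 13 + 6) + (8 * lg + 8) * L + 14 * L + 24"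

text \<open>A vertex without a full certificate has a registered ball, which is what puts it within
  reach of the greedy phase. Rows of vertices still to come are empty, as registration only adds
  members.\<close>

definition ball_inv :: "nat \<Rightarrow> nat \<Rightarrow> hst \<Rightarrow> bool" where
  "ball_inv L k s \<longleftrightarrow> clean s \<and> sound s \<and> vr s vL = L \<and> reg L s \<and>
     (\<forall>v<n. k \<le> v \<longrightarrow> ar s aBig v = 0 \<and> ball s v = {}) \<and>
     (\<forall>v<n. v < k \<longrightarrow> full_ok v (vr s vBest) \<or> ar s aBig v \<noteq> 0 \<and> ball_ok v (vr s vBest) (ball s v))"

text \<open>Certificates are first obtained for \<open>vE\<close> and then carried over to
  \<open>vBest\<close>, which only improves; all the rest is framing between the components.\<close>

lemma wp_balls:
  assumes i: "ball_inv L 0 s" and L: "1 \<le> L"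
  shows "wp H F balls (\<lambda>t s'. t \<le> n * ball_time L + 2 \<and> ball_inv L n s') s"
  unfolding balls_def
proof (rule wp_FOR[where n = n and I = "\<lambda>k t s'. t \<le> k * ball_time L \<and> ball_inv L k s'"])
  have st: "stat s" using i by (simp add: ball_inv_def clean_def)
  show "vr s vN = n" by (rule statD(1)[OF st])
  have inv_cong: "ball_inv L k (setv a x s') \<longleftrightarrow> ball_inv L k s'" if "a \<in> {vV, vS}" for k a x s'
  proof -
    have "stat (setv a x s') \<longleftrightarrow> stat s'" using that by (auto simp: stat_def)
    moreover have "sound (setv a x s') \<longleftrightarrow> sound s'" using that by (auto simp: sound_def cyl_def)
    moreover have "ball (setv a x s') = ball s'" "unhit (setv a x s') = unhit s'"
      by (simp_all add: fun_eq_iff ball_def unhit_def)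
    ultimately show ?thesis using that by (auto simp: ball_inv_def clean_def reg_def)
  qed
  show "0 \<le> 0 * ball_time L \<and> ball_inv L 0 (setv vV 0 s)" using i by (simp add: inv_cong)
  fix v t :: nat and s2 :: hst
  assume v: "v < n" and I: "t \<le> v * ball_time L \<and> ball_inv L v s2" and iv: "vr s2 vV = v" "vr s2 vN = n"
  define s3 where "s3 = setv vS v s2"
  have I3: "ball_inv L v s3" using I by (simp add: s3_def inv_cong)
  have cl: "clean s3" and so: "sound s3" and rg: "reg L s3" and L3: "vr s3 vL = L"
    and fr: "ar s3 aBig v = 0" "ball s3 v = {}"
    and fr': "\<forall>u<n. v \<le> u \<longrightarrow> ar s3 aBig u = 0 \<and> ball s3 u = {}"
    and okk: "\<forall>u<n. u < v \<longrightarrow> full_ok u (vr s3 vBest) \<or> ar s3 aBig u \<noteq> 0 \<and> ball_ok u (vr s3 vBest) (ball s3 u)"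
    using I3 v unfolding ball_inv_def by blast+
  show "wp H F (Asg vS (V vV) ;; search ;; pairs ;; register ;; finish ;; cleanup)
    (\<lambda>t' s'. t + t' + 2 \<le> Suc v * ball_time L \<and> ball_inv L (Suc v) (setv vV (Suc v) s')) s2"
    apply (simp add: wp_eqs iv s3_def[symmetric])
    apply (rule wp_conseq, rule wp_search[OF cl _ v])
      apply (simp add: s3_def)
     apply (use L in \<open>simp add: L3\<close>)
    apply (rule wp_Sq, rule wp_conseq, rule wp_pairs, blast)
    subgoal premises p for t4 s4 t5 s5
    proof -
      obtain k where k: "sst v k s5" and c5: "vr s5 vE \<noteq> 0 \<longrightarrow> cand s5"
        and ok5: "full_ok v (vr s5 vE) \<or> vr s5 vL = vr s5 vCnt \<and> ball_ok v (vr s5 vE) (vis s5)"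
        and t5: "t5 \<le> vr s4 vCnt * (vr s4 vCnt * 13 + 6) + 2"
        using p(4) by blast
      have t4: "t4 \<le> (16 * lg + 50) * (vr s4 vCnt + 2)" and c4: "vr s4 vCnt \<le> vr s4 vL"
        using p(1) by (auto simp: searched_def)
      have f5: "vr s5 vCnt = vr s4 vCnt" "vr s5 vBest = vr s3 vBest" "vr s5 vLo = vr s3 vLo"
        "vr s5 vHi = vr s3 vHi" "ar s5 aCy = ar s3 aCy" "ar s5 aBig = ar s3 aBig" "ar s5 aMem = ar s3 aMem"
        "ar s5 aCnt = ar s3 aCnt" "ar s5 aLst = ar s3 aLst" "vr s5 vL = L" "vr s4 vL = L"
        "vr s5 vV = v"
        using p iv by (simp_all add: L3) (simp add: s3_def iv)
      have so5: "sound s5" using so by (simp add: sound_def cyl_def f5)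
      have bu: "ball s5 = ball s3" "unhit s5 = unhit s3" by (simp_all add: fun_eq_iff ball_def unhit_def f5)
      have rg5: "reg L s5" using rg by (simp add: reg_def bu f5)
      have W: "wp H F register (\<lambda>t s'. t \<le> 8 * vr s5 vCnt + 6 \<and> reg L s' \<and>
        (\<forall>u<n. ar s' aBig u = (if u = v \<and> L = vr s5 vCnt then 1 else ar s5 aBig u)) \<and>
        (\<forall>u<n. ball s' u = (if u = v \<and> L = vr s5 vCnt then vis s5 else ball s5 u))) s5"
        by (rule wp_register[OF k rg5]) (use v L fr in \<open>simp_all add: f5 bu\<close>)
      show ?thesis
        apply (rule wp_Sq, rule wp_conseq, rule W)
        subgoal premises q for t6 s6
        proof -
          have k6: "sst v k s6" 
            using k q(2,3) stat_cong[of s5 s6] unfolding sst_def vis_def by simp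
          have vis6: "vis s6 = vis s5" using q by (simp add: vis_def)
          have c6: "vr s6 vE \<noteq> 0 \<longrightarrow> cand s6" using c5 q by (simp add: cand_def vis6)
          have so6: "sound s6" using so5 q by (simp add: sound_def cyl_def)
          show ?thesis
            apply (rule wp_Sq, rule wp_conseq, rule wp_finish[OF k6 c6 so6])
            subgoal premises r for t7 s7
            proof -
              have k7: "sst v k s7"
                using k6 r(2,3) stat_cong[of s6 s7] unfolding sst_def vis_def by simp
              show ?thesis
                apply (rule wp_conseq, rule wp_cleanup[OF k7])
                subgoal premises z for t8 s8
                proof -
                  have b8: "vr s8 vBest = vr s7 vBest" "vr s8 vLo = vr s7 vLo" "vr s8 vHi = vr s7 vHi"
                    "ar s8 aCy = ar s7 aCy" using z by simp_all
                  have "sound s7" using r by blast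
                  then have so8: "sound s8" by (simp add: sound_def cyl_def b8)
                  have a8: "ar s8 aBig = ar s6 aBig" "ar s8 aMem = ar s6 aMem" "ar s8 aCnt = ar s6 aCnt"
                    "ar s8 aLst = ar s6 aLst" "vr s8 vL = L" "vr s7 vCnt = vr s4 vCnt" "vr s6 vCnt = vr s4 vCnt"
                    using z r q by (simp_all add: f5)
                  have bu8: "ball s8 = ball s6" "unhit s8 = unhit s6"
                    by (simp_all add: fun_eq_iff ball_def unhit_def a8)
                  have rg8: "reg L s8" using q by (simp add: reg_def bu8 a8)
                  \<comment> \<open>The new best value improves on the old one and on
                    \<open>vE\<close>, so certificates of earlier vertices and that of
                    \<open>v\<close> both persist.\<close>
                  have bet: "vr s3 vBest \<noteq> 0 \<longrightarrow> vr s8 vBest \<noteq> 0 \<and> vr s8 vBest \<le> vr s3 vBest"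
                    "vr s5 vE \<noteq> 0 \<longrightarrow> vr s8 vBest \<noteq> 0 \<and> vr s8 vBest \<le> vr s5 vE"
                    using r q by (simp_all add: b8 f5)
                  have Big: "ar s8 aBig u = (if u = v \<and> L = vr s4 vCnt then 1 else ar s3 aBig u)"
                    and Bal: "ball s8 u = (if u = v \<and> L = vr s4 vCnt then vis s5 else ball s3 u)"
                    if "u < n" for u
                    using q that by (simp_all add: a8 bu8 bu f5)
                  have "full_ok u (vr s8 vBest) \<or> ar s8 aBig u \<noteq> 0 \<and> ball_ok u (vr s8 vBest) (ball s8 u)"
                    if "u < n" "u < Suc v" for u
                  proof (cases "u = v")
                    case True
                    then show ?thesis
                      using ok5 Big[OF v] Bal[OF v] full_ok_better[OF _ bet(2)] ball_ok_better[OF _ bet(2)] f5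
                      by auto
                  next
                    case False
                    then show ?thesis
                      using that okk Big[of u] Bal[of u] full_ok_better[OF _ bet(1)] ball_ok_better[OF _ bet(1)]
                      by auto
                  qed
                  moreover have "\<forall>u<n. Suc v \<le> u \<longrightarrow> ar s8 aBig u = 0 \<and> ball s8 u = {}"
                    using fr' Big Bal by simp
                  moreover have "clean s8" using z by blast
                  ultimately have inv: "ball_inv L (Suc v) s8"
                    using so8 rg8 a8 by (simp add: ball_inv_def)
                  have c: "vr s4 vCnt \<le> L" using c4 f5 by simp
                  have ts: "t4 \<le> (16 * lg + 50) * (L + 2)" "t5 \<le> L * (L * 13 + 6) + 2"
                    "t6 \<le> 8 * L + 6" "t7 \<le> 6 * L + 11" "t8 \<le> (8 * lg + 8) * L + 2"
                  proof -
                    show "t4 \<le> (16 * lg + 50) * (L + 2)"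
                      using t4 mult_le_mono2[of "vr s4 vCnt + 2" "L + 2" "16 * lg + 50"] c by linarith
                    have "vr s4 vCnt * (vr s4 vCnt * 13 + 6) \<le> L * (L * 13 + 6)"
                      using c by (intro mult_le_mono) simp_all
                    then show "t5 \<le> L * (L * 13 + 6) + 2" using t5 by linarith
                    show "t6 \<le> 8 * L + 6" "t7 \<le> 6 * L + 11" using q r c by (auto simp: a8 f5)
                    have "(8 * lg + 8) * vr s4 vCnt \<le> (8 * lg + 8) * L" using c by (rule mult_le_mono2)
                    then show "t8 \<le> (8 * lg + 8) * L + 2" using z(1) by (simp only: a8) linarith
                  qed
                  have "t + (1 + (t4 + (t5 + (t6 + (t7 + t8))))) + 2 \<le> Suc v * ball_time L"
                    using I ts by (simp add: ball_time_def)
                  then show ?thesis using inv by (simp add: inv_cong add_ac)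
                qed
                done
            qed
            done
        qed
        done
    qed
    done
qed (use bnd_sum[of n] in auto)

section \<open>The greedy hitting set\<close>

lemma wp_findmax:
  assumes "vr s vN = n"
  shows "wp H F findmax (\<lambda>t s'. t \<le> 5 * n + 3 \<and> vr s' vZ < n \<and> (\<forall>x<n. ar s aCnt x \<le> ar s aCnt (vr s' vZ))) s"
proof -
  have "wp H F (FOR vI vN (IF CLess (Rd aCnt (V vZ)) (Rd aCnt (V vI)) (Asg vZ (V vI)) SKIP))
    (\<lambda>t s'. t \<le> 5 * n + 2 \<and> vr s' vZ < n \<and> (\<forall>x<n. ar s aCnt x \<le> ar s aCnt (vr s' vZ))) (setv vZ 0 s)"
  proof (rule wp_FOR[where n = n and I = "\<lambda>i t s'. t \<le> 5 * i \<and> vr s' vZ < n \<and>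
      (\<forall>x<i. ar s aCnt x \<le> ar s aCnt (vr s' vZ)) \<and> ar s' aCnt = ar s aCnt"])
    fix i t :: nat and s2 :: hst
    assume i: "i < n" and I: "t \<le> 5 * i \<and> vr s2 vZ < n \<and>
      (\<forall>x<i. ar s aCnt x \<le> ar s aCnt (vr s2 vZ)) \<and> ar s2 aCnt = ar s aCnt"
      and iv: "vr s2 vI = i" "vr s2 vN = n"
    show "wp H F (IF CLess (Rd aCnt (V vZ)) (Rd aCnt (V vI)) (Asg vZ (V vI)) SKIP)
      (\<lambda>t' s'. t + t' + 2 \<le> 5 * Suc i \<and> vr (setv vI (Suc i) s') vZ < n \<and>
        (\<forall>x<Suc i. ar s aCnt x \<le> ar s aCnt (vr (setv vI (Suc i) s') vZ)) \<and>
        ar (setv vI (Suc i) s') aCnt = ar s aCnt) s2"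
      using i I by (auto simp: wp_eqs iv less_Suc_eq intro: order.trans less_imp_le)
  qed (use assms bnd_sum[of n] n_pos in auto)
  then show ?thesis unfolding findmax_def by (simp add: wp_eqs) (rule wp_conseq, assumption, auto)
qed

lemma inv_setv [simp]:
  "ball (setv i x s) = ball s" "unhit (setv i x s) = unhit s" "reg L (setv i x s) \<longleftrightarrow> reg L s"
  by (simp_all add: fun_eq_iff ball_def unhit_def reg_def)

lemma reg_cong:
  assumes "reg L s" "ar s' aBig = ar s aBig" "ar s' aMem = ar s aMem" "ar s' aCnt = ar s aCnt" "ar s' aLst = ar s aLst"
  shows "reg L s'" "ball s' = ball s" "unhit s' = unhit s"
proof -
  show b: "ball s' = ball s" and u: "unhit s' = unhit s"
    using assms by (simp_all add: fun_eq_iff ball_def unhit_def)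
  show "reg L s'" using assms(1) by (simp add: reg_def b u assms)
qed

lemma wp_unregister:
  assumes r: "reg L s" and vr: "vr s vN = n" "vr s vBall = L" "vr s vI = v" and v: "v \<in> unhit s"
  shows "wp H F unregister (\<lambda>t s'. t \<le> 5 * L + 4 \<and> ar s' aBig = (ar s aBig)(v := 0) \<and>
    (\<forall>x<n. ar s' aCnt x = ar s aCnt x - (if x \<in> ball s v then 1 else 0))) s"
proof -
  define R where "R = (\<lambda>j. ar s aLst (v * n + j))"
  have cb: "card (ball s v) = L" and im: "R ` {..<L} = ball s v" using r v by (simp_all add: reg_def R_def)
  \<comment> \<open>\<open>L\<close> positions cover a ball of \<open>L\<close> elements, so no
    member is listed twice and each counter drops exactly once.\<close>
  have inj: "inj_on R {..<L}" by (rule eq_card_imp_inj_on) (simp_all add: im cb)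
  have vn: "v < n" using v by (simp add: unhit_def)
  have Ln: "L \<le> n" using card_mono[OF _ ball_finite(2)[of s v]] cb by simp
  define I where "I = (\<lambda>j t s'. t \<le> 5 * j \<and> vr s' vN = n \<and> vr s' vI = v \<and> ar s' aLst = ar s aLst \<and>
    ar s' aBig = (ar s aBig)(v := 0) \<and>
    (\<forall>x<n. ar s' aCnt x = ar s aCnt x - (if x \<in> R ` {..<j} then 1 else 0)))"
  have "wp H F unregister_loop
    (\<lambda>t s'. t \<le> 5 * L + 2 \<and> I L 0 s') (seta aBig v 0 s)"
    unfolding unregister_loop_def
  proof (rule wp_FOR[where n = L and I = I])
    show "I 0 0 (setv vJ 0 (seta aBig v 0 s))" using vr by (simp add: I_def)
    fix j t :: nat and s2 :: hst
    assume j: "j < L" and I: "I j t s2" and ij: "vr s2 vJ = j" "vr s2 vBall = L"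
    have I': "vr s2 vN = n" "vr s2 vI = v" "ar s2 aLst = ar s aLst" "ar s2 aBig = (ar s aBig)(v := 0)"
      and t: "t \<le> 5 * j" and C: "\<And>x. x < n \<Longrightarrow> ar s2 aCnt x = ar s aCnt x - (if x \<in> R ` {..<j} then 1 else 0)"
      using I unfolding I_def by blast+
    have b: "v * n < H" "v * n + j < H" using bnd_prod[of v] bnd_sq[of v j] vn j Ln by auto
    have "R j \<noteq> R x" if "x < j" for x using inj_onD[OF inj, of j x] that j by auto
    then have Rj: "R j < n" "R j \<notin> R ` {..<j}" using im j ball_finite(2)[of s v] by auto
    have RS: "R ` {..<Suc j} = insert (R j) (R ` {..<j})" by (auto simp: lessThan_Suc)
    have Rf: "ar s aLst (v * n + j) = R j" by (simp add: R_def)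
    show "wp H F (Asg vX (Rd aLst (V vI .* V vN .+ V vJ)) ;; St aCnt (V vX) (Rd aCnt (V vX) .- N 1))
      (\<lambda>t' s'. I (Suc j) (t + t' + 2) (setv vJ (Suc j) s')) s2"
      apply (simp add: wp_eqs ij I' Rf b)
      using t Rj C
      apply (simp add: I_def RS I')
      done
  qed (use vr Ln bnd_sum[of L] in \<open>auto simp: I_def\<close>)
  then show ?thesis
    unfolding unregister_def
    apply (simp add: wp_eqs vr)
    apply (rule wp_conseq, assumption)
    apply (simp add: I_def im)
    done
qed

text \<open>The cost \<open>5 * L + 8\<close> is charged to each ball that is hit. A ball is hit
  only once, so over all rounds this amounts to at most \<open>n\<close> such charges.\<close>

lemma wp_hit:
  assumes r: "reg L s" and vr: "vr s vN = n" "vr s vBall = L" "vr s vZ = z" "z < n"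
  shows "wp H F hit (\<lambda>t s'. t \<le> 6 * n + 2 + (5 * L + 8) * card {v \<in> unhit s. z \<in> ball s v} \<and>
    reg L s' \<and> unhit s' = unhit s - {v. z \<in> ball s v}) s"
proof -
  define U where "U = (\<lambda>i. {v \<in> unhit s. v < i \<and> z \<in> ball s v})"
  have Uf: "finite (U i)" for i using unhit_finite(1)[of s] by (simp add: U_def)
  have Un: "U n = {v \<in> unhit s. z \<in> ball s v}" by (auto simp: U_def unhit_def)
  have "wp H F hit (\<lambda>t s'. t \<le> 6 * n + (5 * L + 8) * card (U n) + 2 \<and>
    reg L s' \<and> unhit s' = unhit s - U n) s"
    unfolding hit_def
  proof (rule wp_FOR[where n = n and I = "\<lambda>i t s'. t \<le> 6 * i + (5 * L + 8) * card (U i) \<and> reg L s' \<and>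
      unhit s' = unhit s - U i \<and> ball s' = ball s \<and> vr s' vZ = z \<and> vr s' vBall = L \<and> ar s' aMem = ar s aMem"])
    show "0 \<le> 6 * 0 + (5 * L + 8) * card (U 0) \<and> reg L (setv vI 0 s) \<and>
      unhit (setv vI 0 s) = unhit s - U 0 \<and> ball (setv vI 0 s) = ball s \<and> vr (setv vI 0 s) vZ = z \<and>
      vr (setv vI 0 s) vBall = L \<and> ar (setv vI 0 s) aMem = ar s aMem"
      using r vr by (simp add: U_def)
    fix i t :: nat and s2 :: hst
    assume i: "i < n" and I: "t \<le> 6 * i + (5 * L + 8) * card (U i) \<and> reg L s2 \<and>
      unhit s2 = unhit s - U i \<and> ball s2 = ball s \<and> vr s2 vZ = z \<and> vr s2 vBall = L \<and> ar s2 aMem = ar s aMem"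
      and iv: "vr s2 vI = i" "vr s2 vN = n"
    have I': "reg L s2" "unhit s2 = unhit s - U i" "ball s2 = ball s" "vr s2 vZ = z" "vr s2 vBall = L"
      "ar s2 aMem = ar s aMem" and t: "t \<le> 6 * i + (5 * L + 8) * card (U i)"
      using I by blast+
    have b: "i * n < H" "i * n + z < H" using bnd_prod[of i] bnd_sq[of i z] i vr by auto
    have US: "U (Suc i) = (if i \<in> unhit s \<and> z \<in> ball s i then insert i (U i) else U i)"
      by (auto simp: U_def less_Suc_eq)
    have iU: "i \<notin> U i" by (simp add: U_def)
    have Big: "ar s2 aBig i \<noteq> 0 \<longleftrightarrow> i \<in> unhit s"
      using I'(2) iU i by (auto simp: unhit_def)
    have Mem: "ar s aMem (i * n + z) \<noteq> 0 \<longleftrightarrow> z \<in> ball s i" using vr by (simp add: ball_def)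
    show "wp H F (IF CEq (Rd aBig (V vI)) (N 0) SKIP
        (IF CEq (Rd aMem (V vI .* V vN .+ V vZ)) (N 0) SKIP unregister))
      (\<lambda>t' s'. t + t' + 2 \<le> 6 * Suc i + (5 * L + 8) * card (U (Suc i)) \<and> reg L (setv vI (Suc i) s') \<and>
      unhit (setv vI (Suc i) s') = unhit s - U (Suc i) \<and> ball (setv vI (Suc i) s') = ball s \<and>
      vr (setv vI (Suc i) s') vZ = z \<and> vr (setv vI (Suc i) s') vBall = L \<and>
      ar (setv vI (Suc i) s') aMem = ar s aMem) s2"
    proof (cases "i \<in> unhit s \<and> z \<in> ball s i")
      case False
      then have "U (Suc i) = U i" unfolding US by (rule if_not_P)
      with False Big Mem t show ?thesis
        by (auto simp: wp_eqs iv I' b)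
    next
      case True
      have cU: "card (U (Suc i)) = Suc (card (U i))" using True US iU Uf by simp
      have i2: "i \<in> unhit s2" using True I'(2) iU by simp
      have W: "wp H F unregister (\<lambda>t s'. t \<le> 5 * L + 4 \<and> ar s' aBig = (ar s2 aBig)(i := 0) \<and>
        (\<forall>x<n. ar s' aCnt x = ar s2 aCnt x - (if x \<in> ball s2 i then 1 else 0))) s2"
        by (rule wp_unregister[OF I'(1) iv(2) I'(5) iv(1) i2])
      have nz: "ar s2 aBig i \<noteq> 0" "ar s aMem (i * n + z) \<noteq> 0" using True Big Mem by auto
      show ?thesis
        using nz
        apply (simp add: wp_eqs iv I'(3-6) b)
        apply (rule wp_conseq, rule W)
        subgoal premises p for t3 s3
        proof -
          have B3: "ball s3 = ball s2" using p by (simp add: fun_eq_iff ball_def)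
          have U3: "unhit s3 = unhit s2 - {i}" using p by (auto simp: unhit_def)
          have "card (ball s3 v) = L \<and> (\<lambda>j. ar s3 aLst (v * n + j)) ` {..<L} = ball s3 v"
            if "v \<in> unhit s3" for v
            using that I'(1) p unfolding U3 B3 by (simp add: reg_def)
          moreover have "ar s3 aCnt x = card {v \<in> unhit s3. x \<in> ball s3 v}" if "x < n" for x
          proof -
            have "{v \<in> unhit s3. x \<in> ball s3 v} =
              (if x \<in> ball s2 i then {v \<in> unhit s2. x \<in> ball s2 v} - {i} else {v \<in> unhit s2. x \<in> ball s2 v})"
              unfolding U3 B3 by auto
            moreover have "ar s3 aCnt x = ar s2 aCnt x - (if x \<in> ball s2 i then 1 else 0)"
              using p that by blast
            ultimately show ?thesis using I'(1) that i2 unhit_finite(1)[of s2] by (simp add: reg_def)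
          qed
          ultimately have "reg L s3" by (simp add: reg_def)
          moreover have "unhit s3 = unhit s - U (Suc i)" using U3 I'(2) True US by auto
          moreover have "vr s3 vZ = z" "vr s3 vBall = L" "ar s3 aMem = ar s aMem" "t3 \<le> 5 * L + 4"
            using p I' by simp_all
          ultimately show ?thesis using t B3 I'(3) cU by simp
        qed
        done
    qed
  qed (use vr bnd_sum[of n] in auto)
  then show ?thesis
    by (rule wp_conseq) (auto simp: Un)
qed

definition round_time :: nat where
  "round_time = (16 * lg + 50) * (n + 2) + (8 * lg + 8) * n + 17 * n + 30"

text \<open>A ball is unhit or contains a vertex from which a full search has been made. Once no
  ball is unhit, the last conjunct is the hypothesis of \<open>approximation\<close>.\<close>

definition ginv :: "nat \<Rightarrow> hst \<Rightarrow> bool" where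
  "ginv L s \<longleftrightarrow> clean s \<and> sound s \<and> vr s vL = n + 1 \<and> vr s vBall = L \<and> reg L s \<and> vr s vZ < n \<and>
     (\<forall>x<n. ar s aCnt x \<le> ar s aCnt (vr s vZ)) \<and>
     (\<forall>v<n. full_ok v (vr s vBest) \<or> ball_ok v (vr s vBest) (ball s v) \<and>
       (v \<in> unhit s \<or> (\<exists>u\<in>ball s v. full_ok u (vr s vBest))))"

lemma wp_greedy_round:
  assumes g: "ginv L s"
  shows "wp H F greedy_round (\<lambda>t s'. t \<le> round_time + (5 * L + 8) * ar s aCnt (vr s vZ) \<and> ginv L s' \<and>
    card (unhit s') = card (unhit s) - ar s aCnt (vr s vZ)) s"
proof -
  define z where "z = vr s vZ"
  have cl: "clean s" and so: "sound s" and L: "vr s vL = n + 1" "vr s vBall = L" and r: "reg L s"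
    and z: "z < n"
    and ok: "\<And>v. v < n \<Longrightarrow> full_ok v (vr s vBest) \<or> ball_ok v (vr s vBest) (ball s v) \<and>
       (v \<in> unhit s \<or> (\<exists>u\<in>ball s v. full_ok u (vr s vBest)))"
    using g unfolding ginv_def z_def by blast+
  have st: "stat s" using cl by (simp add: clean_def)
  note N = statD(1)[OF st]
  have cz: "ar s aCnt z = card {v \<in> unhit s. z \<in> ball s v}" using r z by (simp add: reg_def)
  show ?thesis
    unfolding greedy_round_def
    apply (rule wp_Sq, rule wp_conseq, rule wp_hit[OF r N L(2) z_def[symmetric] z])
    subgoal premises p for t1 s1
    proof -
      define s2 where "s2 = setv vS z s1"
      have "stat s2" by (rule stat_cong[OF st]) (use p in \<open>simp_all add: s2_def\<close>)
      then have cl2: "clean s2" using cl p by (simp add: clean_def s2_def)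
      have z1: "vr s1 vZ = z" using p by (simp add: z_def)
      have f2: "vr s2 vL = n + 1" "vr s2 vBall = L" "vr s2 vBest = vr s vBest" "vr s2 vLo = vr s vLo"
        "vr s2 vHi = vr s vHi" "ar s2 aCy = ar s aCy" "vr s2 vS = z" "vr s2 vZ = z"
        using p L by (simp_all add: s2_def z_def)
      have B2: "ball s2 = ball s" using p by (simp add: fun_eq_iff ball_def s2_def)
      have U2: "unhit s2 = unhit s - {v. z \<in> ball s v}" and r2: "reg L s2" using p by (simp_all add: s2_def)
      show ?thesis
        apply (simp add: wp_eqs z1 s2_def[symmetric])
        apply (rule wp_conseq, rule wp_search[OF cl2 _ z])
          apply (simp add: f2)
         apply (simp add: f2)
        subgoal premises q for t3 s3
        proof -
          obtain k where k: "sst z k s3" and c3: "vr s3 vE \<noteq> 0 \<longrightarrow> cand s3"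
            and fo: "full_ok z (vr s3 vE) \<or> vr s3 vE = 0 \<and> vr s3 vL = vr s3 vCnt"
            using q by (auto simp: searched_def)
          have f3: "vr s3 vL = n + 1" "vr s3 vBall = L" "vr s3 vBest = vr s vBest" "vr s3 vLo = vr s vLo"
            "vr s3 vHi = vr s vHi" "ar s3 aCy = ar s aCy"
            using q by (simp_all add: f2)
          have cn: "vr s3 vCnt \<le> n" using sinv_card[OF sstD(3)[OF k]] by simp
          \<comment> \<open>The cut-off alternative would require \<open>n + 1\<close> visited
            vertices.\<close>
          have fz: "full_ok z (vr s3 vE)" using fo f3 cn by auto
          have so3: "sound s3" using so by (simp add: sound_def cyl_def f3)
          show ?thesis
            apply (rule wp_Sq, rule wp_conseq, rule wp_finish[OF k c3 so3])
            subgoal premises u for t4 s4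
            proof -
              have k4: "sst z k s4"
                using k u(2,3) stat_cong[of s3 s4] unfolding sst_def vis_def by simp
              show ?thesis
                apply (rule wp_Sq, rule wp_conseq, rule wp_cleanup[OF k4])
                subgoal premises x for t5 s5
                proof -
                  have cl5: "clean s5" using x by blast
                  have N5: "vr s5 vN = n" using cl5 statD(1) by (simp add: clean_def)
                  have f5: "vr s5 vL = n + 1" "vr s5 vBall = L" "vr s5 vBest = vr s4 vBest"
                    "vr s5 vLo = vr s4 vLo" "vr s5 vHi = vr s4 vHi" "ar s5 aCy = ar s4 aCy"
                    "vr s4 vCnt = vr s3 vCnt"
                    using x u f3 by simp_all
                  have "sound s4" using u by blast
                  then have so5: "sound s5" by (simp add: sound_def cyl_def f5)
                  have r5: "reg L s5" "ball s5 = ball s2" "unhit s5 = unhit s2"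
                    using reg_cong[OF r2, of s5] x u q by simp_all
                  have bet: "vr s vBest \<noteq> 0 \<longrightarrow> vr s5 vBest \<noteq> 0 \<and> vr s5 vBest \<le> vr s vBest"
                    "vr s3 vE \<noteq> 0 \<longrightarrow> vr s5 vBest \<noteq> 0 \<and> vr s5 vBest \<le> vr s3 vE"
                    using u f3 f5 by simp_all
                  have fz5: "full_ok z (vr s5 vBest)" by (rule full_ok_better[OF fz bet(2)])
                  have ok5: "full_ok v (vr s5 vBest) \<or> ball_ok v (vr s5 vBest) (ball s5 v) \<and>
                     (v \<in> unhit s5 \<or> (\<exists>u\<in>ball s5 v. full_ok u (vr s5 vBest)))" if v: "v < n" for v
                  proof (cases "full_ok v (vr s vBest)")
                    case True
                    then show ?thesis using full_ok_better[OF _ bet(1)] by blast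
                  next
                    case False
                    then have b: "ball_ok v (vr s vBest) (ball s v)"
                      and "v \<in> unhit s \<or> (\<exists>u\<in>ball s v. full_ok u (vr s vBest))"
                      using ok[OF v] by blast+
                    moreover have "ball_ok v (vr s5 vBest) (ball s5 v)"
                      unfolding r5 B2 by (rule ball_ok_better[OF b bet(1)])
                    ultimately show ?thesis
                      using fz5 full_ok_better[OF _ bet(1)] unfolding r5 B2 U2 by blast
                  qed
                  have cU: "card (unhit s5) = card (unhit s) - ar s aCnt z"
                  proof -
                    have "unhit s5 = unhit s - {v \<in> unhit s. z \<in> ball s v}" unfolding r5 U2 by blast
                    moreover have "finite {v \<in> unhit s. z \<in> ball s v}" using unhit_finite(1)[of s] by simp
                    ultimately show ?thesis using card_Diff_subset[of "{v \<in> unhit s. z \<in> ball s v}" "unhit s"]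
                      by (simp add: cz)
                  qed
                  have t1: "t1 \<le> 6 * n + 2 + (5 * L + 8) * ar s aCnt z" using p by (simp add: cz)
                  have t3: "t3 \<le> (16 * lg + 50) * (n + 2)"
                    using q(1) mult_le_mono2[of "vr s3 vCnt + 2" "n + 2" "16 * lg + 50"] cn by linarith
                  have t4: "t4 \<le> 6 * n + 11" using u cn by auto
                  have "(8 * lg + 8) * vr s4 vCnt \<le> (8 * lg + 8) * n"
                    using cn f5(7) by (intro mult_le_mono2) simp
                  moreover have "t5 \<le> (8 * lg + 8) * vr s4 vCnt + 2" using x(1) by blast
                  ultimately have t5: "t5 \<le> (8 * lg + 8) * n + 2" by linarith
                  show ?thesis
                    apply (rule wp_conseq, rule wp_findmax[OF N5])
                    subgoal premises y for t6 s6
                    proof -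
                      have a6: "ar s6 = ar s5" using y by auto
                      have "stat s6" by (rule stat_cong[of s5]) (use cl5 a6 y in \<open>simp_all add: clean_def\<close>)
                      then have "clean s6" using cl5 by (simp add: clean_def a6)
                      moreover have "sound s6" using so5 y by (simp add: sound_def cyl_def)
                      moreover have "reg L s6" "ball s6 = ball s5" "unhit s6 = unhit s5"
                        using reg_cong[OF r5(1), of s6] by (simp_all add: a6)
                      moreover have "vr s6 vL = n + 1" "vr s6 vBall = L" "vr s6 vBest = vr s5 vBest" "vr s6 vZ < n"
                        "\<forall>x<n. ar s6 aCnt x \<le> ar s6 aCnt (vr s6 vZ)"
                        using y f5 by (simp_all add: a6)
                      ultimately have "ginv L s6" unfolding ginv_def using ok5 by simp
                      moreover have "card (unhit s6) = card (unhit s) - ar s aCnt (vr s vZ)"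
                        using cU \<open>unhit s6 = unhit s5\<close> by (simp add: z_def)
                      moreover have "t1 + Suc (t3 + (t4 + (t5 + t6))) \<le> round_time + (5 * L + 8) * ar s aCnt (vr s vZ)"
                        using t1 t3 t4 t5 y(1) unfolding round_time_def z_def[symmetric] by linarith
                      ultimately show ?thesis by simp
                    qed
                    done
                qed
                done
            qed
            done
        qed
        done
    qed
    done
qed

text \<open>Double counting of incidences: each unhit ball contributes \<open>L\<close>, each of the
  \<open>n\<close> vertices at most the maximal counter.\<close>

lemma count_max:
  assumes r: "reg L s" and z: "z < n" "\<And>x. x < n \<Longrightarrow> ar s aCnt x \<le> ar s aCnt z"
  shows "card (unhit s) * L \<le> n * ar s aCnt z"
proof -
  have "card (unhit s) * L = (\<Sum>v\<in>unhit s. card (ball s v))"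
    using r by (simp add: reg_def)
  also have "\<dots> = (\<Sum>v\<in>unhit s. \<Sum>x<n. if x \<in> ball s v then 1 else 0)"
  proof (intro sum.cong refl)
    fix v
    have "ball s v = {..<n} \<inter> ball s v" using ball_finite(2) by blast
    then have "card (ball s v) = card ({..<n} \<inter> ball s v)" by simp
    then show "card (ball s v) = (\<Sum>x<n. if x \<in> ball s v then 1 else 0)"
      by (simp add: sum.If_cases)
  qed
  also have "\<dots> = (\<Sum>x<n. \<Sum>v\<in>unhit s. if x \<in> ball s v then 1 else 0)" by (rule sum.swap)
  also have "\<dots> = (\<Sum>x<n. ar s aCnt x)"
  proof (intro sum.cong refl)
    fix x assume "x \<in> {..<n}"
    then show "(\<Sum>v\<in>unhit s. if x \<in> ball s v then 1 else 0) = ar s aCnt x"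
      using r unhit_finite(1)[of s] by (simp add: reg_def sum.If_cases Int_def)
  qed
  also have "\<dots> \<le> (\<Sum>x<n. ar s aCnt z)" by (intro sum_mono z(2)) simp
  finally show ?thesis by simp
qed

text \<open>As long as one ball is unhit, 1 \<le> n (1 - L / n)^r \<le> n exp (- r L / n); taking
  logarithms bounds \<open>r\<close>.\<close>

lemma rounds_le:
  assumes "1 \<le> u" "u \<le> real n * (1 - real L / real n) ^ r" "1 \<le> L" "L \<le> n"
  shows "real r \<le> real n * ln (real n) / real L"
proof -
  have n: "0 < real n" "0 < real L" using assms by auto
  have "1 - real L / real n \<le> exp (- (real L / real n))"
    using exp_ge_add_one_self[of "- (real L / real n)"] by simp
  moreover have "0 \<le> 1 - real L / real n" using assms n by simp
  ultimately have "(1 - real L / real n) ^ r \<le> exp (- (real L / real n)) ^ r" by (rule power_mono)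
  also have "\<dots> = exp (- (real r * real L / real n))" by (simp add: exp_of_nat_mult[symmetric])
  finally have "real n * (1 - real L / real n) ^ r \<le> real n * exp (- (real r * real L / real n))"
    using n by simp
  then have "1 \<le> real n * exp (- (real r * real L / real n))" using assms by linarith
  then have "exp (real r * real L / real n) \<le> real n" by (simp add: exp_minus field_simps)
  then have "real r * real L / real n \<le> ln (real n)" using n by (simp add: ln_ge_iff)
  then show ?thesis using n by (simp add: field_simps)
qed

text \<open>The fixed cost of a round is multiplied by the number of rounds, while the cost of
  hitting is amortised over the decrease of \<open>card (unhit s')\<close>. \<open>rounds_le\<close>
  applies at the start of a round, when a ball is still unhit, hence one more round in the
  bound.\<close>

lemma wp_greedy:
  assumes i: "ball_inv L n s" and L: "vr s vBall = L" "1 \<le> L"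
  shows "wp H F greedy (\<lambda>t s'. real t \<le> (real n * ln (real n) / real L + 1) * (real round_time + 1) +
      real ((5 * L + 8) * n + 5 * n + 6) \<and> sound s' \<and>
    (\<forall>v<n. full_ok v (vr s' vBest) \<or> ball_ok v (vr s' vBest) (ball s' v) \<and>
       (\<exists>u\<in>ball s' v. full_ok u (vr s' vBest)))) s"
proof -
  define q where "q = 1 - real L / real n"
  define J where "J = (\<lambda>t s'. ginv L s' \<and> (\<exists>r. real (card (unhit s')) \<le> real n * q ^ r \<and>
    real r \<le> real n * ln (real n) / real L + 1 \<and>
    t \<le> r * (round_time + 1) + (5 * L + 8) * (n - card (unhit s'))))"
  have st: "stat s" and cl: "clean s" and so: "sound s" and r: "reg L s"
    and ok: "\<And>v. v < n \<Longrightarrow> full_ok v (vr s vBest) \<or> ar s aBig v \<noteq> 0 \<and> ball_ok v (vr s vBest) (ball s v)"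
    using i by (auto simp: ball_inv_def clean_def)
  note N = statD(1)[OF st]
  have nH: "n + 1 < H" by (rule bnd_sum) simp
  have g: "ginv L s'" if "vr s' vZ < n" "\<forall>x<n. ar (setv vL (n + 1) s) aCnt x \<le> ar (setv vL (n + 1) s) aCnt (vr s' vZ)"
     and v: "\<And>x. x \<notin> wv findmax \<Longrightarrow> vr s' x = vr (setv vL (n + 1) s) x"
     and a: "\<And>a. a \<notin> wa findmax \<Longrightarrow> ar s' a = ar (setv vL (n + 1) s) a" for s'
  proof -
    have a6: "ar s' = ar s" using a by auto
    have "stat s'" by (rule stat_cong[OF st]) (use v a6 in simp_all)
    then have "clean s'" using cl by (simp add: clean_def a6)
    moreover have "sound s'" using so v by (simp add: sound_def cyl_def a6)
    moreover have "reg L s'" "ball s' = ball s" "unhit s' = unhit s"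
      using reg_cong[OF r, of s'] by (simp_all add: a6)
    moreover have "vr s' vL = n + 1" "vr s' vBall = L" "vr s' vBest = vr s vBest" using v L by simp_all
    moreover have "full_ok v (vr s vBest) \<or> ball_ok v (vr s vBest) (ball s v) \<and> v \<in> unhit s" if "v < n" for v
      using ok[OF that] that by (auto simp: unhit_def)
    ultimately show ?thesis unfolding ginv_def using that by (auto simp: a6)
  qed
  have pos: "0 \<le> real n * ln (real n) / real L" using n_pos by simp
  show ?thesis
    unfolding greedy_def
    apply (simp add: wp_eqs N nH[simplified])
    apply (rule wp_conseq, rule wp_findmax)
     apply (simp add: N)
    subgoal premises p for t1 s1
    proof -
      have g1: "ginv L s1" by (rule g) (use p in simp_all)
      have t1: "t1 \<le> 5 * n + 3" using p by blast
      show ?thesis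
        apply (rule wp_WH[where I = J and m = "\<lambda>s. card (unhit s)"])
        subgoal using g1 unhit_finite(2)[of s1] pos by (auto simp: J_def intro!: exI[of _ 0])
        subgoal by simp
        subgoal premises x for t s2
        proof -
          have g2: "ginv L s2" using x by (simp add: J_def)
          define c where "c = ar s2 aCnt (vr s2 vZ)"
          have c0: "c \<noteq> 0" using x by (simp add: c_def)
          obtain r where r: "real (card (unhit s2)) \<le> real n * q ^ r"
            "t \<le> r * (round_time + 1) + (5 * L + 8) * (n - card (unhit s2))"
            using x by (auto simp: J_def)
          have rg: "reg L s2" and z: "vr s2 vZ < n" and mx: "\<And>x. x < n \<Longrightarrow> ar s2 aCnt x \<le> c"
            using g2 unfolding ginv_def c_def by blast+
          have cc: "c = card {v \<in> unhit s2. vr s2 vZ \<in> ball s2 v}" using rg z by (simp add: reg_def c_def)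
          have cle: "c \<le> card (unhit s2)" unfolding cc by (intro card_mono) (auto simp: unhit_finite)
          have cn: "card (unhit s2) \<le> n" by (rule unhit_finite)
          have Ln: "L \<le> n"
          proof -
            from cle c0 have "unhit s2 \<noteq> {}" by auto
            then obtain v where "v \<in> unhit s2" by blast
            then have "card (ball s2 v) = L" using rg by (simp add: reg_def)
            then show ?thesis using card_mono[OF _ ball_finite(2)[of s2 v]] by simp
          qed
          have q0: "0 \<le> q" using Ln n_pos by (simp add: q_def)
          have "card (unhit s2) * L \<le> n * c" unfolding c_def by (rule count_max[OF rg z]) (use mx c_def in simp)
          then have cm: "real (card (unhit s2)) * real L \<le> real n * real c"
            by (metis of_nat_le_iff of_nat_mult)
          \<comment> \<open>By \<open>count_max\<close> the chosen vertex hits at least the fraction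
            L / n of the remaining balls.\<close>
          have card': "real (card (unhit s2)) - real c \<le> real n * q ^ Suc r"
          proof -
            have "real (card (unhit s2)) * (real L / real n) \<le> real c"
              using cm n_pos by (simp add: field_simps)
            then have "real (card (unhit s2)) - real c \<le> real (card (unhit s2)) * q"
              by (simp add: q_def algebra_simps)
            also have "\<dots> \<le> real n * q ^ r * q" using r(1) q0 by (rule mult_right_mono)
            finally show ?thesis by (simp add: mult_ac)
          qed
          have rr: "real r \<le> real n * ln (real n) / real L"
            by (rule rounds_le[OF _ r(1)[unfolded q_def]]) (use c0 cle L Ln in auto)
          show ?thesis
            apply (rule wp_conseq, rule wp_greedy_round[OF g2])
            subgoal premises y for t3 s3
            proof -
              have u3: "card (unhit s3) = card (unhit s2) - c" using y by (simp add: c_def)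
              have "real (card (unhit s3)) \<le> real n * q ^ Suc r" using card' u3 cle by (simp add: of_nat_diff)
              moreover have "real (Suc r) \<le> real n * ln (real n) / real L + 1" using rr by simp
              moreover have "t + t3 + 1 \<le> Suc r * (round_time + 1) + (5 * L + 8) * (n - card (unhit s3))"
              proof -
                have "n - card (unhit s3) = (n - card (unhit s2)) + c" using u3 cle cn by simp
                moreover have "t3 \<le> round_time + (5 * L + 8) * c" using y by (simp add: c_def)
                ultimately show ?thesis using r(2) by (simp add: algebra_simps)
              qed
              moreover have "ginv L s3" using y by blast
              ultimately have "J (t + t3 + 1) s3" unfolding J_def by blast
              then show ?thesis using u3 c0 cle by simp
            qed
            done
        qed
        subgoal premises x for t s2
        proof -
          have g2: "ginv L s2" using x by (simp add: J_def)
          have c0: "ar s2 aCnt (vr s2 vZ) = 0" using x by simp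
          obtain r where r: "real r \<le> real n * ln (real n) / real L + 1"
            "t \<le> r * (round_time + 1) + (5 * L + 8) * (n - card (unhit s2))"
            using x by (auto simp: J_def)
          have rg: "reg L s2" and z: "vr s2 vZ < n" and mx: "\<And>x. x < n \<Longrightarrow> ar s2 aCnt x \<le> 0"
            using g2 c0 unfolding ginv_def by metis+
          \<comment> \<open>The maximal counter is 0 and balls are nonempty because of
            \<open>1 \<le> L\<close>, so no ball is left.\<close>
          have "card (unhit s2) * L \<le> n * ar s2 aCnt (vr s2 vZ)" by (rule count_max[OF rg z]) (use mx c0 in simp)
          then have "unhit s2 = {}" using c0 L unhit_finite(1)[of s2] by simp
          then have "\<forall>v<n. full_ok v (vr s2 vBest) \<or> ball_ok v (vr s2 vBest) (ball s2 v) \<and>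
            (\<exists>u\<in>ball s2 v. full_ok u (vr s2 vBest))" "sound s2"
            using g2 unfolding ginv_def by blast+
          moreover have "real (1 + (t1 + (t + 1))) \<le> (real n * ln (real n) / real L + 1) * (real round_time + 1) +
            real ((5 * L + 8) * n + 5 * n + 6)"
          proof -
            have "(5 * L + 8) * (n - card (unhit s2)) \<le> (5 * L + 8) * n" by (intro mult_le_mono2) simp
            then have "1 + (t1 + (t + 1)) \<le> r * (round_time + 1) + ((5 * L + 8) * n + 5 * n + 6)"
              using t1 r(2) by linarith
            then have "real (1 + (t1 + (t + 1))) \<le> real r * (real round_time + 1) + real ((5 * L + 8) * n + 5 * n + 6)"
              by (metis of_nat_1 of_nat_add of_nat_le_iff of_nat_mult)
            also have "real r * (real round_time + 1) \<le> (real n * ln (real n) / real L + 1) * (real round_time + 1)"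
              by (intro mult_right_mono r) simp
            finally show ?thesis by simp
          qed
          ultimately show ?thesis by simp
        qed
        done
    qed
    done
qed

end

section \<open>Reading the input\<close>

lemma nth_concat_take:
  "u < length A \<Longrightarrow> i < length (A ! u) \<Longrightarrow> concat A ! (length (concat (take u A)) + i) = A ! u ! i"
proof (induction A arbitrary: u)
  case (Cons a A)
  then show ?case by (cases u) (auto simp: nth_append)
qed simp

lemma length_concat_take:
  "u < length A \<Longrightarrow> length (concat (take (Suc u) A)) = length (concat (take u A)) + length (A ! u)"
  by (simp add: take_Suc_conv_app_nth)

lemma length_concat_take_le: "length (concat (take u A)) \<le> length (concat A)"
  by (metis append_take_drop_id concat_append length_append le_add1)

lemma nth_flatten:
  "p < length xs \<Longrightarrow> concat (map (\<lambda>(v, k). [v, k]) xs) ! (2 * p) = fst (xs ! p) \<and>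
    concat (map (\<lambda>(v, k). [v, k]) xs) ! Suc (2 * p) = snd (xs ! p)"
proof (induction xs arbitrary: p)
  case (Cons x xs)
  then show ?case by (cases p; cases x) auto
qed simp

lemma length_flatten: "length (concat (map (\<lambda>(v, k). [v, k]) xs)) = 2 * length xs"
  by (induction xs) auto

definition start :: "(nat \<times> nat) list list \<Rightarrow> nat \<Rightarrow> nat" where
  "start A u = 2 + length A + 2 * length (concat (take u A))"

lemma encode_graph_nth:
  shows "length (encode_graph A) = start A (length A)"
    and "encode_graph A ! 0 = length A"
    and "u \<le> length A \<Longrightarrow> encode_graph A ! Suc u = start A u"
    and "u < length A \<Longrightarrow> i < length (A ! u) \<Longrightarrow> encode_graph A ! (start A u + 2 * i) = fst (A ! u ! i)"
    and "u < length A \<Longrightarrow> i < length (A ! u) \<Longrightarrow> encode_graph A ! Suc (start A u + 2 * i) = snd (A ! u ! i)"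
proof -
  define hd where "hd = map (\<lambda>u. 2 + length A + 2 * length (concat (take u A))) [0..<Suc (length A)]"
  define tl where "tl = concat (map (\<lambda>(v, k). [v, k]) (concat A))"
  have e: "encode_graph A = length A # hd @ tl" by (simp add: encode_graph_def hd_def tl_def)
  have lh: "length hd = Suc (length A)" by (simp add: hd_def)
  show "length (encode_graph A) = start A (length A)"
    by (simp add: e lh tl_def length_flatten start_def)
  show "encode_graph A ! 0 = length A" by (simp add: e)
  show "u \<le> length A \<Longrightarrow> encode_graph A ! Suc u = start A u"
    by (simp add: e nth_append lh) (simp add: hd_def start_def nth_append del: upt_Suc)
  assume u: "u < length A" "i < length (A ! u)"
  define p where "p = length (concat (take u A)) + i"
  have p: "p < length (concat A)"
    using length_concat_take[OF u(1)] length_concat_take_le[of "Suc u" A] u(2) by (simp add: p_def)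
  have c: "concat A ! p = A ! u ! i" unfolding p_def by (rule nth_concat_take[OF u])
  have s: "start A u + 2 * i = Suc (Suc (length A) + 2 * p)" by (simp add: start_def p_def)
  show "encode_graph A ! (start A u + 2 * i) = fst (A ! u ! i)"
    unfolding s e using nth_flatten[OF p] c by (simp add: nth_append lh tl_def)
  have s: "Suc (start A u + 2 * i) = Suc (Suc (length A) + Suc (2 * p))" by (simp add: start_def p_def)
  show "encode_graph A ! Suc (start A u + 2 * i) = snd (A ! u ! i)"
    unfolding s e using nth_flatten[OF p] c by (simp add: nth_append lh tl_def)
qed

lemma start_Suc: "u < length A \<Longrightarrow> start A (Suc u) = start A u + 2 * length (A ! u)"
  by (simp add: start_def length_concat_take)

lemma start_le: "start A u \<le> start A (length A)"
  using length_concat_take_le[of u A] by (simp add: start_def)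

definition prep_entry :: prog where
  "prep_entry =
    (Asg vY (Rd 0 (V vJ)) ;; Asg vK (Rd 0 (V vJ .+ N 1)) ;; St aW (V vI .* V vN .+ V vY) (V vK) ;;
     Asg qV (V vK .* V vN .+ V vY) ;; Asg vJ (V vJ .+ N 2) ;; tset (V vY) (V qV))"

lemma prep_entry_sets [simp]:
  "wv prep_entry = {vY, vK, qV, vJ, tI, tA, tB}" "wa prep_entry = {aW, aT}" "parr prep_entry = {0, aW, aT}"
  by (auto simp: prep_entry_def)

definition prep_fill :: prog where
  "prep_fill =
    (Asg vJ (Rd 0 (V vI .+ N 1)) ;; Asg vEnd (Rd 0 (V vI .+ N 2)) ;;
     WH CLess (V vJ) (V vEnd) prep_entry)"

lemma prep_fill_sets [simp]:
  "wv prep_fill = {vY, vK, qV, vJ, vEnd, tI, tA, tB}" "wa prep_fill = {aW, aT}"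
  "parr prep_fill = {0, aW, aT}"
  by (auto simp: prep_fill_def)

definition prep_pop :: prog where
  "prep_pop =
    (Asg vY (Rd aT (N 1) .- Rd aT (N 1) .div V vN .* V vN) ;;
     St aNb (V vI .* V vN .+ V vJ) (V vY .+ N 1) ;; Asg vJ (V vJ .+ N 1) ;; tset (V vY) (N 0))"

lemma prep_pop_sets [simp]:
  "wv prep_pop = {vY, vJ, tI, tA, tB}" "wa prep_pop = {aNb, aT}" "parr prep_pop = {aNb, aT}"
  by (auto simp: prep_pop_def)

text \<open>Sorting by repeated extraction of the minimum from the tournament, which
  \<open>prep_fill\<close> has loaded with the neighbours of \<open>vI\<close>. Deleting each
  minimum leaves the tournament empty for the next vertex.\<close>

definition prep_sort :: prog where
  "prep_sort = (Asg vJ (N 0) ;; WH CNeq (Rd aT (N 1)) (N 0) prep_pop)"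

lemma prep_sort_sets [simp]:
  "wv prep_sort = {vY, vJ, tI, tA, tB}" "wa prep_sort = {aNb, aT}" "parr prep_sort = {aNb, aT}"
  by (auto simp: prep_sort_def)

text \<open>Work is done per list entry only, O(m log n + n) in all: matrix and rows are correct
  elsewhere because unwritten cells are 0.\<close>

definition prep :: prog where
  "prep = (Asg vN (Rd 0 (N 0)) ;; FOR vI vN (prep_fill ;; prep_sort))"

lemma prep_sets [simp]:
  "wv prep = {vN, vI, vY, vK, qV, vJ, vEnd, tI, tA, tB}" "wa prep = {aW, aT, aNb}"
  "parr prep = {0, aW, aT, aNb}"
  by (auto simp: prep_def)

locale ram_input = ram_graph n E w M H F lg for n E w M H F lg +
  fixes A :: "(nat \<times> nat) list list"
  assumes adj: "adjacency_lists n E w A"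
    and F_len: "F = length (encode_graph A)"
begin

section \<open>Filling the matrix and sorting the lists\<close>

definition input :: "hst \<Rightarrow> bool" where
  "input s \<longleftrightarrow> (\<forall>i<F. ar s 0 i = encode_graph A ! i)"

definition nbrs :: "nat \<Rightarrow> nat set" where
  "nbrs u = {y. {u, y} \<in> E}"

lemma lenA: "length A = n"
  using adj by (simp add: adjacency_lists_def)

lemma adjD:
  assumes "u < n"
  shows "distinct (A ! u)" "set (A ! u) = (\<lambda>y. (y, w {u, y})) ` nbrs u"
  using adj assms by (auto simp: adjacency_lists_def nbrs_def)

lemma nbrs_lt: "y \<in> nbrs u \<Longrightarrow> y < n" "y \<in> nbrs u \<Longrightarrow> {u, y} \<in> E"
  using edgeD by (auto simp: nbrs_def)

lemma nbrs_card: "u < n \<Longrightarrow> card (nbrs u) = length (A ! u) \<and> card (nbrs u) < n"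
proof -
  assume u: "u < n"
  have "card (set (A ! u)) = card (nbrs u)" unfolding adjD(2)[OF u] by (intro card_image inj_onI) auto
  moreover have "nbrs u \<subseteq> {..<n} - {u}" using edgeD by (auto simp: nbrs_def)
  then have "card (nbrs u) \<le> card ({..<n} - {u})" by (intro card_mono) auto
  ultimately show ?thesis using distinct_card[OF adjD(1)[OF u]] u by simp
qed

lemma inputD:
  assumes "input s"
  shows "ar s 0 0 = n" "u \<le> n \<Longrightarrow> ar s 0 (Suc u) = start A u"
    "u < n \<Longrightarrow> i < length (A ! u) \<Longrightarrow> ar s 0 (start A u + 2 * i) = fst (A ! u ! i)"
    "u < n \<Longrightarrow> i < length (A ! u) \<Longrightarrow> ar s 0 (Suc (start A u + 2 * i)) = snd (A ! u ! i)"
    "u < n \<Longrightarrow> i < length (A ! u) \<Longrightarrow> Suc (start A u + 2 * i) < F" "Suc n < F" "F \<le> 2 + n + 2 * (n * n)"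
proof -
  have Fs: "F = start A n" using F_len encode_graph_nth(1) lenA by simp
  show F2: "Suc n < F" unfolding Fs by (simp add: start_def lenA)
  have lt: "Suc (start A u + 2 * i) < F" if "u < n" "i < length (A ! u)" for u i
    using start_Suc[of u A] start_le[of A "Suc u"] that by (simp add: Fs lenA)
  show "ar s 0 0 = n" using assms F2 encode_graph_nth(2)[of A] lenA by (simp add: input_def)
  show "u \<le> n \<Longrightarrow> ar s 0 (Suc u) = start A u"
    using assms F2 encode_graph_nth(3)[of u A] lenA by (simp add: input_def)
  show "u < n \<Longrightarrow> i < length (A ! u) \<Longrightarrow> ar s 0 (start A u + 2 * i) = fst (A ! u ! i)"
    using assms lt[of u i] encode_graph_nth(4)[of u A i] lenA by (simp add: input_def)
  show "u < n \<Longrightarrow> i < length (A ! u) \<Longrightarrow> ar s 0 (Suc (start A u + 2 * i)) = snd (A ! u ! i)"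
    using assms lt[of u i] encode_graph_nth(5)[of u A i] lenA by (simp add: input_def)
  show "u < n \<Longrightarrow> i < length (A ! u) \<Longrightarrow> Suc (start A u + 2 * i) < F" by (rule lt)
  have "length (concat A) = (\<Sum>u<n. length (A ! u))"
    by (simp add: length_concat sum_list_sum_nth lenA atLeast0LessThan)
  also have "\<dots> \<le> (\<Sum>u<n. n)" by (intro sum_mono) (use nbrs_card in \<open>force intro: less_imp_le\<close>)
  finally show "F \<le> 2 + n + 2 * (n * n)" by (simp add: Fs start_def lenA)
qed

lemma F_H: "F < H"
proof -
  \<comment> \<open>The bound on \<open>F\<close> does not depend on the state, so any state that
    holds the input can be used to read it off \<open>inputD\<close>.\<close>
  have s: "input (Hst (\<lambda>_. 0) (\<lambda>_ i. encode_graph A ! i))" by (simp add: input_def)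
  have "F \<le> 2 + n + 2 * (n * n)" by (rule inputD(7)[OF s])
  also have "\<dots> < 8 * ((n + 1) * (n + 1) * (M + 1))" by (simp add: algebra_simps)
  finally show ?thesis using H by simp
qed

lemma wp_prep_fill:
  assumes i: "input s" and u: "vr s vI = u" "u < n" and N: "vr s vN = n" and t: "tourn n (ar s aT)"
    and z: "\<And>x. x < n \<Longrightarrow> ar s aT (n + x) = 0"
  shows "wp H F prep_fill (\<lambda>t s'. t \<le> (8 * lg + 10) * length (A ! u) + 3 \<and> tourn n (ar s' aT) \<and>
    (\<forall>y<n. ar s' aT (n + y) = (if y \<in> nbrs u then w {u, y} * n + y else 0)) \<and>
    (\<forall>x<n. \<forall>y<n. ar s' aW (x * n + y) = (if x = u \<and> y \<in> nbrs u then w {u, y} else ar s aW (x * n + y)))) s"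
proof -
  define R where "R = (\<lambda>i. fst ` set (take i (A ! u)))"
  define d where "d = length (A ! u)"
  have Rd: "R d = nbrs u" using adjD(2)[OF u(2)] by (auto simp: R_def d_def image_image)
  note I1 = inputD[OF i]
  define I where "I = (\<lambda>t s'. \<exists>i\<le>d. vr s' vJ = start A u + 2 * i \<and> t \<le> (8 * lg + 10) * i \<and> vr s' vN = n \<and>
    vr s' vI = u \<and> vr s' vEnd = start A (Suc u) \<and> ar s' 0 = ar s 0 \<and> tourn n (ar s' aT) \<and>
    (\<forall>y<n. ar s' aT (n + y) = (if y \<in> R i then w {u, y} * n + y else 0)) \<and>
    (\<forall>x<n. \<forall>y<n. ar s' aW (x * n + y) = (if x = u \<and> y \<in> R i then w {u, y} else ar s aW (x * n + y))))"
  have bu: "Suc u < H" "Suc (Suc u) < H" using u(2) by (auto intro!: bnd_sum)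
  have uF: "Suc u < F" "Suc (Suc u) < F" using I1(6) u(2) by auto
  have us: "start A (Suc u) = start A u + 2 * d" using start_Suc[of u A] lenA u(2) by (simp add: d_def)
  show ?thesis
    unfolding prep_fill_def
    apply (simp add: wp_eqs u bu uF I1(2)[of u] I1(2)[of "Suc u"] less_imp_le Suc_le_eq)
    apply (rule wp_WH[where I = I and m = "\<lambda>s. start A (Suc u) - vr s vJ"])
    subgoal using u N t z by (auto simp: I_def R_def intro!: exI[of _ 0])
    subgoal by simp
    subgoal premises p for t s2
    proof -
      obtain i where i: "i \<le> d" "vr s2 vJ = start A u + 2 * i" "t \<le> (8 * lg + 10) * i" "vr s2 vN = n"
        "vr s2 vI = u" "vr s2 vEnd = start A (Suc u)" "ar s2 0 = ar s 0" "tourn n (ar s2 aT)"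
        and T: "\<And>y. y < n \<Longrightarrow> ar s2 aT (n + y) = (if y \<in> R i then w {u, y} * n + y else 0)"
        and Wm: "\<And>x y. x < n \<Longrightarrow> y < n \<Longrightarrow> ar s2 aW (x * n + y) =
          (if x = u \<and> y \<in> R i then w {u, y} else ar s aW (x * n + y))"
        using p(1) unfolding I_def by blast
      have id: "i < d" using p(2) i us by simp
      define y where "y = fst (A ! u ! i)"
      have mem: "A ! u ! i \<in> set (A ! u)" using id by (simp add: d_def)
      then have y: "y \<in> nbrs u" "snd (A ! u ! i) = w {u, y}" using adjD(2)[OF u(2)] by (auto simp: y_def)
      have yn: "y < n" by (rule nbrs_lt[OF y(1)])
      have RS: "R (Suc i) = insert y (R i)"
        using id by (simp add: R_def d_def take_Suc_conv_app_nth y_def)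
      have wM: "w {u, y} \<le> M" using weights[OF nbrs_lt(2)[OF y(1)]] by simp
      have M1: "M \<le> M * n + M" by simp
      have b: "w {u, y} * n < H" "w {u, y} * n + y < H" "u * n < H" "u * n + y < H"
        "Suc (start A u + 2 * i) < H" "Suc (Suc (start A u + 2 * i)) < H" "start A u + 2 * i < F" "Suc (start A u + 2 * i) < F"
        using bnd_key[of "w {u, y}" y] bnd_key[of "w {u, y}" 0] wM yn u(2) bnd_prod[of u] bnd_sq[of u y]
          I1(5)[OF u(2), of i] id F_H by (auto simp: d_def)
      have rd: "ar s 0 (start A u + 2 * i) = y" "ar s 0 (Suc (start A u + 2 * i)) = w {u, y}"
        using I1(3,4)[OF u(2), of i] id y by (simp_all add: d_def y_def)
      show ?thesis
        unfolding prep_entry_def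
        apply (simp add: wp_eqs i(2,4,5,7) rd b)
        apply (rule wp_tset)
        apply (simp_all add: i(4,8) yn)
        subgoal premises q for t3 s3
        proof -
          have Rn: "R (Suc i) = insert y (R i)" by (rule RS)
          have "I T s3" if TT: "T \<le> t + t3 + 7" for T
            unfolding I_def
          proof (intro exI[of _ "Suc i"] conjI allI impI)
            show "Suc i \<le> d" using id by simp
            show "vr s3 vJ = start A u + 2 * Suc i" using q i by simp
            show "T \<le> (8 * lg + 10) * Suc i" using q(1) i(3) TT by simp
            fix x assume "x < n"
            then show "ar s3 aT (n + x) = (if x \<in> R (Suc i) then w {u, x} * n + x else 0)"
              using q(3)[of x] T[of x] Rn by auto
            fix y' assume "y' < n"
            then show "ar s3 aW (x * n + y') = (if x = u \<and> y' \<in> R (Suc i) then w {u, y'} else ar s aW (x * n + y'))"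
              using q Wm[OF \<open>x < n\<close>, of y'] Rn yn by (auto simp: row_index_inj)
          qed (use q i in simp_all)
          moreover have "vr s3 vJ = start A u + 2 * i + 2" using q i by simp
          ultimately show ?thesis using id us by simp
        qed
        done
    qed
    subgoal premises p for t s2
    proof -
      obtain i where i: "i \<le> d" "vr s2 vJ = start A u + 2 * i" "t \<le> (8 * lg + 10) * i"
        "vr s2 vEnd = start A (Suc u)" "tourn n (ar s2 aT)"
        "\<forall>y<n. ar s2 aT (n + y) = (if y \<in> R i then w {u, y} * n + y else 0)"
        "\<forall>x<n. \<forall>y<n. ar s2 aW (x * n + y) = (if x = u \<and> y \<in> R i then w {u, y} else ar s aW (x * n + y))"
        using p(1) unfolding I_def by blast
      have "i = d" using i p(2) us by simp
      then show ?thesis using i Rd by (simp add: d_def)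
    qed
    done
qed

definition sorted_nbrs :: "nat \<Rightarrow> nat list \<Rightarrow> bool" where
  "sorted_nbrs u l \<longleftrightarrow> distinct l \<and> set l = nbrs u \<and>
     (\<forall>i j. i \<le> j \<longrightarrow> j < length l \<longrightarrow> w {u, l ! i} \<le> w {u, l ! j})"

text \<open>The extracted list is sorted because it lies below everything still in the tournament.
  Fewer than \<open>n\<close> entries are written into a row of zeros, so the terminating 0 is
  present.\<close>

lemma wp_prep_sort:
  assumes u: "vr s vI = u" "u < n" and N: "vr s vN = n" and t: "tourn n (ar s aT)"
    and z: "\<And>y. y < n \<Longrightarrow> ar s aT (n + y) = (if y \<in> nbrs u then w {u, y} * n + y else 0)"
    and nb: "\<And>i. i < n \<Longrightarrow> ar s aNb (u * n + i) = 0"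
  shows "wp H F prep_sort (\<lambda>t s'. t \<le> (8 * lg + 8) * length (A ! u) + 2 \<and> tourn n (ar s' aT) \<and>
    (\<forall>y<n. ar s' aT (n + y) = 0) \<and> (\<exists>l. sorted_nbrs u l \<and> (\<forall>x<n. \<forall>i<n. ar s' aNb (x * n + i) =
      (if x = u then if i < length l then Suc (l ! i) else 0 else ar s aNb (x * n + i))))) s"
proof -
  define I where "I = (\<lambda>t s'. \<exists>l. length l = vr s' vJ \<and> t \<le> (8 * lg + 8) * length l \<and> vr s' vN = n \<and>
    vr s' vI = u \<and> tourn n (ar s' aT) \<and> distinct l \<and> set l \<subseteq> nbrs u \<and>
    (\<forall>i j. i \<le> j \<longrightarrow> j < length l \<longrightarrow> w {u, l ! i} \<le> w {u, l ! j}) \<and>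
    (\<forall>y\<in>set l. \<forall>z\<in>nbrs u - set l. w {u, y} \<le> w {u, z}) \<and>
    (\<forall>y<n. ar s' aT (n + y) = (if y \<in> nbrs u - set l then w {u, y} * n + y else 0)) \<and>
    (\<forall>x<n. \<forall>i<n. ar s' aNb (x * n + i) =
      (if x = u then if i < length l then Suc (l ! i) else 0 else ar s aNb (x * n + i))))"
  have nbf: "finite (nbrs u)" by (rule finite_subset[of _ "{..<n}"]) (use nbrs_lt in auto)
  show ?thesis
    unfolding prep_sort_def
    apply (simp add: wp_eqs)
    apply (rule wp_WH[where I = I and m = "\<lambda>s. n - vr s vJ"])
    subgoal using u N t z nb by (auto simp: I_def intro!: exI[of _ "[]"])
    subgoal by simp
    subgoal premises p for t s2
    proof -
      obtain l where l: "length l = vr s2 vJ" "t \<le> (8 * lg + 8) * length l" "vr s2 vN = n" "vr s2 vI = u"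
        "tourn n (ar s2 aT)" "distinct l" "set l \<subseteq> nbrs u"
        and srt: "\<And>i j. i \<le> j \<Longrightarrow> j < length l \<Longrightarrow> w {u, l ! i} \<le> w {u, l ! j}"
        and lo: "\<And>y z. y \<in> set l \<Longrightarrow> z \<in> nbrs u - set l \<Longrightarrow> w {u, y} \<le> w {u, z}"
        and T: "\<And>y. y < n \<Longrightarrow> ar s2 aT (n + y) = (if y \<in> nbrs u - set l then w {u, y} * n + y else 0)"
        and Nb: "\<And>x i. x < n \<Longrightarrow> i < n \<Longrightarrow> ar s2 aNb (x * n + i) =
          (if x = u then if i < length l then Suc (l ! i) else 0 else ar s aNb (x * n + i))"
        using p(1) unfolding I_def by blast
      have T1: "ar s2 aT 1 \<noteq> 0" using p(2) by simp
      obtain y where y: "y < n" "ar s2 aT 1 = ar s2 aT (n + y)"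
        using tourn_attained[OF l(5), of 1] T1 n_pos by auto
      then have yn: "y \<in> nbrs u" "y \<notin> set l" and T1y: "ar s2 aT (Suc 0) = w {u, y} * n + y"
        using T[OF y(1)] T1 by (auto split: if_splits)
      have mi: "w {u, y} \<le> w {u, x}" if x: "x \<in> nbrs u - set l" for x
      proof -
        have xn: "x < n" "0 < w {u, x}" using nbrs_lt[of x u] x weight_pos[of u x] by auto
        have "ar s2 aT (n + x) = w {u, x} * n + x" using T[OF xn(1)] x by simp
        then have "w {u, y} * n + y \<le> w {u, x} * n + x"
          using tourn_lower[OF l(5), of "n + x"] xn n_pos T1y by simp
        from div_le_mono[OF this, of n] show ?thesis using y(1) xn(1) by simp
      qed
      have len: "length l < n"
        using card_mono[OF nbf l(7)] distinct_card[OF l(6)] nbrs_card[OF u(2)] by simp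
      have b: "w {u, y} * n < H" "u * n < H" "u * n + vr s2 vJ < H" "Suc y < H" "Suc (vr s2 vJ) < H"
        using bnd_key[of "w {u, y}" 0] weights[OF nbrs_lt(2)[OF yn(1)]] bnd_prod[of u] bnd_sq[of u "vr s2 vJ"]
          u(2) y(1) len l(1) by (auto intro!: bnd_sum)
      have ar: "(w {u, y} * n + y) div n = w {u, y}" using y(1) by simp
      show ?thesis
        unfolding prep_pop_def
        apply (simp add: wp_eqs T1y l(3,4) ar b)
        apply (rule wp_tset)
        apply (simp_all add: l(3,5) y(1))
        subgoal premises q for t3 s3
        proof -
          have "I T s3" if TT: "T \<le> t + t3 + 5" for T
            unfolding I_def
          proof (intro exI[of _ "l @ [y]"] conjI allI impI ballI)
            show "length (l @ [y]) = vr s3 vJ" using q l by simp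
            show "T \<le> (8 * lg + 8) * length (l @ [y])" using q(1) l(2) TT by simp
            show "distinct (l @ [y])" using l yn by simp
            show "set (l @ [y]) \<subseteq> nbrs u" using l yn by simp
            show "w {u, (l @ [y]) ! i} \<le> w {u, (l @ [y]) ! j}" if "i \<le> j" "j < length (l @ [y])" for i j
            proof (cases "j < length l")
              case True
              then show ?thesis using that srt by (simp add: nth_append)
            next
              case False
              then have "j = length l" using that by simp
              then show ?thesis using that lo[of "l ! i" y] yn by (auto simp: nth_append)
            qed
            show "w {u, a} \<le> w {u, b}" if "a \<in> set (l @ [y])" "b \<in> nbrs u - set (l @ [y])" for a b
              using that lo mi by auto
            fix x assume x: "x < n"
            show "ar s3 aT (n + x) = (if x \<in> nbrs u - set (l @ [y]) then w {u, x} * n + x else 0)"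
              using q(3)[OF x] T[OF x] by auto
            fix i assume i: "i < n"
            have f3: "ar s3 aNb = (ar s2 aNb)(u * n + vr s2 vJ := Suc y)" using q by simp
            show "ar s3 aNb (x * n + i) =
              (if x = u then if i < length (l @ [y]) then Suc ((l @ [y]) ! i) else 0 else ar s aNb (x * n + i))"
              unfolding f3 using Nb[OF x i] i len l(1) by (auto simp: row_index_inj nth_append less_Suc_eq)
          qed (use q l in simp_all)
          moreover have "vr s3 vJ = Suc (vr s2 vJ)" using q by simp
          ultimately show ?thesis using len l(1) by simp
        qed
        done
    qed
    subgoal premises p for t s2
    proof -
      obtain l where l: "t \<le> (8 * lg + 8) * length l" "tourn n (ar s2 aT)" "distinct l" "set l \<subseteq> nbrs u"
        and srt: "\<forall>i j. i \<le> j \<longrightarrow> j < length l \<longrightarrow> w {u, l ! i} \<le> w {u, l ! j}"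
        and T: "\<forall>y<n. ar s2 aT (n + y) = (if y \<in> nbrs u - set l then w {u, y} * n + y else 0)"
        and Nb: "\<forall>x<n. \<forall>i<n. ar s2 aNb (x * n + i) =
          (if x = u then if i < length l then Suc (l ! i) else 0 else ar s aNb (x * n + i))"
        using p(1) unfolding I_def by blast
      have T1: "ar s2 aT 1 = 0" using p(2) by simp
      have z0: "ar s2 aT (n + y) = 0" if "y < n" for y
        using tourn_lower[OF l(2), of "n + y"] T1 that n_pos by force
      have "nbrs u \<subseteq> set l"
      proof
        fix y assume y: "y \<in> nbrs u"
        have "y < n" "0 < w {u, y}" using nbrs_lt[OF y] weight_pos by auto
        then show "y \<in> set l" using z0[of y] T y n_pos by (auto split: if_splits)
      qed
      with l have s: "set l = nbrs u" by blast
      then have "length l = length (A ! u)" using distinct_card[OF l(3)] nbrs_card[OF u(2)] by simp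
      moreover have "sorted_nbrs u l" using l s srt by (simp add: sorted_nbrs_def)
      ultimately show ?thesis using l z0 Nb by auto
    qed
    done
qed

text \<open>The handshake bound: an ordered pair is recovered from its edge and one bit telling
  which end is smaller.\<close>

lemma sum_degrees: "(\<Sum>u<n. length (A ! u)) \<le> 2 * card E"
proof -
  have finE: "finite E" using simple by (auto simp: simple_graph_def intro: finite_subset[of _ "Pow {..<n}"])
  have "(\<Sum>u<n. length (A ! u)) = (\<Sum>u<n. card (nbrs u))" using nbrs_card by simp
  also have "\<dots> = card (SIGMA u:{..<n}. nbrs u)"
  proof -
    have "finite (nbrs u)" for u by (rule finite_subset[of _ "{..<n}"]) (use nbrs_lt in auto)
    then show ?thesis by simp
  qed
  also have "\<dots> \<le> card (E \<times> (UNIV :: bool set))"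
  proof (rule card_inj_on_le[where f = "\<lambda>(u, y). ({u, y}, u < y)"])
    have "y \<noteq> u" if "y \<in> nbrs u" for u y using edgeD[OF nbrs_lt(2)[OF that]] by blast
    then show "inj_on (\<lambda>(u, y). ({u, y}, u < y)) (SIGMA u:{..<n}. nbrs u)"
      by (force simp: inj_on_def doubleton_eq_iff)
    show "(\<lambda>(u, y). ({u, y}, u < y)) ` (SIGMA u:{..<n}. nbrs u) \<subseteq> E \<times> UNIV"
      by (auto simp: nbrs_def)
  qed (use finE in simp)
  finally show ?thesis by (simp add: card_cartesian_product)
qed

text \<open>Ties between equal weights are settled by the run, so the sorted lists are not fixed in
  advance; the locale parameter \<open>srt\<close> appears existentially and is chosen from the
  final memory.\<close>

lemma wp_prep:
  assumes i: "input s" and z: "\<And>a i. a \<noteq> 0 \<Longrightarrow> ar s a i = 0"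
  shows "wp H F prep (\<lambda>t s'. t \<le> (16 * lg + 18) * (2 * card E) + 7 * n + 3 \<and>
    (\<exists>srt. ram_search n E w M H F lg srt \<and> ram_search.clean n E w srt s')) s"
proof -
  have n0: "ar s 0 0 = n" by (rule inputD[OF i])
  define I where "I = (\<lambda>k t s'. t \<le> (16 * lg + 18) * (\<Sum>u<k. length (A ! u)) + 7 * k \<and> input s' \<and> vr s' vN = n \<and>
    tourn n (ar s' aT) \<and> (\<forall>x<n. ar s' aT (n + x) = 0 \<and> ar s' aVis x = 0) \<and>
    (\<forall>x<n. \<forall>y<n. ar s' aW (x * n + y) = (if x < k \<and> {x, y} \<in> E then w {x, y} else 0)) \<and>
    (\<forall>x<n. k \<le> x \<longrightarrow> (\<forall>i<n. ar s' aNb (x * n + i) = 0)) \<and>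
    (\<forall>x<n. x < k \<longrightarrow> (\<exists>l. sorted_nbrs x l \<and>
      (\<forall>i<n. ar s' aNb (x * n + i) = (if i < length l then Suc (l ! i) else 0)))))"
  have nH: "n < H" by (rule bnd_sum) simp
  have loop: "wp H F (FOR vI vN (prep_fill ;; prep_sort)) (\<lambda>t s'. I n (t - 2) s') (setv vN n s)"
  proof (rule wp_FOR[where n = n and I = I])
    show "I 0 0 (setv vI 0 (setv vN n s))"
      using i z by (auto simp: I_def input_def intro: tourn_zero)
    fix u t :: nat and s2 :: hst
    assume u: "u < n" and I: "I u t s2" and iv: "vr s2 vI = u" "vr s2 vN = n"
    have t: "t \<le> (16 * lg + 18) * (\<Sum>u<u. length (A ! u)) + 7 * u" and inp: "input s2"
      and T: "tourn n (ar s2 aT)" and "\<forall>x<n. ar s2 aT (n + x) = 0 \<and> ar s2 aVis x = 0"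
      and "\<forall>x<n. \<forall>y<n. ar s2 aW (x * n + y) = (if x < u \<and> {x, y} \<in> E then w {x, y} else 0)"
      and "\<forall>x<n. u \<le> x \<longrightarrow> (\<forall>i<n. ar s2 aNb (x * n + i) = 0)"
      and "\<forall>x<n. x < u \<longrightarrow> (\<exists>l. sorted_nbrs x l \<and>
        (\<forall>i<n. ar s2 aNb (x * n + i) = (if i < length l then Suc (l ! i) else 0)))"
      using I unfolding I_def by - (elim conjE, assumption)+
    note I1 = this(4-7)
    have T0: "ar s2 aT (n + x) = 0 \<and> ar s2 aVis x = 0" if "x < n" for x
      using I1(1)[rule_format, OF that] .
    have Wm: "ar s2 aW (x * n + y) = (if x < u \<and> {x, y} \<in> E then w {x, y} else 0)"
      if "x < n" "y < n" for x y using I1(2)[rule_format, OF that] .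
    have Nb0: "ar s2 aNb (x * n + i) = 0" if "x < n" "u \<le> x" "i < n" for x i
      using I1(3)[rule_format, OF that] .
    have Nb: "\<exists>l. sorted_nbrs x l \<and>
        (\<forall>i<n. ar s2 aNb (x * n + i) = (if i < length l then Suc (l ! i) else 0))"
      if "x < n" "x < u" for x using I1(4) that by (elim allE impE)
    show "wp H F (prep_fill ;; prep_sort) (\<lambda>t' s'. I (Suc u) (t + t' + 2) (setv vI (Suc u) s')) s2"
      apply (rule wp_Sq, rule wp_conseq, rule wp_prep_fill[OF inp iv(1) u iv(2) T])
       apply (use T0 in blast)
      subgoal premises p for t3 s3
      proof -
        have f3: "vr s3 vI = u" "vr s3 vN = n" "ar s3 aNb = ar s2 aNb" "ar s3 0 = ar s2 0" "ar s3 aVis = ar s2 aVis"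
          using p iv by simp_all
        show ?thesis
          apply (rule wp_conseq, rule wp_prep_sort[OF f3(1) u f3(2)])
          subgoal using p by blast
          subgoal using p by blast
          subgoal using Nb0[OF u] by (simp add: f3)
          subgoal premises q for t4 s4
          proof -
            have f4: "vr s4 vN = n" "ar s4 0 = ar s2 0" "ar s4 aVis = ar s2 aVis" "ar s4 aW = ar s3 aW"
              using q f3 by simp_all
            obtain l where l: "sorted_nbrs u l" and Nb4: "\<And>x i. x < n \<Longrightarrow> i < n \<Longrightarrow> ar s4 aNb (x * n + i) =
              (if x = u then if i < length l then Suc (l ! i) else 0 else ar s2 aNb (x * n + i))"
              using q(1) unfolding f3 by blast
            have t34: "t3 \<le> (8 * lg + 10) * length (A ! u) + 3" "t4 \<le> (8 * lg + 8) * length (A ! u) + 2"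
              using p q by blast+
            have W4: "ar s4 aW (x * n + y) = (if x < Suc u \<and> {x, y} \<in> E then w {x, y} else 0)"
              if "x < n" "y < n" for x y
            proof -
              have "ar s3 aW (x * n + y) = (if x = u \<and> y \<in> nbrs u then w {u, y} else ar s2 aW (x * n + y))"
                using p(1) that by blast
              then show ?thesis unfolding f4 using Wm[OF that]
                by (cases "x = u") (auto simp: nbrs_def less_Suc_eq)
            qed
            have Nb': "\<exists>l. sorted_nbrs x l \<and>
              (\<forall>i<n. ar s4 aNb (x * n + i) = (if i < length l then Suc (l ! i) else 0))" if "x < n" "x < Suc u" for x
            proof (cases "x = u")
              case True
              then show ?thesis using l Nb4 u by auto
            next
              case False
              then show ?thesis using Nb[of x] that Nb4[of x] by auto
            qed
            have "I (Suc u) (t + (t3 + t4) + 2) s4"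
              unfolding I_def
            proof (intro conjI allI impI)
              show "t + (t3 + t4) + 2 \<le> (16 * lg + 18) * (\<Sum>u<Suc u. length (A ! u)) + 7 * Suc u"
                using t t34 by (simp add: algebra_simps)
              show "input s4" using inp by (simp add: input_def f4)
              show "ar s4 aNb (x * n + i) = 0" if "x < n" "Suc u \<le> x" "i < n" for x i
                using Nb4[of x i] Nb0[of x i] that by auto
            qed (use f4 q T0 W4 Nb' in simp_all)
            then show ?thesis by (simp add: I_def input_def add_ac)
          qed
          done
      qed
      done
  qed (use nH in auto)
  show ?thesis
    unfolding prep_def
    apply (use inputD(6)[OF i] in \<open>simp add: wp_eqs n0\<close>)
    apply (rule wp_conseq, rule loop)
    subgoal premises p for t s2
    proof -
      have I: "I n (t - 2) s2" using p by blast
      have N: "vr s2 vN = n" and T: "tourn n (ar s2 aT)"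
        and T0: "\<forall>x<n. ar s2 aT (n + x) = 0 \<and> ar s2 aVis x = 0"
        and Wm: "\<forall>x<n. \<forall>y<n. ar s2 aW (x * n + y) = (if x < n \<and> {x, y} \<in> E then w {x, y} else 0)"
        and ex: "\<forall>x<n. x < n \<longrightarrow> (\<exists>l. sorted_nbrs x l \<and>
          (\<forall>i<n. ar s2 aNb (x * n + i) = (if i < length l then Suc (l ! i) else 0)))"
        and t: "t - 2 \<le> (16 * lg + 18) * (\<Sum>u<n. length (A ! u)) + 7 * n"
        using I unfolding I_def by - (elim conjE, assumption)+
      \<comment> \<open>From here on the rows of \<open>aNb\<close> define the order in which edges
        are scanned.\<close>
      from ex obtain srt where srt: "\<And>x. x < n \<Longrightarrow> sorted_nbrs x (srt x)"
        "\<And>x i. x < n \<Longrightarrow> i < n \<Longrightarrow> ar s2 aNb (x * n + i) = (if i < length (srt x) then Suc (srt x ! i) else 0)"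
        by metis
      interpret S: ram_search n E w M H F lg srt
        by unfold_locales (use srt(1) in \<open>auto simp: sorted_nbrs_def nbrs_def\<close>)
      have "S.stat s2" unfolding S.stat_def S.active_def using N Wm srt(2) by simp
      then have "S.clean s2" unfolding S.clean_def using T T0 by blast
      moreover have "t \<le> (16 * lg + 18) * (2 * card E) + 7 * n + 2"
        using t mult_le_mono2[OF sum_degrees, of "16 * lg + 18"] by linarith
      ultimately show ?thesis using S.ram_search_axioms by auto
    qed
    done
qed

end

section \<open>The complete algorithm\<close>

text \<open>A linear search for the least positive integer whose cube is at least \<open>n\<close>;
  it takes about n^(1/3) rounds.\<close>

definition ball_size :: prog where
  "ball_size =
    (Asg vL (N 1) ;; WH CLess (V vL .* V vL .* V vL) (V vN) (Asg vL (V vL .+ N 1)) ;; Asg vBall (V vL))"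

lemma ball_size_sets [simp]: "wv ball_size = {vL, vBall}" "wa ball_size = {}" "parr ball_size = {}"
  by (auto simp: ball_size_def)

text \<open>Register 0 stays 0 and register 1 holds variable 0, which is \<open>vLen\<close>. By the
  output convention the cycle must therefore be copied to address 0, over the input.\<close>

definition emit :: prog where
  "emit = (Asg vLen (V vHi .- V vLo) ;; FOR vJ vLen (St 0 (V vJ) (Rd aCy (V vLo .+ V vJ))))"

lemma emit_sets [simp]: "wv emit = {vLen, vJ}" "wa emit = {0}" "parr emit = {0, aCy}"
  by (auto simp: emit_def)

definition girth_prog :: prog where
  "girth_prog = (prep ;; ball_size ;; balls ;; greedy ;; emit)"

lemma girth_prog_parr: "parr girth_prog \<subseteq> {..<16}"
  by (simp add: girth_prog_def)

context ram_graph
begin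

lemma wp_ball_size:
  assumes N: "vr s vN = n"
  shows "wp H F ball_size (\<lambda>t s'. 1 \<le> vr s' vL \<and> t \<le> 2 * vr s' vL + 4 \<and> vr s' vBall = vr s' vL \<and>
    n \<le> vr s' vL ^ 3 \<and> (vr s' vL = 1 \<or> (vr s' vL - 1) ^ 3 < n)) s"
proof -
  define I where "I = (\<lambda>t s'. vr s' vN = n \<and> 1 \<le> vr s' vL \<and> t \<le> 2 * vr s' vL \<and>
    (vr s' vL = 1 \<or> (vr s' vL - 1) ^ 3 < n))"
  \<comment> \<open>For \<open>L \<noteq> 1\<close>, \<open>L \<le> 2 * (L - 1)\<close> turns
    \<open>(L - 1) ^ 3 < n\<close> into a cube below 8 n, so the tested product still fits into a
    word.\<close>
  have b: "L * L * L < H" "L * L < H" if "1 \<le> L" "L = 1 \<or> (L - 1) ^ 3 < n" for L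
  proof -
    have "L * L * L \<le> 8 * n + 8"
    proof (cases "L = 1")
      case False
      with that have "L \<le> 2 * (L - 1)" "(L - 1) ^ 3 < n" by auto
      then have "L ^ 3 \<le> (2 * (L - 1)) ^ 3" by (intro power_mono) auto
      also have "\<dots> = 8 * (L - 1) ^ 3" by (simp add: power_mult_distrib)
      finally show ?thesis using \<open>(L - 1) ^ 3 < n\<close> by (simp add: power3_eq_cube)
    qed simp
    also have "\<dots> < 8 * ((n + 1) * (n + 1) * (M + 1))"
      using n_pos by (simp add: algebra_simps)
    finally show 1: "L * L * L < H" using H by simp
    have "L * L * 1 \<le> L * L * L" using that by (intro mult_le_mono2) simp
    then have "L * L \<le> L * L * L" by simp
    from this 1 show "L * L < H" by (rule le_less_trans)
  qed
  show ?thesis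
    unfolding ball_size_def
    apply (simp add: wp_eqs)
    apply (rule wp_WH[where I = I and m = "\<lambda>s. n - vr s vL"])
    subgoal using N by (simp add: I_def)
    subgoal for t s' using b[of "vr s' vL"] by (simp add: I_def)
    subgoal premises p for t s'
    proof -
      have I: "vr s' vN = n" "1 \<le> vr s' vL" "t \<le> 2 * vr s' vL" and c: "vr s' vL ^ 3 < n"
        using p by (simp_all add: I_def power3_eq_cube)
      have "vr s' vL \<le> vr s' vL ^ 3" using I(2) by (simp add: self_le_power)
      then have l: "vr s' vL < n" using c by simp
      then have "Suc (vr s' vL) < H" by (intro bnd_sum) simp
      then show ?thesis using I c l by (simp add: wp_eqs I_def)
    qed
    subgoal for t s' by (auto simp: wp_eqs I_def power3_eq_cube)
    done
qed

lemma cycle_length: "is_cycle E c \<Longrightarrow> length c \<le> n"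
proof -
  assume c: "is_cycle E c"
  have "set c \<subseteq> {..<n}"
    using cycle_edge[OF c] edgeD by (fastforce simp: in_set_conv_nth)
  from card_mono[OF _ this] show ?thesis using c distinct_card[of c] by (simp add: is_cycle_def)
qed

end

context ram_search
begin

lemma wp_emit:
  assumes s: "sound s"
  shows "wp H F emit (\<lambda>t s'. t \<le> 3 * n + 3 \<and> map (ar s' 0) [0..<vr s' vLen] = cyl s \<and> vr s' vLen \<le> n) s"
proof -
  define k where "k = vr s vHi - vr s vLo"
  have le: "vr s vLo \<le> vr s vHi" "vr s vHi \<le> 2 * n" using s by (auto simp: sound_def)
  have kn: "k \<le> n"
  proof (cases "vr s vBest = 0")
    case True
    then show ?thesis using s by (simp add: sound_def k_def)
  next
    case False
    then have "is_cycle E (cyl s)" using s by (simp add: sound_def)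
    from cycle_length[OF this] show ?thesis by (simp add: cyl_def k_def)
  qed
  have loop: "wp H F (FOR vJ vLen (St 0 (V vJ) (Rd aCy (V vLo .+ V vJ))))
    (\<lambda>t s'. t \<le> 3 * k + 2 \<and> (\<forall>i<k. ar s' 0 i = ar s aCy (vr s vLo + i)) \<and> vr s' vLen = k) (setv vLen k s)"
  proof (rule wp_FOR[where n = k and I = "\<lambda>j t s'. t \<le> 3 * j \<and> vr s' vLo = vr s vLo \<and> ar s' aCy = ar s aCy \<and>
      (\<forall>i<j. ar s' 0 i = ar s aCy (vr s vLo + i))"])
    fix j t :: nat and s2 :: hst
    assume j: "j < k" and I: "t \<le> 3 * j \<and> vr s2 vLo = vr s vLo \<and> ar s2 aCy = ar s aCy \<and>
      (\<forall>i<j. ar s2 0 i = ar s aCy (vr s vLo + i))" and iv: "vr s2 vJ = j" "vr s2 vLen = k"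
    have "vr s vLo + j < H" using j le by (intro bnd_sum) (simp add: k_def)
    moreover have "j < F" using j kn F by simp
    ultimately show "wp H F (St 0 (V vJ) (Rd aCy (V vLo .+ V vJ))) (\<lambda>t' s'. t + t' + 2 \<le> 3 * Suc j \<and>
      vr (setv vJ (Suc j) s') vLo = vr s vLo \<and> ar (setv vJ (Suc j) s') aCy = ar s aCy \<and>
      (\<forall>i<Suc j. ar (setv vJ (Suc j) s') 0 i = ar s aCy (vr s vLo + i))) s2"
      using I by (simp add: wp_eqs iv less_Suc_eq)
  qed (use kn bnd_sum[of k] in auto)
  have c: "map f [0..<k] = cyl s" if "\<forall>i<k. f i = ar s aCy (vr s vLo + i)" for f
    using that by (intro nth_equalityI) (auto simp: cyl_def k_def)
  show ?thesis
    unfolding emit_def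
    apply (simp add: wp_eqs k_def[symmetric])
    apply (rule wp_conseq, rule loop)
    using c kn by auto
qed

end

text \<open>\<open>enat\<close> is well ordered, so the infimum of a nonempty set is one of its
  members.\<close>

lemma girth_attained:
  assumes "is_cycle E c0"
  obtains c where "is_cycle E c" "girth E w = enat (cycle_weight w c)"
proof -
  define S where "S = (\<lambda>c. enat (cycle_weight w c)) ` {c. is_cycle E c}"
  have "S \<noteq> {}" using assms by (auto simp: S_def)
  then have "Inf S \<in> S" unfolding Inf_enat_def by (auto intro: LeastI)
  then show ?thesis using that by (auto simp: S_def girth_def)
qed

context ram_input
begin

text \<open>The bodies of \<open>ball_time\<close> and \<open>round_time\<close> are repeated
  because these belong to the locale of the sorted lists, which are chosen only during the
  run.\<close>

definition high_time :: "nat \<Rightarrow> real" where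
  "high_time L = real ((16 * lg + 18) * (2 * card E) + 15 * n + 2 * L + 18 + (5 * L + 8) * n + n *
      ((16 * lg + 50) * (L + 2) + L * (L * 13 + 6) + (8 * lg + 8) * L + 14 * L + 24)) +
    (real n * ln (real n) / real L + 1) *
      (real ((16 * lg + 50) * (n + 2) + (8 * lg + 8) * n + 17 * n + 30) + 1)"

text \<open>Zeroed arrays and variables provide the initial invariants: no ball is registered and
  the stored cycle is empty. Each phase then hands its invariant to the next.\<close>

lemma wp_girth_prog:
  assumes i: "input s" and z: "\<And>a i. a \<noteq> 0 \<Longrightarrow> ar s a i = 0" "\<And>x. vr s x = 0"
  shows "wp H F girth_prog (\<lambda>t s'. (\<exists>L. 1 \<le> L \<and> n \<le> L ^ 3 \<and> (L = 1 \<or> (L - 1) ^ 3 < n) \<and> real t \<le> high_time L) \<and>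
    (if \<exists>c. is_cycle E c then girth_approximation 2 E w (map (ar s' 0) [0..<vr s' vLen])
     else map (ar s' 0) [0..<vr s' vLen] = []) \<and> vr s' vLen \<le> n) s"
  unfolding girth_prog_def
  apply (rule wp_Sq, rule wp_conseq, rule wp_prep[OF i z(1)], assumption)
  subgoal premises p for t1 s1
  proof -
    obtain srt where S: "ram_search n E w M H F lg srt" and cl: "ram_search.clean n E w srt s1"
      and t1: "t1 \<le> (16 * lg + 18) * (2 * card E) + 7 * n + 3" using p(1) by blast
    interpret S: ram_search n E w M H F lg srt by (rule S)
    have st1: "S.stat s1" using cl by (simp add: S.clean_def)
    note N1 = S.statD(1)[OF st1]
    have z1: "ar s1 a i = 0" if "a \<in> {aBig, aMem, aCnt, aLst, aCy}" for a i
      using p(3)[of a] z(1)[of a i] that by auto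
    have v1: "vr s1 vLo = 0" "vr s1 vHi = 0" "vr s1 vBest = 0" using p(2) z(2) by simp_all
    show ?thesis
      apply (rule wp_Sq, rule wp_conseq, rule wp_ball_size[OF N1])
      subgoal premises q for t2 s2
      proof -
        define L where "L = vr s2 vL"
        have L: "1 \<le> L" "n \<le> L ^ 3" "L = 1 \<or> (L - 1) ^ 3 < n" and t2: "t2 \<le> 2 * L + 4"
          and vB: "vr s2 vBall = L"
          using q(1) by (auto simp: L_def)
        have a2: "ar s2 = ar s1" using q(3) by auto
        have v2: "vr s2 vLo = 0" "vr s2 vHi = 0" "vr s2 vBest = 0" "vr s2 vN = vr s1 vN"
          using q(2) v1 by simp_all
        have "S.stat s2" by (rule S.stat_cong[OF st1]) (simp_all add: v2 a2)
        then have "S.clean s2" using cl by (simp add: S.clean_def a2)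
        moreover have "S.sound s2" by (simp add: S.sound_def v2)
        moreover have b2: "S.unhit s2 = {}" "S.ball s2 = (\<lambda>_. {})"
          by (simp_all add: S.unhit_def S.ball_def a2 z1 fun_eq_iff)
        moreover have "S.reg L s2" by (simp add: S.reg_def b2 a2 z1)
        ultimately have bi: "S.ball_inv L 0 s2" by (simp add: S.ball_inv_def L_def a2 z1)
        show ?thesis
          apply (rule wp_Sq, rule wp_conseq, rule S.wp_balls[OF bi L(1)])
          subgoal premises r for t3 s3
          proof -
            have bi3: "S.ball_inv L n s3" and t3: "t3 \<le> n * S.ball_time L + 2" using r(1) by blast+
            have vB3: "vr s3 vBall = L" using r(2) vB by simp
            show ?thesis
              apply (rule wp_Sq, rule wp_conseq, rule S.wp_greedy[OF bi3 vB3 L(1)])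
              subgoal premises u for t4 s4
              proof -
                have so: "S.sound s4"
                  and t4: "real t4 \<le> (real n * ln (real n) / real L + 1) * (real S.round_time + 1) +
                    real ((5 * L + 8) * n + 5 * n + 6)"
                  and ok: "\<And>v. v < n \<Longrightarrow> full_ok v (vr s4 vBest) \<or> ball_ok v (vr s4 vBest) (S.ball s4 v) \<and>
                    (\<exists>u\<in>S.ball s4 v. full_ok u (vr s4 vBest))"
                  using u(1) by blast+
                \<comment> \<open>Valid for every cycle, seen from its own first vertex; only
                  afterwards is it applied to a cycle that attains the girth.\<close>
                have best: "vr s4 vBest \<noteq> 0 \<and> vr s4 vBest \<le> 2 * cycle_weight w c" if c: "is_cycle E c" for c
                proof (rule approximation[OF c])
                  have "0 < length c" using c by (auto simp: is_cycle_def)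
                  then have "c ! 0 < n" using cycle_edge[OF c] edgeD by blast
                  from ok[OF this] show "full_ok (c ! 0) (vr s4 vBest) \<or>
                    (\<exists>X. ball_ok (c ! 0) (vr s4 vBest) X \<and> (\<exists>u\<in>X. full_ok u (vr s4 vBest)))" by blast
                qed
                have out: "if \<exists>c. is_cycle E c then girth_approximation 2 E w (S.cyl s4) else S.cyl s4 = []"
                proof (cases "\<exists>c. is_cycle E c")
                  case True
                  then obtain c where c: "is_cycle E c" "girth E w = enat (cycle_weight w c)"
                    using girth_attained by blast
                  have "is_cycle E (S.cyl s4)" "cycle_weight w (S.cyl s4) \<le> vr s4 vBest"
                    using so best[OF c(1)] by (auto simp: S.sound_def)
                  then have "girth_approximation 2 E w (S.cyl s4)"
                    using best[OF c(1)] by (simp add: girth_approximation_def c(2))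
                  then show ?thesis using True by simp
                next
                  case False
                  then have "vr s4 vBest = 0" using so by (auto simp: S.sound_def)
                  then have "S.cyl s4 = []" using so by (simp add: S.sound_def S.cyl_def)
                  then show ?thesis using False by simp
                qed
                show ?thesis
                  apply (rule wp_conseq, rule S.wp_emit[OF so])
                  subgoal premises x for t5 s5
                  proof -
                    have "real (t1 + (t2 + (t3 + (t4 + t5)))) \<le> high_time L"
                    proof -
                      have "t1 + t2 + t3 + t5 \<le> (16 * lg + 18) * (2 * card E) + 10 * n + 2 * L + 12 +
                        n * ((16 * lg + 50) * (L + 2) + L * (L * 13 + 6) + (8 * lg + 8) * L + 14 * L + 24)"
                        using t1 t2 t3 x(1) unfolding S.ball_time_def by linarith
                      then have "real (t1 + t2 + t3 + t5) \<le> real ((16 * lg + 18) * (2 * card E) + 10 * n + 2 * L + 12 +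
                        n * ((16 * lg + 50) * (L + 2) + L * (L * 13 + 6) + (8 * lg + 8) * L + 14 * L + 24))"
                        by (rule of_nat_mono)
                      then show ?thesis
                        using t4 unfolding high_time_def S.round_time_def by simp
                    qed
                    then show ?thesis using L out x(1) by auto
                  qed
                  done
              qed
              done
          qed
          done
      qed
      done
  qed
  done

end

text \<open>With p = n^(1/3) and l = log (n + 1) the condition on \<open>L\<close> means p \<le> L
  \<le> 2 p. The balls then cost p^3 times O(l p^2), and O(l p^2) greedy rounds cost O(l p^3) each,
  so both are O(l^2 p^5); preprocessing adds O(l m).\<close>

lemma time_bound:
  fixes n m lg L :: nat
  assumes n: "1 \<le> n" and L: "1 \<le> L" "n \<le> L ^ 3" "L = 1 \<or> (L - 1) ^ 3 < n"
    and lg: "real lg \<le> log 2 (real n + 1) + 2"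
  shows "real ((16 * lg + 18) * (2 * m) + 15 * n + 2 * L + 18 + (5 * L + 8) * n + n *
      ((16 * lg + 50) * (L + 2) + L * (L * 13 + 6) + (8 * lg + 8) * L + 14 * L + 24)) +
    (real n * ln (real n) / real L + 1) *
      (real ((16 * lg + 50) * (n + 2) + (8 * lg + 8) * n + 17 * n + 30) + 1)
    \<le> 2600 * log 2 (real n + 1) ^ 2 * (real n powr (5 / 3) + real m)"
proof -
  define p where "p = real n powr (1 / 3)"
  define l where "l = log 2 (real n + 1)"
  define k where "k = real L"
  have l1: "1 \<le> l" unfolding l_def using n by (simp add: le_log_iff)
  have lgl: "real lg \<le> 3 * l" using lg l1 unfolding l_def by linarith
  have p3: "p ^ 3 = real n" unfolding p_def using n by (simp add: powr_realpow[symmetric] powr_powr)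
  have p5: "p ^ 5 = real n powr (5 / 3)" unfolding p_def using n by (simp add: powr_realpow[symmetric] powr_powr)
  have p1: "1 \<le> p" unfolding p_def using n by (simp add: ge_one_powr_ge_zero)
  have p0: "0 \<le> p" using p1 by simp
  have k1: "1 \<le> k" using L by (simp add: k_def)
  have kp: "k \<le> 2 * p"
  proof (cases "L = 1")
    case True
    then show ?thesis using p1 by (simp add: k_def)
  next
    case False
    then have "(L - 1) ^ 3 < n" using L by blast
    then have "real ((L - 1) ^ 3) < real n" by (simp only: of_nat_less_iff)
    moreover have "real ((L - 1) ^ 3) = (k - 1) ^ 3" using L(1) by (simp add: k_def of_nat_diff)
    ultimately have "(k - 1) ^ 3 < p ^ 3" by (simp only: p3)
    then have "k - 1 < p" using p0 by (rule power_less_imp_less_base)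
    then show ?thesis using p1 by simp
  qed
  have pk: "p \<le> k"
  proof -
    have "real n \<le> real (L ^ 3)" using L by (simp only: of_nat_le_iff)
    then have "p ^ 3 \<le> k ^ 3" by (simp add: p3 k_def)
    then show ?thesis using power_mono_iff[of p k 3] p0 k1 by simp
  qed
  have N: "real n = p ^ 3" by (simp add: p3)
  have mm: "0 \<le> real m" by simp
  have ll: "1 \<le> l ^ 2" "l \<le> l ^ 2" using l1 by (simp_all add: power2_eq_square mult_ge1_I)
  have p31: "1 \<le> p ^ 3" using p1 by simp
  have p35: "p ^ 3 * p \<le> p ^ 5" "p ^ 3 \<le> p ^ 5"
    using power_increasing[of 4 5 p] power_increasing[of 3 5 p] p1 by (simp_all add: eval_nat_numeral mult_ac)
  have a1: "(16 * real lg + 18) * (2 * real m) \<le> 132 * l ^ 2 * real m"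
  proof -
    have "(16 * real lg + 18) * (2 * real m) \<le> (66 * l) * (2 * real m)"
      using lgl l1 by (intro mult_right_mono) auto
    also have "\<dots> = 132 * (l * real m)" by simp
    also have "\<dots> \<le> 132 * (l ^ 2 * real m)" using mult_right_mono[OF ll(2) mm] by simp
    finally show ?thesis by simp
  qed
  have a2: "15 * real n + 2 * k + 18 + (5 * k + 8) * real n \<le> 96 * (l ^ 2 * p ^ 5)"
  proof -
    \<comment> \<open>The coefficients 23, 2, 18 and 5 add up to 48, each term is dominated by
      \<open>k * p ^ 3\<close>, and this is at most \<open>2 * p ^ 5\<close>; hence 96.\<close>
    have "15 * real n + 2 * k + 18 + (5 * k + 8) * real n = 23 * p ^ 3 + 2 * k + 18 + 5 * (k * p ^ 3)"
      by (simp add: N algebra_simps)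
    moreover have kn: "k * p ^ 3 \<ge> p ^ 3" "k * p ^ 3 \<ge> k" "k * p ^ 3 \<ge> 1"
      using mult_right_mono[OF k1, of "p ^ 3"] mult_left_mono[OF p31, of k] k1 p31 p0 by auto
    moreover have "k * p ^ 3 \<le> 2 * p ^ 5"
    proof -
      have "k * p ^ 3 \<le> 2 * p * p ^ 3" using p0 by (intro mult_right_mono[OF kp]) simp
      also have "\<dots> = 2 * (p ^ 3 * p)" by simp
      finally show ?thesis using p35(1) by linarith
    qed
    moreover have "p ^ 5 \<le> l ^ 2 * p ^ 5" using mult_right_mono[OF ll(1), of "p ^ 5"] p0 by simp
    ultimately show ?thesis by linarith
  qed
  have a3: "real n * ((16 * real lg + 50) * (k + 2) + k * (k * 13 + 6) + (8 * real lg + 8) * k + 14 * k + 24)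
    \<le> 1600 * (l ^ 2 * p ^ 5)"
  proof -
    have "(16 * real lg + 50) * (k + 2) \<le> (98 * l) * (3 * k)"
      using lgl l1 k1 by (intro mult_mono) auto
    moreover have "(8 * real lg + 8) * k \<le> (32 * l) * k" using lgl l1 k1 by (intro mult_right_mono) auto
    moreover have lk: "l * k \<le> l * (k * k)" "k \<le> k * k" "1 \<le> k * k" "k * k \<le> l * (k * k)"
      using k1 l1 mult_right_mono[OF l1, of "k * k"] by (auto simp: mult_ge1_I intro!: mult_left_mono)
    \<comment> \<open>The coefficients add up to 294 + 32 + 57 = 383, rounded up to 400; replacing
      \<open>k\<close> by \<open>2 * p\<close> below multiplies by 4.\<close>
    ultimately have "(16 * real lg + 50) * (k + 2) + k * (k * 13 + 6) + (8 * real lg + 8) * k + 14 * k + 24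
      \<le> 400 * (l * (k * k))"
      by (simp add: algebra_simps)
    also have "\<dots> \<le> 400 * (l ^ 2 * (2 * p * (2 * p)))"
      using kp k1 ll l1 p0 by (intro mult_left_mono mult_mono) auto
    finally have "real n * ((16 * real lg + 50) * (k + 2) + k * (k * 13 + 6) + (8 * real lg + 8) * k + 14 * k + 24)
      \<le> real n * (400 * (l ^ 2 * (2 * p * (2 * p))))" by (intro mult_left_mono) auto
    also have "\<dots> = 1600 * (l ^ 2 * p ^ 5)" by (simp add: N eval_nat_numeral)
    finally show ?thesis .
  qed
  have a4: "(real n * ln (real n) / k + 1) *
      ((16 * real lg + 50) * (real n + 2) + (8 * real lg + 8) * real n + 17 * real n + 30 + 1)
      \<le> 800 * (l ^ 2 * p ^ 5)"
  proof -
    have "(16 * real lg + 50) * (real n + 2) \<le> (98 * l) * (3 * real n)"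
      using lgl l1 n by (intro mult_mono) auto
    moreover have "(8 * real lg + 8) * real n \<le> (32 * l) * real n" using lgl l1 by (intro mult_right_mono) auto
    moreover have "real n \<le> l * real n" "1 \<le> l * real n" using mult_right_mono[OF l1, of "real n"] mult_ge1_I[of l "real n"] n l1 by auto
    ultimately have r: "(16 * real lg + 50) * (real n + 2) + (8 * real lg + 8) * real n + 17 * real n + 30 + 1
      \<le> 400 * (l * real n)" by (simp add: algebra_simps)
    have "ln (real n) \<le> l"
    proof -
      have "ln (real n) \<le> ln (real n + 1)" using n by simp
      also have "\<dots> \<le> ln (real n + 1) / ln 2"
        using n ln_2_less_1 by (simp add: le_divide_eq mult_left_le)
      finally show ?thesis by (simp add: l_def log_def)
    qed
    then have "real n * ln (real n) / k \<le> real n * l / p"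
      using pk p1 l1 n by (intro frac_le mult_left_mono) auto
    also have "\<dots> = p ^ 2 * l" using p1 by (simp add: N eval_nat_numeral)
    finally have "real n * ln (real n) / k + 1 \<le> 2 * (p ^ 2 * l)"
      using mult_ge1_I[of "p ^ 2" l] p1 l1 by simp
    then have "(real n * ln (real n) / k + 1) *
      ((16 * real lg + 50) * (real n + 2) + (8 * real lg + 8) * real n + 17 * real n + 30 + 1)
      \<le> 2 * (p ^ 2 * l) * (400 * (l * real n))"
      using r n k1 l1 p0 by (intro mult_mono) auto
    also have "\<dots> = 800 * (l ^ 2 * p ^ 5)" by (simp add: N eval_nat_numeral)
    finally show ?thesis .
  qed
  have "real ((16 * lg + 18) * (2 * m) + 15 * n + 2 * L + 18 + (5 * L + 8) * n + n *
      ((16 * lg + 50) * (L + 2) + L * (L * 13 + 6) + (8 * lg + 8) * L + 14 * L + 24)) +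
    (real n * ln (real n) / real L + 1) *
      (real ((16 * lg + 50) * (n + 2) + (8 * lg + 8) * n + 17 * n + 30) + 1) =
    (16 * real lg + 18) * (2 * real m) + (15 * real n + 2 * k + 18 + (5 * k + 8) * real n) +
    real n * ((16 * real lg + 50) * (k + 2) + k * (k * 13 + 6) + (8 * real lg + 8) * k + 14 * k + 24) +
    (real n * ln (real n) / k + 1) *
      ((16 * real lg + 50) * (real n + 2) + (8 * real lg + 8) * real n + 17 * real n + 30 + 1)"
    by (simp add: k_def algebra_simps)
  \<comment> \<open>2496 = 96 + 1600 + 800.\<close>
  also have "\<dots> \<le> 132 * l ^ 2 * real m + 2496 * (l ^ 2 * p ^ 5)"
    using a1 a2 a3 a4 by linarith
  also have "\<dots> \<le> 2600 * l ^ 2 * (p ^ 5 + real m)"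
  proof -
    have "0 \<le> l ^ 2 * real m" "0 \<le> l ^ 2 * p ^ 5" using p0 by simp_all
    then show ?thesis by (simp add: algebra_simps)
  qed
  finally show ?thesis by (simp add: p5 l_def)
qed

text \<open>The prologue puts \<open>F\<close> into register 2, as compiled array accesses expect:
  cell 0 contains n, and cell n + 1 the address behind the last list, which is the input length.
  Registers 4 and 6 are temporaries.\<close>

definition girth_com :: com where
  "girth_com = Seq (Load 4 0) (Seq (Const 6 1) (Seq (Arith Plus 4 4 6) (Seq (Load 2 4) (cp girth_prog))))"

text \<open>The first witness \<open>girth_com\<close> runs within words below (n + M + 1)^12. Of
  the two logarithmic factors one comes from the tournament and one from the size of the hitting
  set. In the constant, 4 counts the prologue and 2600 comes from \<open>time_bound\<close>,
  multiplied by the slowdown of the compiler.\<close>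

theorem theorem1:
  "\<exists>(P :: com) (d :: nat) (C :: real) (a :: nat) (b :: nat).
     \<forall>(n :: nat) (E :: nat set set) (w :: nat set \<Rightarrow> nat) (M :: nat) (A :: (nat \<times> nat) list list).
       simple_graph n E \<longrightarrow> connected_graph n E \<longrightarrow>
       1 \<le> M \<longrightarrow> (\<forall>e\<in>E. w e \<in> {1..M}) \<longrightarrow> adjacency_lists n E w A \<longrightarrow>
       (\<exists>t s. exec ((n + M + 1) ^ d) P (initial_state (encode_graph A)) t s \<and>
          real t \<le> C * log 2 (real n + 1) ^ a *
            (real n powr (5 / 3) * log 2 (real M + 1) ^ b + real (card E)) \<and>
          (if \<exists>c. is_cycle E c then girth_approximation 2 E w (output_of s)
           else output_of s = []))"
proof (rule exI[of _ girth_com], rule exI[of _ 12], rule exI[of _ "real (psz girth_prog) * 2600 + 4"],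
    rule exI[of _ 2], rule exI[of _ 0], intro allI impI)
  fix n E w M A
  assume g: "simple_graph n E" and M: "1 \<le> M" and wt: "\<forall>e\<in>E. w e \<in> {1..M}" and adj: "adjacency_lists n E w A"
  define xs where "xs = encode_graph A"
  define F where "F = length xs"
  define H where "H = 8 * ((n + 1) * (n + 1) * (M + 1))"
  \<comment> \<open>The summand 1 is there because the tournament has up to 2 n nodes.\<close>
  define lg where "lg = nat \<lceil>log 2 (real n + 1)\<rceil> + 1"
  define Z where "Z = n + M + 1"
  define B where "B = Z ^ 12"
  have n: "0 < n" using g by (simp add: simple_graph_def)
  have lA: "length A = n" using adj by (simp add: adjacency_lists_def)
  have F0: "n < F" unfolding F_def xs_def using encode_graph_nth(1)[of A] lA by (simp add: start_def)
  have lg2: "2 * n \<le> 2 ^ lg"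
  proof -
    have "real n \<le> 2 powr (log 2 (real n + 1))" by simp
    also have "\<dots> \<le> 2 powr (real (nat \<lceil>log 2 (real n + 1)\<rceil>))"
      by (intro powr_mono) (linarith, simp)
    also have "\<dots> = 2 ^ nat \<lceil>log 2 (real n + 1)\<rceil>" by (rule powr_realpow) simp
    finally have "real n \<le> real (2 ^ nat \<lceil>log 2 (real n + 1)\<rceil>)" by simp
    then have "n \<le> 2 ^ nat \<lceil>log 2 (real n + 1)\<rceil>" by (simp only: of_nat_le_iff)
    then show ?thesis by (simp add: lg_def)
  qed
  have lgl: "real lg \<le> log 2 (real n + 1) + 2"
  proof -
    have "0 \<le> log 2 (real n + 1)" by simp
    then have "real (nat \<lceil>log 2 (real n + 1)\<rceil>) \<le> log 2 (real n + 1) + 1" by linarith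
    then show ?thesis unfolding lg_def of_nat_add of_nat_1 by linarith
  qed
  interpret I: ram_input n E w M H F lg A
    by unfold_locales (use g wt adj F0 lg2 in \<open>auto simp: H_def F_def xs_def\<close>)
  define s0 where "s0 = Hst (\<lambda>_. 0) (\<lambda>a i. if a = 0 \<and> i < F then xs ! i else 0)"
  have inp: "I.input s0" by (simp add: I.input_def s0_def xs_def)
  note D = I.inputD[OF inp]
  obtain t s where h: "hex H F girth_prog s0 t s"
    and T: "\<exists>L. 1 \<le> L \<and> n \<le> L ^ 3 \<and> (L = 1 \<or> (L - 1) ^ 3 < n) \<and> real t \<le> I.high_time L"
    and out: "if \<exists>c. is_cycle E c then girth_approximation 2 E w (map (ar s 0) [0..<vr s vLen])
       else map (ar s 0) [0..<vr s vLen] = []"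
    and len: "vr s vLen \<le> n"
    using I.wp_girth_prog[OF inp] unfolding wp_def by (auto simp: s0_def)
  have FH: "F < H" by (rule I.F_H)
  \<comment> \<open>Every input word is the vertex count, a list address (at most \<open>F\<close>),
    a neighbour or a weight.\<close>
  have bd: "bounded H s0"
  proof -
    have "x < H" if "x \<in> set xs" for x
    proof -
      have flat: "\<exists>v k. (v, k) \<in> set ys \<and> (x = v \<or> x = k)"
        if "x \<in> set (concat (map (\<lambda>(v, k). [v, k]) ys))" for ys :: "(nat \<times> nat) list"
        using that by (induction ys) auto
      have up: "\<exists>u\<le>n. x = start A u"
        if "x \<in> set (map (\<lambda>u. 2 + length A + 2 * length (concat (take u A))) [0..<Suc (length A)])"
      proof -
        from that obtain u where "u \<in> set [0..<Suc (length A)]" "x = 2 + length A + 2 * length (concat (take u A))"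
          unfolding set_map by blast
        then show ?thesis by (intro exI[of _ u]) (auto simp: start_def lA)
      qed
      from that have "x \<in> set [length A] \<or>
          x \<in> set (map (\<lambda>u. 2 + length A + 2 * length (concat (take u A))) [0..<Suc (length A)]) \<or>
          x \<in> set (concat (map (\<lambda>(v, k). [v, k]) (concat A)))"
        unfolding xs_def encode_graph_def set_append by blast
      then have "x = n \<or> (\<exists>u\<le>n. x = start A u) \<or> (\<exists>v k. (v, k) \<in> set (concat A) \<and> (x = v \<or> x = k))"
      proof (elim disjE)
        assume "x \<in> set [length A]"
        then show ?thesis by (simp add: lA)
      next
        assume "x \<in> set (map (\<lambda>u. 2 + length A + 2 * length (concat (take u A))) [0..<Suc (length A)])"
        from up[OF this] show ?thesis by blast
      next
        assume "x \<in> set (concat (map (\<lambda>(v, k). [v, k]) (concat A)))"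
        from flat[OF this] show ?thesis by blast
      qed
      then consider "x = n" | u where "u \<le> n" "x = start A u"
        | v k where "(v, k) \<in> set (concat A)" "x = v \<or> x = k"
        by blast
      then show ?thesis
      proof cases
        case 1
        then show ?thesis using F0 FH by simp
      next
        case 2
        have "F = start A n" unfolding F_def xs_def using encode_graph_nth(1)[of A] lA by simp
        then show ?thesis using 2 start_le[of A u] FH lA by simp
      next
        case 3
        then obtain l where "l \<in> set A" "(v, k) \<in> set l" by auto
        then obtain u where u: "u < n" "(v, k) \<in> set (A ! u)" using lA by (metis in_set_conv_nth)
        then have v: "v \<in> I.nbrs u" "k = w {u, v}" using I.adjD(2)[OF u(1)] by auto
        have "v < n" "k \<le> M" using I.nbrs_lt[OF v(1)] wt v(2) by auto
        then have "v < H" "k < H" by (auto intro: I.bnd_sum)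
        then show ?thesis using 3 by blast
      qed
    qed
    then show ?thesis using FH by (simp add: bounded_def s0_def F_def)
  qed
  have B: "F + 16 * H + 16 \<le> B"
  proof -
    have Z: "3 \<le> Z" "n \<le> Z" using n M by (simp_all add: Z_def)
    have "F \<le> 2 + n + 2 * (n * n)" by (rule D(7))
    also have "\<dots> \<le> 4 * Z ^ 3"
    proof -
      have "n * n \<le> Z * Z" using Z by (intro mult_le_mono)
      moreover have "Z * Z * 1 \<le> Z * Z * Z" using Z by (intro mult_le_mono2) simp
      moreover have "Z * 3 \<le> Z * Z" using Z by (intro mult_le_mono2)
      ultimately show ?thesis unfolding power3_eq_cube using Z by linarith
    qed
    finally have "F \<le> 4 * Z ^ 3" .
    moreover have "(n + 1) * (n + 1) * (M + 1) \<le> Z * Z * Z"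
      using n M by (intro mult_le_mono) (simp_all add: Z_def)
    then have "H \<le> 8 * Z ^ 3" by (simp add: H_def power3_eq_cube)
    moreover have "16 \<le> 16 * Z ^ 3" using Z by simp
    \<comment> \<open>148 = 4 + 16 * 8 + 16; as Z \<ge> 3, the factor is absorbed by Z^9, which
      leads to the exponent 12.\<close>
    ultimately have "F + 16 * H + 16 \<le> 148 * Z ^ 3" by linarith
    also have "\<dots> \<le> Z ^ 9 * Z ^ 3"
    proof (rule mult_le_mono1)
      have "(148::nat) \<le> 3 ^ 9" by simp
      also have "\<dots> \<le> Z ^ 9" by (intro power_mono) (use Z in simp_all)
      finally show "148 \<le> Z ^ 9" .
    qed
    also have "\<dots> = B" by (simp add: B_def power_add[symmetric])
    finally show ?thesis .
  qed
  define z0 where "z0 = initial_state xs"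
  define z1 where "z1 = set_reg 4 n z0"
  define z2 where "z2 = set_reg 6 1 z1"
  define z3 where "z3 = set_reg 4 (n + 1) z2"
  define z4 where "z4 = set_reg 2 F z3"
  have m0: "mem z0 i = (if i < F then xs ! i else 0)" for i by (simp add: z0_def initial_state_def F_def)
  have r0: "regs z0 r = 0" for r by (simp add: z0_def initial_state_def)
  have lt: "n + 1 < B" "F < B" "1 < B" using F0 B by auto
  have x0: "xs ! 0 = n" unfolding xs_def using encode_graph_nth(2)[of A] lA by simp
  have x1: "xs ! Suc n = F"
    unfolding xs_def F_def using encode_graph_nth(3)[of n A] encode_graph_nth(1)[of A] lA by simp
  have e1: "exec B (Load 4 0) z0 1 z1"
    unfolding z1_def using F0 lt by (intro exec.Load) (simp_all add: r0 m0 x0)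
  have e2: "exec B (Const 6 1) z1 1 z2" unfolding z2_def using lt by (intro exec.Const)
  have e3: "exec B (Arith Plus 4 4 6) z2 1 z3"
    unfolding z3_def using lt by (intro exec.Arith) (simp_all add: z2_def z1_def)
  have e4: "exec B (Load 2 4) z3 1 z4"
    unfolding z4_def using lt D(6) by (intro exec.Load) (simp_all add: z3_def z2_def z1_def m0 x1)
  have rl: "rel F s0 z4"
    unfolding rel_def by (auto simp: z4_def z3_def z2_def z1_def r0 m0 s0_def adr_val_def) presburger+
  obtain t' z where e5: "exec B (cp girth_prog) z4 t' z" and t': "t' \<le> psz girth_prog * t" and rz: "rel F s z"
    using compile_correct[OF h bd rl girth_prog_parr B] by blast
  have ex: "exec B girth_com z0 (1 + (1 + (1 + (1 + t')))) z"
    unfolding girth_com_def by (rule exec.Seq[OF e1 exec.Seq[OF e2 exec.Seq[OF e3 exec.Seq[OF e4 e5]]]])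
  have oz: "output_of z = map (ar s 0) [0..<vr s vLen]"
  proof -
    have "regs z 1 = vr s 0" using rz[unfolded rel_def, THEN conjunct1, rule_format, of 0] by simp
    moreover have "regs z 0 = 0" "\<And>i. i < F \<Longrightarrow> mem z i = ar s 0 i" using rz by (simp_all add: rel_def)
    ultimately show ?thesis using len F0 by (simp add: output_of_def)
  qed
  let ?S = "log 2 (real n + 1) ^ 2 * (real n powr (5 / 3) + real (card E))"
  have tt: "real t \<le> 2600 * ?S"
  proof -
    obtain L where L: "1 \<le> L" "n \<le> L ^ 3" "L = 1 \<or> (L - 1) ^ 3 < n" "real t \<le> I.high_time L"
      using T by blast
    have "1 \<le> n" using n by simp
    from time_bound[OF this L(1-3) lgl, of "card E"] L(4) show ?thesis
      unfolding I.high_time_def by simp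
  qed
  \<comment> \<open>Lets the four prologue instructions be absorbed into the multiplicative
    constant.\<close>
  have S1: "1 \<le> ?S"
  proof -
    have "1 \<le> log 2 (real n + 1)" using n by (simp add: le_log_iff)
    then have "1 \<le> log 2 (real n + 1) ^ 2" by simp
    moreover have "1 \<le> real n powr (5 / 3)" using n by (simp add: ge_one_powr_ge_zero)
    then have "1 \<le> real n powr (5 / 3) + real (card E)" by simp
    ultimately show ?thesis using mult_mono[of 1 _ 1] by fastforce
  qed
  have "real (1 + (1 + (1 + (1 + t')))) \<le> 4 + real (psz girth_prog) * real t"
    using t' by (simp flip: of_nat_mult)
  also have "\<dots> \<le> 4 * ?S + real (psz girth_prog) * (2600 * ?S)"
    using S1 mult_left_mono[OF tt, of "real (psz girth_prog)"] by linarith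
  also have "\<dots> = (real (psz girth_prog) * 2600 + 4) * ?S" by (simp only: ring_distribs mult_ac add_ac)
  finally have tf: "real (1 + (1 + (1 + (1 + t')))) \<le> (real (psz girth_prog) * 2600 + 4) * ?S" .
  show "\<exists>t s. exec ((n + M + 1) ^ 12) girth_com (initial_state (encode_graph A)) t s \<and>
          real t \<le> (real (psz girth_prog) * 2600 + 4) * log 2 (real n + 1) ^ 2 *
            (real n powr (5 / 3) * log 2 (real M + 1) ^ 0 + real (card E)) \<and>
          (if \<exists>c. is_cycle E c then girth_approximation 2 E w (output_of s)
           else output_of s = [])"
  proof (intro exI conjI)
    show "exec ((n + M + 1) ^ 12) girth_com (initial_state (encode_graph A)) (1 + (1 + (1 + (1 + t')))) z"
      using ex by (simp only: B_def Z_def z0_def xs_def)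
    show "real (1 + (1 + (1 + (1 + t')))) \<le> (real (psz girth_prog) * 2600 + 4) * log 2 (real n + 1) ^ 2 *
            (real n powr (5 / 3) * log 2 (real M + 1) ^ 0 + real (card E))"
      using tf by (simp only: power_0 mult_1_right mult.assoc)
    show "if \<exists>c. is_cycle E c then girth_approximation 2 E w (output_of z) else output_of z = []"
      using out unfolding oz .
  qed
qed

end
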